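(* A Banach space $X$ is reflexive and asymptotic-$c_0$ if and only if there exists $C\ge 1$ such that for every $k\in\mathbb{N}$ and every Lipschitz map $f:\big([\mathbb{N}]^k,d^{(k)}_{\mathbb{H}}\big)\to X$ there exists $\mathbb{M}\in[\mathbb{N}]^\omega$ so that $$\mathrm{diam}\big(f([\mathbb{M}]^k)\big)\le C\,\mathrm{Lip}(f).$$
   Context: Banach spaces are real. For $\mathbb{M}\subset\mathbb{N}$, $[\mathbb{M}]^k$ is the set of subsets of $\mathbb{M}$ with exactly $k$ elements, and $[\mathbb{N}]^\omega$ is the set of infinite subsets of $\mathbb{N}$. Elements of sets $\bar m=\{m_1,\dots,m_k\}$ are always listed in increasing order. The Hamming distance on $[\mathbb{N}]^k$ is $d^{(k)}_{\mathbb{H}}(\bar m,\bar n)=|\{i\in\{1,\dots,k\}:m_i\ne n_i\}|$. For a map $f$ between metric spaces, $\mathrm{Lip}(f)=\sup\{d(f(x),f(y))/d(x,y): d(x,y)>0\}$, and $f$ is Lipschitz if $\mathrm{Lip}(f)<\infty$. $S_Z$ denotes the unit sphere of a Banach space $Z$, and $\mathrm{cof}(X)$ denotes the set of closed finite-codimensional subspaces of $X$. Equivalence: for $C\ge 1$, two linearly independent finite sequences $(x_i)_{i=1}^k$, $(y_i)_{i=1}^k$ in Banach spaces are $C$-equivalent, written $(x_i)\sim_C(y_i)$, if there are $A,B>0$ with $C=A\cdot B$ such that for all scalars $a_1,\dots,a_k$, $\frac1A\|\sum_{i=1}^k a_ix_i\|\le\|\sum_{i=1}^k a_iy_i\|\le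 B\|\sum_{i=1}^k a_ix_i\|$. Asymptotic structure: $\mathcal{E}_k$ is the set of all norms on $\mathbb{R}^k$ for which the unit vector basis $(e_j)_{j=1}^k$ is a normalized monotone basis. For a Banach space $X$ and $k\in\mathbb{N}$, the $k$-th asymptotic structure $\{X\}_k$ is the set of all $E=(\mathbb{R}^k,\|\cdot\|)\in\mathcal{E}_k$ such that $$\forall \varepsilon>0\ \forall X_1\in\mathrm{cof}(X)\ \exists x_1\in S_{X_1}\ \forall X_2\in\mathrm{cof}(X)\ \exists x_2\in S_{X_2}\cdots\forall X_k\in\mathrm{cof}(X)\ \exists x_k\in S_{X_k}:\ (x_j)_{j=1}^k\sim_{1+\varepsilon}(e_j)_{j=1}^k.$$ For $C\ge 1$, $X$ is $C$-asymptotic-$c_0$ if for all $k\in\mathbb{N}$ and all $E\in\{X\}_k$, the basis $(e_j)_{j=1}^k$ of $E$ is $C$-equivalent to the unit vector basis of $\ell_\infty^k$. $X$ is asymptotic-$c_0$ if it is $C$-asymptotic-$c_0$ for some $C\ge1$. *)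

theory Defs
  imports
    "HOL-Analysis.Analysis"
    "HOL-Analysis.Finite_Function_Topology"
    "HOL-Library.Ramsey"
begin

text \<open>Surjectivity of the canonical embedding into the bidual.\<close>

definition reflexive_space :: "'a::real_normed_vector itself \<Rightarrow> bool" where
  "reflexive_space _ \<longleftrightarrow>
     (\<forall>\<Phi> :: ('a \<Rightarrow>\<^sub>L real) \<Rightarrow>\<^sub>L real. \<exists>x :: 'a. \<forall>\<phi>.
        blinfun_apply \<Phi> \<phi> = blinfun_apply \<phi> x)"

text \<open>Finite codimension: the classes of finitely many vectors span the quotient by \<open>Y\<close>.\<close>

definition cof :: "'a::real_normed_vector set set" where
  "cof = {Y. subspace Y \<and> closed Y \<and> (\<exists>F. finite F \<and> span (Y \<union> F) = UNIV)}"

definition lin_indep_seq :: "nat \<Rightarrow> (nat \<Rightarrow> 'v::real_vector) \<Rightarrow> bool" where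
  "lin_indep_seq k x \<longleftrightarrow> inj_on x {..<k} \<and> independent (x ` {..<k})"

text \<open>
  The norms are explicit arguments because the norm on \<open>\<real>\<^sup>k\<close> varies. Finite sequences of
  length \<open>k\<close> are indexed by \<open>0, \<dots>, k - 1\<close>.
\<close>

definition equivalent_seqs ::
  "real \<Rightarrow> nat \<Rightarrow> ('v::real_vector \<Rightarrow> real) \<Rightarrow> (nat \<Rightarrow> 'v)
     \<Rightarrow> ('w::real_vector \<Rightarrow> real) \<Rightarrow> (nat \<Rightarrow> 'w) \<Rightarrow> bool" where
  "equivalent_seqs C k p x q y \<longleftrightarrow>
     lin_indep_seq k x \<and> lin_indep_seq k y \<and>
     (\<exists>A B. A > 0 \<and> B > 0 \<and> C = A * B \<and>
        (\<forall>a :: nat \<Rightarrow> real.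
           1 / A * p (\<Sum>i<k. a i *\<^sub>R x i) \<le> q (\<Sum>i<k. a i *\<^sub>R y i) \<and>
           q (\<Sum>i<k. a i *\<^sub>R y i) \<le> B * p (\<Sum>i<k. a i *\<^sub>R x i)))"

text \<open>
  \<open>\<real>\<^sup>k\<close>, for a dimension \<open>k\<close> that is a bound variable, is the span of the first \<open>k\<close> unit
  vectors in the space of finitely supported real sequences. The library's norm on that
  space plays no role.
\<close>

definition unit_vec :: "nat \<Rightarrow> (nat \<Rightarrow>\<^sub>0 real)" where
  "unit_vec j = Poly_Mapping.single j 1"

definition Rk :: "nat \<Rightarrow> (nat \<Rightarrow>\<^sub>0 real) set" where
  "Rk k = span (unit_vec ` {..<k})"

definition norm_on :: "'v::real_vector set \<Rightarrow> ('v \<Rightarrow> real) \<Rightarrow> bool" where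
  "norm_on V N \<longleftrightarrow>
     (\<forall>v\<in>V. 0 \<le> N v \<and> (N v = 0 \<longleftrightarrow> v = 0)) \<and>
     (\<forall>c. \<forall>v\<in>V. N (c *\<^sub>R v) = \<bar>c\<bar> * N v) \<and>
     (\<forall>v\<in>V. \<forall>w\<in>V. N (v + w) \<le> N v + N w)"

text \<open>
  The set \<open>\<E>\<^sub>k\<close>. Membership constrains \<open>N\<close> only on \<open>Rk k\<close>; its values elsewhere are never used.
\<close>

definition normalized_monotone_norms :: "nat \<Rightarrow> ((nat \<Rightarrow>\<^sub>0 real) \<Rightarrow> real) set" where
  "normalized_monotone_norms k = {N. norm_on (Rk k) N \<and>
     (\<forall>j<k. N (unit_vec j) = 1) \<and>
     (\<forall>(a :: nat \<Rightarrow> real) m n. m \<le> n \<longrightarrow> n \<le> k \<longrightarrow>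
        N (\<Sum>i<m. a i *\<^sub>R unit_vec i) \<le> N (\<Sum>i<n. a i *\<^sub>R unit_vec i))}"

text \<open>
  \<open>asymptotic_game P n xs\<close> is the formula with \<open>n\<close> remaining alternations
  ``for all \<open>Y \<in> cof\<close> there is \<open>x\<close> in the unit sphere of \<open>Y\<close>'' in front of \<open>P\<close>;
  \<open>xs\<close> lists the vectors already chosen, oldest first.
\<close>

primrec asymptotic_game ::
  "('a::real_normed_vector list \<Rightarrow> bool) \<Rightarrow> nat \<Rightarrow> 'a list \<Rightarrow> bool" where
  "asymptotic_game P 0 xs \<longleftrightarrow> P xs"
| "asymptotic_game P (Suc n) xs \<longleftrightarrow>
     (\<forall>Y\<in>cof. \<exists>x\<in>Y. norm x = 1 \<and> asymptotic_game P n (xs @ [x]))"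

definition asymptotic_structure ::
  "'a::real_normed_vector itself \<Rightarrow> nat \<Rightarrow> ((nat \<Rightarrow>\<^sub>0 real) \<Rightarrow> real) set" where
  "asymptotic_structure _ k = {N \<in> normalized_monotone_norms k.
     \<forall>\<epsilon>>0. asymptotic_game
       (\<lambda>xs :: 'a list. equivalent_seqs (1 + \<epsilon>) k norm (\<lambda>i. xs ! i) N unit_vec) k []}"

definition linf_norm :: "nat \<Rightarrow> (nat \<Rightarrow>\<^sub>0 real) \<Rightarrow> real" where
  "linf_norm k v = Max ((\<lambda>i. \<bar>Poly_Mapping.lookup v i\<bar>) ` {..<k})"

definition C_asymptotic_c0 :: "real \<Rightarrow> 'a::real_normed_vector itself \<Rightarrow> bool" where
  "C_asymptotic_c0 C T \<longleftrightarrow>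
     (\<forall>k\<ge>1. \<forall>N \<in> asymptotic_structure T k.
        equivalent_seqs C k N unit_vec (linf_norm k) unit_vec)"

definition asymptotic_c0 :: "'a::real_normed_vector itself \<Rightarrow> bool" where
  "asymptotic_c0 T \<longleftrightarrow> (\<exists>C\<ge>1. C_asymptotic_c0 C T)"

definition hamming_dist :: "nat \<Rightarrow> nat set \<Rightarrow> nat set \<Rightarrow> real" where
  "hamming_dist k m n =
     real (card {i. i < k \<and> sorted_list_of_set m ! i \<noteq> sorted_list_of_set n ! i})"

text \<open>
  The domain is a carrier set \<open>S\<close> with an explicit metric \<open>d\<close>. The supremum in \<open>Lip\<close> is taken
  in the reals, so \<open>Lip\<close> is meaningful when \<open>is_Lipschitz\<close> holds and \<open>S\<close> has two points.
\<close>

definition lipschitz_quotients ::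
  "'s set \<Rightarrow> ('s \<Rightarrow> 's \<Rightarrow> real) \<Rightarrow> ('s \<Rightarrow> 'b::metric_space) \<Rightarrow> real set" where
  "lipschitz_quotients S d f = {dist (f x) (f y) / d x y | x y. x \<in> S \<and> y \<in> S \<and> d x y > 0}"

definition is_Lipschitz ::
  "'s set \<Rightarrow> ('s \<Rightarrow> 's \<Rightarrow> real) \<Rightarrow> ('s \<Rightarrow> 'b::metric_space) \<Rightarrow> bool" where
  "is_Lipschitz S d f \<longleftrightarrow> bdd_above (lipschitz_quotients S d f)"

definition Lip ::
  "'s set \<Rightarrow> ('s \<Rightarrow> 's \<Rightarrow> real) \<Rightarrow> ('s \<Rightarrow> 'b::metric_space) \<Rightarrow> real" where
  "Lip S d f = Sup (lipschitz_quotients S d f)"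

end

theory Submission
  imports Defs
begin

text \<open>
Everything rests on one device. Fix a free ultrafilter \<open>U\<close> on the natural numbers. In a reflexive
space bounded families have weak limits along \<open>U\<close>, and a property that
holds for \<open>U\<close>-almost all \<open>l\<^sub>1\<close>, for \<open>U\<close>-almost all \<open>l\<^sub>2\<close>, ..., for \<open>U\<close>-almost all \<open>l\<^sub>k\<close> holds for all
increasing \<open>k\<close>-tuples from a suitable infinite set (\<open>iter_ev_infinite_set\<close>). So \<open>U\<close> takes over the
role of Ramsey arguments and of passages to subsequences. A weakly null tree is a bounded family
\<open>x\<^sub>t\<close> indexed by finite lists such that \<open>x\<^bsub>t@[l]\<^esub> \<rightarrow> 0\<close> weakly as \<open>l \<rightarrow> U\<close>; its branch sums are the
vectors \<open>x\<^bsub>[l\<^sub>1]\<^esub> + x\<^bsub>[l\<^sub>1,l\<^sub>2]\<^esub> + \<dots> + x\<^bsub>[l\<^sub>1,\<dots>,l\<^sub>k]\<^esub>\<close>. Both directions are statements about the size of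
branch sums.

From reflexive and asymptotic-\<open>c\<^sub>0\<close> to concentration: let \<open>f\<close> be Lipschitz and take weak limits of
\<open>f(l\<^sub>1,\<dots>,l\<^sub>k)\<close> along \<open>U\<close>, one coordinate after the other, beginning with the last. The differences of
consecutive limits form a weakly null tree (\<open>weak_limit_tree\<close>) whose nodes have norm at most
\<open>Lip(f)\<close>, because a change of one coordinate moves \<open>f\<close> by at most \<open>Lip(f)\<close>, and
\<open>f(l\<^sub>1,\<dots>,l\<^sub>k)\<close> minus the total limit is a branch sum. The norm \<open>a \<mapsto> lim \<parallel>\<Sum> a\<^sub>i x\<^bsub>[l\<^sub>1,\<dots>,l\<^sub>i]\<^esub>\<parallel>\<close>
defined by a normalized weakly null tree belongs to the asymptotic structure, since its nodes can be
moved into prescribed subspaces of finite codimension (\<open>type_norm_asymptotic\<close>). Hence it is dominated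
by \<open>C\<close> times the sup norm, and \<open>U\<close>-almost all branch sums are small (\<open>weak_null_tree_bound\<close>).

From concentration to the properties of the space: concentration is applied only to arrays, that is, to maps
\<open>f(m\<^sub>1,\<dots>,m\<^sub>k) = w\<^sub>1(m\<^sub>1) + \<dots> + w\<^sub>k(m\<^sub>k)\<close>. They are Lipschitz with constant \<open>2 sup \<parallel>w\<^sub>i(m)\<parallel>\<close>, whatever the
number of rows (\<open>array_concentration\<close>). In a non-reflexive space James' sequence, taken as every row
of an array, contradicts concentration (\<open>concentration_imp_reflexive\<close>).

For asymptotic-\<open>c\<^sub>0\<close>, reflexivity first turns the game that defines the asymptotic structure into a
weakly null tree with countable branching (\<open>game_tree\<close>). Its branch sums have to be bounded, but as
functions of \<open>(l\<^sub>1,\<dots>,l\<^sub>k)\<close> they have no good Lipschitz constant: a change of \<open>l\<^sub>1\<close> changes all later nodes. The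
remedy is to sum over all prefixes at once: let \<open>w\<^sub>i(m)\<close> be the sum of all nodes that extend a node
labelled by a set of \<open>i - 1\<close> numbers below \<open>m\<close>. In a generic subtree (\<open>separated_subtree\<close>) two things
happen. Firstly, \<open>w\<^sub>i(m)\<close> is itself the value of an array, with very many rows, so that concentration
gives \<open>\<parallel>w\<^sub>i(m)\<parallel> \<le> 2 C\<close>. Secondly, a functional that norms a branch sum, decomposed along the tree by
weak-star limits, is almost zero at all nodes off that branch. Now \<open>f(m\<^sub>1,\<dots>,m\<^sub>k) = \<Sum> w\<^sub>i(m\<^sub>i)\<close> has Lipschitz
constant at most \<open>4 C\<close>; the functional of the branch \<open>m\<^sub>1 < \<dots> < m\<^sub>k\<close> sees the norm of its branch sum in
\<open>f(m\<^sub>1,\<dots>,m\<^sub>k)\<close> and almost nothing in \<open>f(n\<^sub>1,\<dots>,n\<^sub>k)\<close> if \<open>m\<^sub>k < n\<^sub>1\<close>. Concentration for this second array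
bounds branch sums by \<open>4 C\<^sup>2 + 1\<close> (\<open>concentration_tree_bound\<close>).
\<close>

section \<open>The Hahn--Banach theorem\<close>

definition sublinear :: "('a::real_vector \<Rightarrow> real) \<Rightarrow> bool" where
  "sublinear p \<longleftrightarrow> (\<forall>x y. p (x + y) \<le> p x + p y) \<and> (\<forall>c\<ge>0. \<forall>x. p (c *\<^sub>R x) = c * p x)"

lemma sublinearI:
  assumes "\<And>x y. p (x + y) \<le> p x + p y" and "\<And>c x. c > 0 \<Longrightarrow> p (c *\<^sub>R x) \<le> c * p x" and "p 0 = 0"
  shows "sublinear p"
proof -
  have "p (c *\<^sub>R x) = c * p x" if "c \<ge> 0" for c x
  proof (cases "c = 0")
    case True then show ?thesis using assms(3) by simp
  next
    case False
    then have c: "c > 0" using that by simp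
    have "p x = p ((1/c) *\<^sub>R (c *\<^sub>R x))" using c by simp
    also have "\<dots> \<le> (1/c) * p (c *\<^sub>R x)" using assms(2)[of "1/c" "c *\<^sub>R x"] c by (simp del: scaleR_scaleR)
    finally have "c * p x \<le> p (c *\<^sub>R x)" using c by (simp add: field_simps)
    then show ?thesis using assms(2)[OF c, of x] by simp
  qed
  then show ?thesis using assms(1) by (auto simp: sublinear_def)
qed

lemma sublinear_0: "sublinear p \<Longrightarrow> p 0 = 0"
  unfolding sublinear_def by (metis mult_zero_left order_refl scaleR_zero_left)

lemma sublinear_neg_le: assumes "sublinear p" shows "- p (- x) \<le> p x"
proof -
  have "p (x + - x) \<le> p x + p (- x)" using assms unfolding sublinear_def by blast
  then show ?thesis using sublinear_0[OF assms] by simp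
qed

text \<open>Three infima occur below: over a chain in Zorn's lemma, over shifts in one direction, and over
a subspace. They are sublinear for one reason: the family is closed, up to domination, under addition
and positive scaling.\<close>

lemma sublinear_INF:
  fixes q :: "'i \<Rightarrow> 'a::real_vector \<Rightarrow> real"
  assumes ne: "I \<noteq> {}" and low: "\<And>i x. i \<in> I \<Longrightarrow> l x \<le> q i x"
    and add: "\<And>i j x y. i \<in> I \<Longrightarrow> j \<in> I \<Longrightarrow> \<exists>k\<in>I. q k (x + y) \<le> q i x + q j y"
    and scale: "\<And>i c x. i \<in> I \<Longrightarrow> c > 0 \<Longrightarrow> \<exists>k\<in>I. q k (c *\<^sub>R x) \<le> c * q i x"
    and zero: "\<exists>i\<in>I. q i 0 \<le> 0" "\<And>i. i \<in> I \<Longrightarrow> 0 \<le> q i 0"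
  defines "r \<equiv> \<lambda>x. INF i\<in>I. q i x"
  shows "sublinear r" and "\<And>i x. i \<in> I \<Longrightarrow> r x \<le> q i x"
proof -
  have le: "r x \<le> q i x" if "i \<in> I" for i x
    unfolding r_def by (rule cINF_lower[OF bdd_belowI2 that]) (rule low)
  then show "\<And>i x. i \<in> I \<Longrightarrow> r x \<le> q i x" .
  have great: "b \<le> r x" if "\<And>i. i \<in> I \<Longrightarrow> b \<le> q i x" for b x
    unfolding r_def using ne that by (rule cINF_greatest)
  show "sublinear r"
  proof (rule sublinearI)
    fix x y
    have "r (x + y) \<le> q i x + q j y" if "i \<in> I" "j \<in> I" for i j
      using add[OF that] le order_trans by blast
    then have "r (x + y) - q i x \<le> r y" if "i \<in> I" for i
      using that by (intro great) (smt (verit))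
    then have "r (x + y) - r y \<le> r x" by (intro great) (smt (verit))
    then show "r (x + y) \<le> r x + r y" by simp
  next
    fix c :: real and x assume c: "c > 0"
    have "r (c *\<^sub>R x) / c \<le> q i x" if "i \<in> I" for i
    proof -
      have "r (c *\<^sub>R x) \<le> c * q i x" using scale[OF that c] le order_trans by blast
      then show ?thesis using c by (simp add: field_simps)
    qed
    then have "r (c *\<^sub>R x) / c \<le> r x" by (rule great)
    then show "r (c *\<^sub>R x) \<le> c * r x" using c by (simp add: field_simps)
  next
    have "0 \<le> r 0" using zero(2) by (rule great)
    moreover obtain i where "i \<in> I" "q i 0 \<le> 0" using zero(1) by blast
    then have "r 0 \<le> 0" using le order_trans by blast
    ultimately show "r 0 = 0" by simp
  qed
qed

lemma sublinear_chain_inf: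
  fixes p :: "'a::real_vector \<Rightarrow> real"
  assumes ne: "C \<noteq> {}" and C: "\<And>q. q \<in> C \<Longrightarrow> sublinear q \<and> q \<le> p"
    and chain: "\<And>q r. q \<in> C \<Longrightarrow> r \<in> C \<Longrightarrow> q \<le> r \<or> r \<le> q"
  shows "sublinear (\<lambda>x. INF q\<in>C. q x)" and "\<And>q. q \<in> C \<Longrightarrow> (\<lambda>x. INF q\<in>C. q x) \<le> q"
proof -
  have low: "- p (- x) \<le> q x" if "q \<in> C" for q x
  proof -
    have "q (- x) \<le> p (- x)" using C[OF that] by (simp add: le_fun_def)
    then show ?thesis using C[OF that] sublinear_neg_le[of q x] by linarith
  qed
  have add: "\<exists>s\<in>C. s (x + y) \<le> q x + r y" if qr: "q \<in> C" "r \<in> C" for q r x y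
  proof -
    have "\<exists>s\<in>C. s \<le> q \<and> s \<le> r" using chain[OF qr] qr by blast
    then obtain s where s: "s \<in> C" "s \<le> q" "s \<le> r" by blast
    have "s (x + y) \<le> s x + s y" using C s(1) by (auto simp: sublinear_def)
    also have "\<dots> \<le> q x + r y" using s by (intro add_mono) (auto simp: le_fun_def)
    finally show ?thesis using s(1) by blast
  qed
  have scale: "\<exists>k\<in>C. k (c *\<^sub>R x) \<le> c * q x" if "q \<in> C" "c > 0" for q c x
    using that C[OF that(1)] by (intro bexI[of _ q]) (auto simp: sublinear_def)
  have zero: "q 0 = 0" if "q \<in> C" for q using C[OF that] sublinear_0 by blast
  then have zero': "\<exists>q\<in>C. q 0 \<le> 0" "\<And>q. q \<in> C \<Longrightarrow> 0 \<le> q 0" using ne by fastforce+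
  show "sublinear (\<lambda>x. INF q\<in>C. q x)"
    by (rule sublinear_INF(1)[where q = "\<lambda>q. q" and l = "\<lambda>x. - p (- x)"]; fact)
  have "(INF q\<in>C. q x) \<le> q x" if "q \<in> C" for q x
    by (rule sublinear_INF(2)[where q = "\<lambda>q. q" and l = "\<lambda>x. - p (- x)"]; fact)
  then show "(\<lambda>x. INF q\<in>C. q x) \<le> q" if "q \<in> C" for q using that by (simp add: le_fun_def)
qed

text \<open>If \<open>q\<close> were not additive, then pushing \<open>x\<close> far in the direction \<open>y\<close> would produce a smaller sublinear function, namely the \<open>r\<close> of the proof.\<close>

lemma minimal_sublinear_additive:
  fixes q :: "'a::real_vector \<Rightarrow> real"
  assumes q: "sublinear q" and min: "\<And>r. sublinear r \<Longrightarrow> r \<le> q \<Longrightarrow> r = q"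
  shows "q (x + y) = q x + q y"
proof -
  \<comment> \<open>Minimality will give \<open>r = q\<close>; then \<open>t = 1\<close> in the infimum is the missing inequality.\<close>
  define r where "r x = (INF t\<in>{0..}. q (x + t *\<^sub>R y) - t * q y)" for x
  have low: "- q (- x) \<le> q (x + t *\<^sub>R y) - t * q y" if "t \<ge> 0" for x t
  proof -
    have "t * q y = q ((x + t *\<^sub>R y) + (- x))" using q that by (simp add: sublinear_def)
    also have "\<dots> \<le> q (x + t *\<^sub>R y) + q (- x)" using q unfolding sublinear_def by blast
    finally show ?thesis by simp
  qed
  have add: "\<exists>k\<in>{0..}. q (u + v + k *\<^sub>R y) - k * q y \<le> (q (u + s *\<^sub>R y) - s * q y) + (q (v + t *\<^sub>R y) - t * q y)"
    if "s \<in> {0..}" "t \<in> {0..}" for s t u v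
  proof -
    have "q ((u + s *\<^sub>R y) + (v + t *\<^sub>R y)) \<le> q (u + s *\<^sub>R y) + q (v + t *\<^sub>R y)"
      using q unfolding sublinear_def by blast
    then show ?thesis using that by (intro bexI[of _ "s + t"]) (simp_all add: algebra_simps)
  qed
  have scale: "\<exists>k\<in>{0..}. q (c *\<^sub>R u + k *\<^sub>R y) - k * q y \<le> c * (q (u + t *\<^sub>R y) - t * q y)"
    if "t \<in> {0..}" "c > 0" for t c u
  proof -
    have "q (c *\<^sub>R (u + t *\<^sub>R y)) = c * q (u + t *\<^sub>R y)" using q that(2) by (simp add: sublinear_def)
    then show ?thesis using that by (intro bexI[of _ "c * t"]) (simp_all add: algebra_simps)
  qed
  have zero: "\<exists>t\<in>{0..}. q (0 + t *\<^sub>R y) - t * q y \<le> 0" "\<And>t. t \<in> {0..} \<Longrightarrow> 0 \<le> q (0 + t *\<^sub>R y) - t * q y"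
    using q sublinear_0[OF q] by (auto simp: sublinear_def intro: bexI[of _ 0])
  have ne: "{0::real..} \<noteq> {}" and low': "\<And>t x. t \<in> {0..} \<Longrightarrow> - q (- x) \<le> q (x + t *\<^sub>R y) - t * q y"
    using low by auto
  have rle: "r x \<le> q (x + t *\<^sub>R y) - t * q y" if "t \<in> {0..}" for x t
    unfolding r_def by (rule sublinear_INF(2)[where q = "\<lambda>t x. q (x + t *\<^sub>R y) - t * q y" and l = "\<lambda>x. - q (- x)"]; fact)
  have "sublinear r"
    unfolding r_def by (rule sublinear_INF(1)[where q = "\<lambda>t x. q (x + t *\<^sub>R y) - t * q y" and l = "\<lambda>x. - q (- x)"]; fact)
  moreover have "r \<le> q" using rle[of 0] by (simp add: le_fun_def)
  ultimately have "r = q" by (rule min)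
  then have "q x \<le> q (x + y) - q y" using rle[of 1 x] by simp
  moreover have "q (x + y) \<le> q x + q y" using q unfolding sublinear_def by blast
  ultimately show ?thesis by simp
qed

theorem linear_below_sublinear:
  fixes p :: "'a::real_vector \<Rightarrow> real"
  assumes p: "sublinear p"
  obtains f where "linear f" "\<And>x. f x \<le> p x"
proof -
  let ?A = "{q. sublinear q \<and> q \<le> p}"
  have po: "partial_order_on ?A (relation_of (\<lambda>x y. y \<le> x) ?A)"
    by (rule partial_order_on_relation_ofI) auto
  have "\<exists>m\<in>?A. \<forall>q\<in>?A. m \<ge> q \<longrightarrow> q = m"
  proof (rule predicate_Zorn[OF po])
    fix C assume C: "C \<in> Chains (relation_of (\<lambda>x y. y \<le> x) ?A)"
    then have CA: "\<And>q. q \<in> C \<Longrightarrow> sublinear q \<and> q \<le> p" and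
      ch: "\<And>q r. q \<in> C \<Longrightarrow> r \<in> C \<Longrightarrow> q \<le> r \<or> r \<le> q"
      by (auto simp: Chains_def relation_of_def)
    show "\<exists>u\<in>?A. \<forall>q\<in>C. u \<le> q"
    proof (cases "C = {}")
      case True then show ?thesis using p by auto
    next
      case False
      note inf = sublinear_chain_inf[OF False CA ch]
      obtain q where "q \<in> C" using False by blast
      then show ?thesis using inf CA by (intro bexI[of _ "\<lambda>x. INF q\<in>C. q x"]) (auto intro: order_trans)
    qed
  qed
  then obtain q where q: "sublinear q" "q \<le> p" and
    min: "\<And>r. sublinear r \<Longrightarrow> r \<le> p \<Longrightarrow> r \<le> q \<Longrightarrow> r = q" by blast
  have add: "q (x + y) = q x + q y" for x y
    using q(1) by (rule minimal_sublinear_additive) (use q(2) min in \<open>auto intro: order_trans\<close>)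
  have neg: "q (- x) = - q x" for x
    using add[of x "- x"] sublinear_0[OF q(1)] by simp
  have "q (c *\<^sub>R x) = c * q x" for c x
  proof (cases "c \<ge> 0")
    case True then show ?thesis using q(1) by (simp add: sublinear_def)
  next
    case False
    then have "q ((- c) *\<^sub>R x) = (- c) * q x" using q(1) unfolding sublinear_def by (metis neg_0_le_iff_le nle_le)
    then show ?thesis using neg[of "c *\<^sub>R x"] by simp
  qed
  then have "linear q" using add by (intro linearI) auto
  then show ?thesis using that q(2) by (auto simp: le_fun_def)
qed

text \<open>Extension is a special case of the existence of a linear minorant: replace \<open>p\<close> by the largest sublinear function that is below \<open>p\<close> everywhere and below \<open>f\<close> on \<open>S\<close>. A linear minorant cannot be strictly below \<open>f\<close> anywhere on \<open>S\<close>, because \<open>S = - S\<close>.\<close>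

theorem Hahn_Banach:
  fixes p :: "'a::real_vector \<Rightarrow> real"
  assumes p: "sublinear p" and S: "subspace S"
    and add: "\<And>x y. x \<in> S \<Longrightarrow> y \<in> S \<Longrightarrow> f (x + y) = f x + f y"
    and scale: "\<And>c x. x \<in> S \<Longrightarrow> f (c *\<^sub>R x) = c * f x"
    and le: "\<And>x. x \<in> S \<Longrightarrow> f x \<le> p x"
  obtains g where "linear g" "\<And>x. g x \<le> p x" "\<And>x. x \<in> S \<Longrightarrow> g x = f x"
proof -
  define r where "r x = (INF y\<in>S. p (x - y) + f y)" for x
  have S0: "0 \<in> S" using S by (rule subspace_0)
  then have f0: "f 0 = 0" using scale[of 0 0] by simp
  have low: "- p (- x) \<le> p (x - y) + f y" if "y \<in> S" for x y
  proof -
    have "f (- y) = - f y" using scale[OF that, of "-1"] by simp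
    then have "- f y \<le> p (- y)" using le[of "- y"] S that by (simp add: subspace_neg)
    moreover have "p ((x - y) + (- x)) \<le> p (x - y) + p (- x)" using p unfolding sublinear_def by blast
    ultimately show ?thesis by simp
  qed
  have sum: "\<exists>k\<in>S. p (u + v - k) + f k \<le> (p (u - y) + f y) + (p (v - z) + f z)" if "y \<in> S" "z \<in> S" for y z u v
  proof -
    have "p ((u - y) + (v - z)) \<le> p (u - y) + p (v - z)" using p unfolding sublinear_def by blast
    then show ?thesis using add[OF that] subspace_add[OF S that]
      by (intro bexI[of _ "y + z"]) (simp_all add: algebra_simps)
  qed
  have mult: "\<exists>k\<in>S. p (c *\<^sub>R u - k) + f k \<le> c * (p (u - y) + f y)" if "y \<in> S" "c > 0" for y c u
  proof -
    have "p (c *\<^sub>R (u - y)) = c * p (u - y)" using p that(2) by (simp add: sublinear_def)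
    then show ?thesis using scale[OF that(1)] subspace_scale[OF S that(1)]
      by (intro bexI[of _ "c *\<^sub>R y"]) (simp_all add: algebra_simps)
  qed
  have zero: "\<exists>y\<in>S. p (0 - y) + f y \<le> 0" "\<And>y. y \<in> S \<Longrightarrow> 0 \<le> p (0 - y) + f y"
    using S0 f0 sublinear_0[OF p] low[of _ 0] by (auto intro: bexI[of _ 0])
  have ne: "S \<noteq> {}" using S0 by blast
  have rle: "r x \<le> p (x - y) + f y" if "y \<in> S" for x y
    unfolding r_def by (rule sublinear_INF(2)[where q = "\<lambda>y x. p (x - y) + f y" and l = "\<lambda>x. - p (- x)"]; fact)
  have "sublinear r"
    unfolding r_def by (rule sublinear_INF(1)[where q = "\<lambda>y x. p (x - y) + f y" and l = "\<lambda>x. - p (- x)"]; fact)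
  then obtain g where g: "linear g" "\<And>x. g x \<le> r x" by (rule linear_below_sublinear) blast
  have "g x \<le> p x" for x using g(2)[of x] rle[OF S0, of x] f0 by simp
  moreover have le': "g x \<le> f x" if "x \<in> S" for x
    using g(2)[of x] rle[OF that, of x] sublinear_0[OF p] by simp
  moreover have "g x = f x" if "x \<in> S" for x
  proof -
    have "g (- x) \<le> f (- x)" using le' S that by (simp add: subspace_neg)
    then show ?thesis
      using le'[OF that] scale[OF that, of "-1"] linear_neg[OF g(1), of x] by simp
  qed
  ultimately show ?thesis using g(1) that by blast
qed

type_synonym 'a dual = "'a \<Rightarrow>\<^sub>L real"

lemma blinfun_of_bounded:
  fixes g :: "'a::real_normed_vector \<Rightarrow> real"
  assumes g: "linear g" and le: "\<And>x. g x \<le> B * norm x"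
  obtains \<phi> :: "'a dual" where "\<And>x. blinfun_apply \<phi> x = g x" "\<And>x. \<bar>\<phi> x\<bar> \<le> B * norm x"
proof -
  have ab: "\<bar>g x\<bar> \<le> B * norm x" for x
    using le[of x] le[of "- x"] linear_neg[OF g, of x] by simp
  have "bounded_linear g"
    using ab by (intro bounded_linear_intro[of g B] linear_add[OF g] linear_scale[OF g]) (auto simp: mult.commute)
  then show ?thesis using that[of "Blinfun g"] ab by (simp add: bounded_linear_Blinfun_apply)
qed

text \<open>The functional \<open>y + c x \<mapsto> c d\<close> on the span of \<open>Y\<close> and \<open>x\<close> is bounded by the norm, since \<open>x\<close> has distance at least \<open>d\<close> from \<open>Y\<close>.\<close>

lemma separating_functional:
  fixes Y :: "'a::real_normed_vector set"
  assumes Y: "subspace Y" and d: "\<And>y. y \<in> Y \<Longrightarrow> d \<le> norm (x - y)" "d \<ge> 0"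
  obtains \<phi> :: "'a dual" where "\<phi> x = d" "\<And>y. y \<in> Y \<Longrightarrow> \<phi> y = 0" "\<And>y. \<bar>\<phi> y\<bar> \<le> norm y"
proof (cases "d = 0")
  case True
  show ?thesis by (rule that[of 0]) (auto simp: True)
next
  case False
  then have d0: "d > 0" using d by simp
  have p: "sublinear (norm :: 'a \<Rightarrow> real)"
    by (auto simp: sublinear_def norm_triangle_ineq)
  have xY: "x \<notin> Y" using d(1)[of x] d0 by auto
  define f where "f z = (SOME c. z - c *\<^sub>R x \<in> Y) * d" for z
  have uniq: "b = c" if "z - b *\<^sub>R x \<in> Y" "z - c *\<^sub>R x \<in> Y" for b c z
  proof (rule ccontr)
    assume "b \<noteq> c"
    have "(z - c *\<^sub>R x) - (z - b *\<^sub>R x) \<in> Y" using Y that(2,1) by (rule subspace_diff)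
    then have "(b - c) *\<^sub>R x \<in> Y" by (simp add: algebra_simps)
    from subspace_scale[OF Y this, of "1/(b - c)"] show False using xY \<open>b \<noteq> c\<close> by simp
  qed
  have f: "f z = c * d" if "z - c *\<^sub>R x \<in> Y" for z c
    using uniq[OF that someI[where P="\<lambda>c. z - c *\<^sub>R x \<in> Y", OF that]] by (simp add: f_def)
  let ?S = "span (insert x Y)"
  have S: "z \<in> ?S \<longleftrightarrow> (\<exists>c. z - c *\<^sub>R x \<in> Y)" for z
    using Y by (metis span_breakdown_eq span_eq_iff)
  obtain g where g: "linear g" "\<And>y. g y \<le> norm y" "\<And>y. y \<in> ?S \<Longrightarrow> g y = f y"
  proof (rule Hahn_Banach[OF p, of ?S f])
    show "f (y + z) = f y + f z" if yz: "y \<in> ?S" "z \<in> ?S" for y z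
    proof -
      obtain a b where ab: "y - a *\<^sub>R x \<in> Y" "z - b *\<^sub>R x \<in> Y" using yz S by blast
      then have "(y - a *\<^sub>R x) + (z - b *\<^sub>R x) \<in> Y" using Y by (intro subspace_add)
      then have "(y + z) - (a + b) *\<^sub>R x \<in> Y" by (simp add: algebra_simps)
      then have "f (y + z) = (a + b) * d" by (rule f)
      then show ?thesis using f ab by (simp add: distrib_right)
    qed
    show "f (c *\<^sub>R y) = c * f y" if y: "y \<in> ?S" for c y
    proof -
      obtain a where a: "y - a *\<^sub>R x \<in> Y" using y S by blast
      then have "c *\<^sub>R (y - a *\<^sub>R x) \<in> Y" using Y by (intro subspace_scale)
      then have "c *\<^sub>R y - (c * a) *\<^sub>R x \<in> Y" by (simp add: algebra_simps)
      then show ?thesis using f a by simp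
    qed
    show "f y \<le> norm y" if y: "y \<in> ?S" for y
    proof -
      obtain a where a: "y - a *\<^sub>R x \<in> Y" using y S by blast
      show ?thesis
      proof (cases "a = 0")
        case True then show ?thesis using f[OF a] by simp
      next
        case False
        have "- (1/a) *\<^sub>R (y - a *\<^sub>R x) \<in> Y" using a Y by (intro subspace_scale)
        then have "d \<le> norm (x - (- (1/a) *\<^sub>R (y - a *\<^sub>R x)))" by (rule d)
        also have "x - (- (1/a) *\<^sub>R (y - a *\<^sub>R x)) = (1/a) *\<^sub>R y" using False by (simp add: algebra_simps)
        finally have "\<bar>a\<bar> * d \<le> norm y" using False by (simp add: field_simps)
        then show ?thesis using f[OF a] d0
          by (smt (verit) mult_right_mono)
      qed
    qed
  qed (auto simp: subspace_span)
  obtain \<phi> :: "'a dual" where \<phi>: "\<And>x. \<phi> x = g x" "\<And>x. \<bar>\<phi> x\<bar> \<le> 1 * norm x"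
    using blinfun_of_bounded[OF g(1), of 1] g(2) by auto
  have "g x = d" using g(3)[of x] f[of x 1] subspace_0[OF Y] by (simp add: span_base)
  moreover have "g y = 0" if "y \<in> Y" for y using g(3)[of y] f[of y 0] that by (simp add: span_base)
  ultimately show ?thesis using that[of \<phi>] \<phi> by simp
qed

corollary norming_functional:
  fixes x :: "'a::real_normed_vector"
  obtains \<phi> :: "'a dual" where "\<phi> x = norm x" "\<And>y. \<bar>\<phi> y\<bar> \<le> norm y"
  using separating_functional[of "{0}" "norm x" x] by (auto simp: subspace_single_0)

corollary separating_functional_closed:
  fixes Y :: "'a::real_normed_vector set"
  assumes Y: "subspace Y" "closed Y" and x: "x \<notin> Y"
  obtains \<phi> :: "'a dual" where "\<phi> x = 1" "\<And>y. y \<in> Y \<Longrightarrow> \<phi> y = 0"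
proof -
  have ne: "Y \<noteq> {}" using subspace_0[OF Y(1)] by blast
  have pos: "infdist x Y > 0" using Y x ne by (metis in_closed_iff_infdist_zero infdist_nonneg less_eq_real_def)
  have "infdist x Y \<le> norm (x - y)" if "y \<in> Y" for y
    using infdist_le[OF that, of x] by (simp add: dist_norm)
  then obtain \<phi> :: "'a dual" where \<phi>: "\<phi> x = infdist x Y" "\<And>y. y \<in> Y \<Longrightarrow> \<phi> y = 0"
    using separating_functional[OF Y(1), of "infdist x Y" x] infdist_nonneg by metis
  then show ?thesis using that[of "(1/infdist x Y) *\<^sub>R \<phi>"] pos by (simp add: scaleR_blinfun.rep_eq)
qed

lemma abs_blinfun_le: "\<bar>blinfun_apply \<phi> x\<bar> \<le> norm (\<phi> :: 'a::real_normed_vector dual) * norm x"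
  using norm_blinfun[of \<phi> x] by simp

section \<open>Ultrafilters and iterated quantifiers\<close>

definition ultra :: "'a filter \<Rightarrow> bool" where
  "ultra F \<longleftrightarrow> F \<noteq> bot \<and> (\<forall>P. eventually P F \<or> eventually (\<lambda>x. \<not> P x) F)"

lemma ultra_not: "ultra F \<Longrightarrow> \<not> eventually P F \<longleftrightarrow> eventually (\<lambda>x. \<not> P x) F"
  unfolding ultra_def using eventually_conj[of P F "\<lambda>x. \<not> P x"] by (auto simp: eventually_False)

lemma exists_ultra:
  assumes F: "F \<noteq> bot"
  obtains U where "U \<le> F" "ultra U"
proof -
  let ?A = "{G. G \<noteq> bot \<and> G \<le> F}"
  have po: "partial_order_on ?A (relation_of (\<lambda>G H. H \<le> G) ?A)"
    by (rule partial_order_on_relation_ofI) auto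
  have "\<exists>m\<in>?A. \<forall>G\<in>?A. G \<le> m \<longrightarrow> G = m"
  proof (rule predicate_Zorn[OF po])
    fix C assume C: "C \<in> Chains (relation_of (\<lambda>G H. H \<le> G) ?A)"
    then have CA: "C \<subseteq> ?A" and ch: "\<And>G H. G \<in> C \<Longrightarrow> H \<in> C \<Longrightarrow> G \<le> H \<or> H \<le> G"
      by (auto simp: Chains_def relation_of_def)
    show "\<exists>u\<in>?A. \<forall>G\<in>C. u \<le> G"
    proof (cases "C = {}")
      case True then show ?thesis using F by auto
    next
      case False
      then have "eventually (\<lambda>_. False) (Inf C) \<longleftrightarrow> (\<exists>G\<in>C. eventually (\<lambda>_. False) G)"
        by (intro eventually_Inf_base) (use ch in \<open>metis le_inf_iff order_refl\<close>)+
      then have "Inf C \<noteq> bot" using CA by (auto simp: eventually_False)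
      moreover have "Inf C \<le> F" using False CA by (auto intro: Inf_lower2)
      ultimately show ?thesis by (auto intro: Inf_lower)
    qed
  qed
  then obtain U where U: "U \<noteq> bot" "U \<le> F" and
    min: "\<And>G. G \<noteq> bot \<Longrightarrow> G \<le> F \<Longrightarrow> G \<le> U \<Longrightarrow> G = U" by blast
  have "eventually P U \<or> eventually (\<lambda>x. \<not> P x) U" for P
  proof (rule disjCI)
    assume *: "\<not> eventually (\<lambda>x. \<not> P x) U"
    let ?G = "inf U (principal {x. P x})"
    have "?G \<noteq> bot" using * by (simp add: trivial_limit_def eventually_inf_principal)
    then have "?G = U" using U by (intro min) (auto intro: le_infI1)
    moreover have "eventually P ?G" by (simp add: eventually_inf_principal)
    ultimately show "eventually P U" by simp
  qed
  then show ?thesis using that U by (simp add: ultra_def)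
qed

lemma ultra_tendsto:
  fixes f :: "'b \<Rightarrow> real"
  assumes U: "ultra U" and b: "eventually (\<lambda>x. \<bar>f x\<bar> \<le> B) U"
  obtains l where "(f \<longlongrightarrow> l) U"
proof -
  have "filtermap f U \<noteq> bot" using U by (simp add: ultra_def filtermap_bot_iff)
  moreover have "eventually (\<lambda>y. y \<in> {- B..B}) (filtermap f U)"
    using b by (auto simp: eventually_filtermap abs_le_iff elim!: eventually_mono)
  moreover have "compact {- B..B}" by simp
  ultimately obtain l where l: "inf (nhds l) (filtermap f U) \<noteq> bot"
    unfolding compact_filter by blast
  have "(f \<longlongrightarrow> l) U"
  proof (rule topological_tendstoI, rule ccontr)
    fix S assume S: "open S" "l \<in> S" and "\<not> eventually (\<lambda>x. f x \<in> S) U"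
    then have "eventually (\<lambda>y. y \<notin> S) (filtermap f U)"
      using ultra_not[OF U] by (simp add: eventually_filtermap)
    moreover have "eventually (\<lambda>y. y \<in> S) (nhds l)" using S by (rule eventually_nhds_in_open)
    ultimately have "eventually (\<lambda>_. False) (inf (nhds l) (filtermap f U))"
      unfolding eventually_inf by blast
    then show False using l by (simp add: eventually_False)
  qed
  then show ?thesis by (rule that)
qed

text \<open>Quantification over the iterated product of \<open>U\<close> with itself: for almost all \<open>l\<^sub>1\<close>, for almost all \<open>l\<^sub>2\<close>, and so on up to \<open>n\<close>. The list \<open>t\<close> collects the numbers already chosen, so that the same predicate describes what remains to be chosen below a node of a tree.\<close>

primrec iter_ev :: "nat filter \<Rightarrow> nat \<Rightarrow> (nat list \<Rightarrow> bool) \<Rightarrow> nat list \<Rightarrow> bool" where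
  "iter_ev U 0 P t \<longleftrightarrow> P t"
| "iter_ev U (Suc n) P t \<longleftrightarrow> eventually (\<lambda>l. iter_ev U n P (t @ [l])) U"

lemma iter_ev_mono: "(\<And>s. P s \<Longrightarrow> Q s) \<Longrightarrow> iter_ev U n P t \<Longrightarrow> iter_ev U n Q t"
  by (induction n arbitrary: t) (auto elim!: eventually_mono)

lemma iter_ev_True: "iter_ev U n (\<lambda>_. True) t"
  by (induction n arbitrary: t) auto

lemma iter_ev_conj: "iter_ev U n P t \<Longrightarrow> iter_ev U n Q t \<Longrightarrow> iter_ev U n (\<lambda>s. P s \<and> Q s) t"
  by (induction n arbitrary: t) (auto elim: eventually_elim2)

lemma iter_ev_ball_finite:
  "finite S \<Longrightarrow> (\<And>a. a \<in> S \<Longrightarrow> iter_ev U n (P a) t) \<Longrightarrow> iter_ev U n (\<lambda>s. \<forall>a\<in>S. P a s) t"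
proof (induction S rule: finite_induct)
  case empty
  then show ?case by (simp add: iter_ev_True)
next
  case (insert a S)
  then show ?case using iter_ev_conj[of U n "P a" t "\<lambda>s. \<forall>a\<in>S. P a s"] by simp
qed

lemma iter_ev_length: "iter_ev U n (\<lambda>s. length s = length t + n \<and> take (length t) s = t) t"
proof (induction n arbitrary: t)
  case (Suc n)
  have "iter_ev U n (\<lambda>s. length s = length t + Suc n \<and> take (length t) s = t) (t @ [l])" for l
    by (rule iter_ev_mono[OF _ Suc[of "t @ [l]"]])
      (auto, metis append_eq_conv_conj append_take_drop_id butlast_snoc le_add1 take_Suc_conv_app_nth take_take min.absorb1 le_SucI nat_le_linear)
  then show ?case by simp
qed simp

lemma iter_ev_add: "iter_ev U (n + m) P t = iter_ev U n (iter_ev U m P) t"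
  by (induction n arbitrary: t) auto

lemma iter_ev_append: "iter_ev U n P (s @ t) = iter_ev U n (\<lambda>t. P (s @ t)) t"
proof (induction n arbitrary: t)
  case (Suc n)
  show ?case using Suc.IH[of "t @ [_]"] by simp
qed simp

text \<open>The same quantifier as a filter on lists. It is again an ultrafilter, hence iterated limits of bounded functions are ordinary limits along one filter and the usual limit theorems apply to them.\<close>

definition iter_filter :: "nat filter \<Rightarrow> nat \<Rightarrow> nat list filter" where
  "iter_filter U n = Abs_filter (\<lambda>P. iter_ev U n P [])"

lemma eventually_iter_filter: "eventually P (iter_filter U n) \<longleftrightarrow> iter_ev U n P []"
  unfolding iter_filter_def
  by (rule eventually_Abs_filter, rule is_filter.intro)
    (auto intro: iter_ev_True iter_ev_conj iter_ev_mono)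

lemma iter_ev_not:
  assumes "ultra U"
  shows "\<not> iter_ev U n P t \<longleftrightarrow> iter_ev U n (\<lambda>s. \<not> P s) t"
  by (induction n arbitrary: t) (auto simp: ultra_not[OF assms])

lemma ultra_iter_filter: assumes "ultra U" shows "ultra (iter_filter U n)"
proof -
  have "\<not> iter_ev U n (\<lambda>_. False) []"
    using iter_ev_not[OF assms, of n "\<lambda>_. False"] iter_ev_True by simp
  then show ?thesis
    unfolding ultra_def trivial_limit_def eventually_iter_filter
    using iter_ev_not[OF assms] by blast
qed

lemma iter_ev_nth:
  assumes "eventually P U" and "length t \<le> i" and "i < length t + n" 
  shows "iter_ev U n (\<lambda>s. P (s ! i)) t"
  using assms(2,3)
proof (induction n arbitrary: t)
  case (Suc n)
  show ?case
  proof (cases "i = length t")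
    case True
    have "iter_ev U n (\<lambda>s. P (s ! i)) (t @ [l])" if "P l" for l
    proof (rule iter_ev_mono[OF _ iter_ev_length[of U n "t @ [l]"]])
      fix s assume s: "length s = length (t @ [l]) + n \<and> take (length (t @ [l])) s = t @ [l]"
      then have "s ! i = take (length (t @ [l])) s ! i" using True by (intro nth_take[symmetric]) simp
      also have "\<dots> = l" using s True by simp
      finally show "P (s ! i)" using that by simp
    qed
    then show ?thesis using assms(1) by (auto elim!: eventually_mono)
  next
    case False
    then show ?thesis using Suc by simp
  qed
qed simp

lemma filterlim_nth_iter_filter: "i < n \<Longrightarrow> filterlim (\<lambda>s. s ! i) U (iter_filter U n)"
  unfolding filterlim_iff eventually_iter_filter using iter_ev_nth[of _ U "[]" i n] by simp

lemma iter_ev_coordinates: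
  assumes "\<And>i. i < n \<Longrightarrow> eventually (P i) U"
  shows "iter_ev U n (\<lambda>s. \<forall>i<n. P i (s ! i)) []"
proof -
  have "iter_ev U n (\<lambda>s. \<forall>i\<in>{..<n}. P i (s ! i)) []"
    by (rule iter_ev_ball_finite) (auto intro: iter_ev_nth assms)
  then show ?thesis by (simp add: Ball_def)
qed

text \<open>Only the later coordinate has to be generic: the earlier one is a fixed number when the later one is chosen.\<close>

lemma iter_ev_nth2:
  assumes "\<And>a. eventually (\<lambda>b. P a b) U" and "i < j" "j < n"
  shows "iter_ev U n (\<lambda>s. P (s ! i) (s ! j)) []"
proof -
  have "iter_ev U (n - j) (\<lambda>u. P (u ! i) (u ! j)) s" if s: "length s = j" for s
  proof -
    have "iter_ev U (n - j) (\<lambda>u. P (s ! i) (u ! j)) s"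
      by (rule iter_ev_nth[OF assms(1)]) (use s assms in auto)
    then have "iter_ev U (n - j) (\<lambda>u. P (s ! i) (u ! j) \<and> (length u = length s + (n - j) \<and> take (length s) u = s)) s"
      using iter_ev_length by (rule iter_ev_conj)
    then show ?thesis
    proof (rule iter_ev_mono[rotated])
      fix u assume u: "P (s ! i) (u ! j) \<and> (length u = length s + (n - j) \<and> take (length s) u = s)"
      then have "u ! i = s ! i" using assms(2) s nth_take[of i j u] by auto
      then show "P (u ! i) (u ! j)" using u by simp
    qed
  qed
  then have "iter_ev U j (iter_ev U (n - j) (\<lambda>u. P (u ! i) (u ! j))) []"
    using iter_ev_length[of U j "[]"] by (auto elim!: iter_ev_mono[rotated])
  then show ?thesis using iter_ev_add[of U j "n - j" _ "[]"] assms(3) by simp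
qed

lemma iter_ev_pairs:
  assumes "\<And>i j a. i < j \<Longrightarrow> j < n \<Longrightarrow> eventually (P i j a) U"
  shows "iter_ev U n (\<lambda>s. \<forall>j<n. \<forall>i<j. P i j (s ! i) (s ! j)) []"
proof -
  have "iter_ev U n (\<lambda>s. \<forall>j\<in>{..<n}. \<forall>i\<in>{..<j}. P i j (s ! i) (s ! j)) []"
    by (intro iter_ev_ball_finite finite_lessThan iter_ev_nth2 assms) simp_all
  then show ?thesis by (simp add: Ball_def)
qed

text \<open>The quantifiers before level \<open>m\<close> range over arbitrary nodes, and those after it do not affect the first \<open>Suc m\<close> entries.\<close>

lemma iter_ev_level:
  assumes "\<And>t. length t = m \<Longrightarrow> eventually (\<lambda>l. Q (t @ [l])) U" and m: "m < k"
  shows "iter_ev U k (\<lambda>s. Q (take (Suc m) s)) []"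
proof -
  have "iter_ev U (Suc (k - Suc m)) (\<lambda>s. Q (take (Suc m) s)) t" if t: "length t = m" for t
  proof -
    have "iter_ev U (k - Suc m) (\<lambda>s. Q (take (Suc m) s)) (t @ [l])" if "Q (t @ [l])" for l
      by (rule iter_ev_mono[OF _ iter_ev_length]) (use t that in auto)
    then show ?thesis using assms(1)[OF t] by (auto elim: eventually_mono)
  qed
  then have "iter_ev U m (iter_ev U (Suc (k - Suc m)) (\<lambda>s. Q (take (Suc m) s))) []"
    using iter_ev_length[of U m "[]"] by (auto elim!: iter_ev_mono[rotated] simp del: iter_ev.simps)
  then show ?thesis using iter_ev_add[of U m "Suc (k - Suc m)" _ "[]"] m by simp
qed

lemma iter_ev_sorted:
  assumes U: "U \<le> sequentially" and t: "sorted_wrt (<) t"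
  shows "iter_ev U n (sorted_wrt (<)) t"
  using t
proof (induction n arbitrary: t)
  case (Suc n)
  have "eventually (\<lambda>m. \<forall>x\<in>set t. x < m) U"
  proof (rule eventually_ball_finite)
    show "\<forall>x\<in>set t. eventually (\<lambda>m. x < m) U"
      using U by (meson eventually_gt_at_top filter_leD)
  qed simp
  then show ?case using Suc by (auto simp: sorted_wrt_append elim!: eventually_mono)
qed simp

text \<open>The infinite set is built one element at a time. A finite set is kept good in the sense that each of its increasing lists \<open>t\<close> of length at most \<open>k\<close> satisfies the quantifier that remains below \<open>t\<close>; almost every number can be added, since only finitely many lists \<open>t\<close> impose a condition on it.\<close>

lemma iter_ev_infinite_set:
  assumes U: "U \<le> sequentially" "U \<noteq> bot" and P: "iter_ev U k P []"
  obtains M :: "nat set" where "infinite M"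
    "\<And>t. sorted_wrt (<) t \<Longrightarrow> set t \<subseteq> M \<Longrightarrow> length t = k \<Longrightarrow> P t"
proof -
  define L where "L t \<longleftrightarrow> iter_ev U (k - length t) P t" for t
  have step: "eventually (\<lambda>l. L (t @ [l])) U" if "L t" "length t < k" for t
  proof -
    have "k - length t = Suc (k - Suc (length t))" using that by simp
    then show ?thesis using that(1) by (simp add: L_def)
  qed
  \<comment> \<open>\<open>L t\<close> is what remains of the iterated quantifier below \<open>t\<close>; \<open>G\<close> is the invariant of the construction.\<close>
  define G where "G S \<longleftrightarrow> finite S \<and> (\<forall>t. sorted_wrt (<) t \<longrightarrow> set t \<subseteq> S \<longrightarrow> length t \<le> k \<longrightarrow> L t)" for S :: "nat set"
  have ext: "\<exists>m. G (insert m S) \<and> (\<forall>x\<in>S. x < m)" if S: "G S" for S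
  proof -
    let ?T = "{t. set t \<subseteq> S \<and> length t \<le> k}"
    have "finite ?T" using S by (intro finite_lists_length_le) (simp add: G_def)
    then have "eventually (\<lambda>m. \<forall>t\<in>?T. sorted_wrt (<) t \<and> length t < k \<longrightarrow> L (t @ [m])) U"
      by (rule eventually_ball_finite) (use S step in \<open>auto simp: G_def\<close>)
    moreover have "eventually (\<lambda>m. \<forall>x\<in>S. x < m) U"
    proof (rule eventually_ball_finite)
      show "finite S" using S by (simp add: G_def)
      show "\<forall>x\<in>S. eventually (\<lambda>m. x < m) U"
        using U(1) by (meson eventually_gt_at_top filter_leD)
    qed
    ultimately have "eventually (\<lambda>m. (\<forall>t\<in>?T. sorted_wrt (<) t \<and> length t < k \<longrightarrow> L (t @ [m])) \<and> (\<forall>x\<in>S. x < m)) U"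
      by (rule eventually_conj)
    then obtain m where "\<forall>t\<in>?T. sorted_wrt (<) t \<and> length t < k \<longrightarrow> L (t @ [m])" and m2: "\<forall>x\<in>S. x < m"
      using eventually_happens'[OF U(2)] by blast
    then have m1: "\<And>t. set t \<subseteq> S \<Longrightarrow> sorted_wrt (<) t \<Longrightarrow> length t < k \<Longrightarrow> L (t @ [m])" by simp
    have "L t" if t: "sorted_wrt (<) t" "set t \<subseteq> insert m S" "length t \<le> k" for t
    proof (cases "m \<in> set t")
      case True
      then have tne: "t \<noteq> []" by auto
      then have tt: "t = butlast t @ [last t]" by simp
      have lt: "\<forall>x\<in>set (butlast t). x < last t"
        using t(1) by (subst (asm) tt) (auto simp: sorted_wrt_append)
      have last: "last t = m"
      proof (rule ccontr)
        assume *: "last t \<noteq> m"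
        then have "last t \<in> S" using t(2) tne last_in_set by blast
        moreover have "m \<in> set (butlast t)" using True * tt by (metis UnE empty_iff insert_iff list.set(1,2) set_append)
        ultimately show False using lt m2 by fastforce
      qed
      then have "set (butlast t) \<subseteq> S"
        using t(2) lt by (metis in_set_butlastD insert_iff less_irrefl subset_iff)
      moreover have "sorted_wrt (<) (butlast t)" using t(1) by (subst (asm) tt) (simp add: sorted_wrt_append)
      moreover have "length (butlast t) < k" using t(3) tne by (cases t) auto
      ultimately show ?thesis using m1 last tt by metis
    next
      case False
      then show ?thesis using S t by (auto simp: G_def)
    qed
    then show ?thesis using m2 S by (auto simp: G_def)
  qed
  have "G {}" using P by (auto simp: G_def L_def)
  then have "\<exists>f. \<forall>n. G (f n) \<and> (\<exists>m. f (Suc n) = insert m (f n) \<and> (\<forall>x\<in>f n. x < m))"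
    by (intro dependent_nat_choice) (use ext in blast)+
  then obtain f where f: "\<And>n. G (f n)" "\<And>n. \<exists>m. f (Suc n) = insert m (f n) \<and> (\<forall>x\<in>f n. x < m)"
    by blast
  have mono: "f i \<subseteq> f j" if "i \<le> j" for i j
    by (rule lift_Suc_mono_le[OF _ that]) (use f(2) in blast)
  have card: "card (f n) \<ge> n" for n
  proof (induction n)
    case (Suc n)
    obtain m where "f (Suc n) = insert m (f n)" "\<forall>x\<in>f n. x < m" using f(2) by blast
    then show ?case using Suc f(1)[of n] by (auto simp: G_def card_insert_if)
  qed simp
  show ?thesis
  proof
    show "infinite (\<Union>n. f n)"
    proof
      assume fin: "finite (\<Union>n. f n)"
      then have "card (f (Suc (card (\<Union>n. f n)))) \<le> card (\<Union>n. f n)" by (intro card_mono) auto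
      then show False using card[of "Suc (card (\<Union>n. f n))"] by simp
    qed
    show "P t" if t: "sorted_wrt (<) t" "set t \<subseteq> (\<Union>n. f n)" "length t = k" for t
    proof -
      have ch: "f i \<subseteq> f j \<or> f j \<subseteq> f i" for i j using mono by (metis nat_le_linear)
      have "\<exists>B\<in>range f. set t \<subseteq> B"
        by (rule finite_subset_Union_chain[of "set t" "range f" UNIV]) (use t(2) ch in \<open>auto simp: subset_chain_def\<close>)
      then obtain n where "set t \<subseteq> f n" by blast
      then have "L t" using f(1)[of n] t by (simp add: G_def)
      then show ?thesis using t(3) by (simp add: L_def)
    qed
  qed
qed

section \<open>Weak limits along a filter\<close>

definition weak_lim :: "'b filter \<Rightarrow> ('b \<Rightarrow> 'a::real_normed_vector) \<Rightarrow> 'a \<Rightarrow> bool" where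
  "weak_lim F x y \<longleftrightarrow> (\<forall>\<phi> :: 'a dual. ((\<lambda>n. \<phi> (x n)) \<longlongrightarrow> \<phi> y) F)"

lemma weak_limD: "weak_lim F x y \<Longrightarrow> ((\<lambda>n. blinfun_apply \<phi> (x n)) \<longlongrightarrow> \<phi> y) F"
  for \<phi> :: "'a::real_normed_vector dual"
  by (simp add: weak_lim_def)

text \<open>Weak-star limits along an ultrafilter exist in the dual of every normed space; this is the Banach--Alaoglu theorem in the form used below.\<close>

lemma weak_star_lim_exists:
  fixes h :: "'b \<Rightarrow> 'a::real_normed_vector dual"
  assumes U: "ultra U" and h: "\<And>n y. \<bar>h n y\<bar> \<le> B * norm y"
  shows "\<exists>g :: 'a dual. (\<forall>y. \<bar>g y\<bar> \<le> B * norm y) \<and> (\<forall>y. ((\<lambda>n. h n y) \<longlongrightarrow> g y) U)"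
proof -
  have ne: "U \<noteq> bot" using U by (simp add: ultra_def)
  have bd: "eventually (\<lambda>n. \<bar>h n y\<bar> \<le> B * norm y) U" for y using h by simp
  have "\<exists>l. ((\<lambda>n. h n y) \<longlongrightarrow> l) U" for y using ultra_tendsto[OF U bd] by blast
  then obtain l where l: "\<And>y. ((\<lambda>n. h n y) \<longlongrightarrow> l y) U" by metis
  have le: "\<bar>l y\<bar> \<le> B * norm y" for y by (rule tendsto_upperbound[OF tendsto_rabs[OF l] bd ne])
  have "linear l"
  proof (rule linearI)
    show "l (x + y) = l x + l y" for x y
      using tendsto_unique[OF ne l[of "x + y"]] tendsto_add[OF l[of x] l[of y]]
      by (simp add: blinfun.add_right)
    show "l (c *\<^sub>R x) = c *\<^sub>R l x" for c x
      using tendsto_unique[OF ne l[of "c *\<^sub>R x"]] tendsto_mult_left[OF l[of x], of c]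
      by (simp add: blinfun.scaleR_right)
  qed
  moreover have "l y \<le> B * norm y" for y using le[of y] by linarith
  ultimately obtain g :: "'a dual" where "\<And>y. g y = l y" using blinfun_of_bounded by blast
  then show ?thesis using l le by (intro exI[of _ g]) simp
qed

text \<open>Reflexivity turns a weak-star limit in the bidual of the evaluations at \<open>x n\<close> into a point.\<close>

lemma weak_lim_exists:
  fixes x :: "'b \<Rightarrow> 'a::real_normed_vector"
  assumes refl: "reflexive_space TYPE('a)" and U: "ultra U" and b: "\<And>n. norm (x n) \<le> B"
  obtains y where "weak_lim U x y"
proof -
  define J :: "'b \<Rightarrow> 'a dual dual" where "J n = Blinfun (\<lambda>\<phi>. blinfun_apply \<phi> (x n))" for n
  have J: "J n \<phi> = \<phi> (x n)" for n \<phi>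
    unfolding J_def by (rule bounded_linear_Blinfun_apply[THEN fun_cong]) (rule blinfun.bounded_linear_left)
  have "\<bar>J n \<phi>\<bar> \<le> B * norm \<phi>" for n \<phi>
    using abs_blinfun_le[of \<phi> "x n"] mult_left_mono[OF b[of n] norm_ge_zero[of \<phi>]] unfolding J by (simp add: mult.commute)
  then have "\<exists>\<Phi> :: 'a dual dual. (\<forall>\<phi>. \<bar>\<Phi> \<phi>\<bar> \<le> B * norm \<phi>) \<and> (\<forall>\<phi>. ((\<lambda>n. J n \<phi>) \<longlongrightarrow> \<Phi> \<phi>) U)"
    by (rule weak_star_lim_exists[OF U])
  then obtain \<Phi> :: "'a dual dual" where "\<And>\<phi>. ((\<lambda>n. J n \<phi>) \<longlongrightarrow> \<Phi> \<phi>) U" by blast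
  moreover obtain y where "\<And>\<phi>. \<Phi> \<phi> = blinfun_apply \<phi> y"
    using refl unfolding reflexive_space_def by blast
  ultimately show ?thesis using that[of y] by (simp add: weak_lim_def J)
qed

lemma weak_lim_norm_le:
  fixes y :: "'a::real_normed_vector"
  assumes "weak_lim F x y" "F \<noteq> bot" "eventually (\<lambda>n. norm (x n) \<le> B) F"
  shows "norm y \<le> B"
proof -
  obtain \<phi> :: "'a dual" where \<phi>: "\<phi> y = norm y" "\<And>y. \<bar>\<phi> y\<bar> \<le> norm y"
    using norming_functional by blast
  have "eventually (\<lambda>n. \<phi> (x n) \<le> B) F"
    using assms(3) by eventually_elim (use \<phi>(2) in \<open>smt (verit)\<close>)
  then show ?thesis
    using tendsto_upperbound[OF weak_limD[OF assms(1)] _ assms(2), of \<phi> B] \<phi>(1) by simp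
qed

lemma weak_lim_in_subspace:
  assumes Z: "subspace Z" "closed Z" and "weak_lim F x y" "F \<noteq> bot" "eventually (\<lambda>n. x n \<in> Z) F"
  shows "y \<in> Z"
proof (rule ccontr)
  assume "y \<notin> Z"
  then obtain \<phi> :: "'a dual" where \<phi>: "\<phi> y = 1" "\<And>z. z \<in> Z \<Longrightarrow> \<phi> z = 0"
    using separating_functional_closed[OF Z] by blast
  have "((\<lambda>n. \<phi> (x n)) \<longlongrightarrow> 0) F"
    by (rule tendsto_eventually) (use assms(5) \<phi>(2) in \<open>auto elim!: eventually_mono\<close>)
  then show False using tendsto_unique[OF assms(4) weak_limD[OF assms(3), of \<phi>]] \<phi>(1) by fastforce
qed

lemma weak_lim_diff: "weak_lim F x y \<Longrightarrow> weak_lim F x' y' \<Longrightarrow> weak_lim F (\<lambda>n. x n - x' n) (y - y')"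
  by (auto simp: weak_lim_def blinfun.diff_right intro!: tendsto_diff)

lemma weak_lim_add: "weak_lim F x y \<Longrightarrow> weak_lim F x' y' \<Longrightarrow> weak_lim F (\<lambda>n. x n + x' n) (y + y')"
  by (auto simp: weak_lim_def blinfun.add_right intro!: tendsto_add)

lemma weak_lim_scaleR: "weak_lim F x y \<Longrightarrow> weak_lim F (\<lambda>n. c *\<^sub>R x n) (c *\<^sub>R y)"
  by (auto simp: weak_lim_def blinfun.scaleR_right intro!: tendsto_mult_left)

lemma weak_lim_const: "weak_lim F (\<lambda>_. y) y"
  by (auto simp: weak_lim_def)

lemma weak_lim_sum:
  "(\<And>i. i \<in> A \<Longrightarrow> weak_lim F (x i) (y i)) \<Longrightarrow> weak_lim F (\<lambda>n. \<Sum>i\<in>A. x i n) (\<Sum>i\<in>A. y i)"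
  by (auto simp: weak_lim_def blinfun.sum_right intro!: tendsto_sum)

lemma weak_lim_compose: "weak_lim F x y \<Longrightarrow> filterlim g F G \<Longrightarrow> weak_lim G (\<lambda>n. x (g n)) y"
  by (auto simp: weak_lim_def intro: filterlim_compose)

lemma weak_lim_cong:
  fixes x :: "'a \<Rightarrow> 'b::real_normed_vector"
  assumes eq: "eventually (\<lambda>n. x n = x' n) F" and x: "weak_lim F x y"
  shows "weak_lim F x' y"
  unfolding weak_lim_def
proof
  fix \<phi> :: "'b dual"
  have "eventually (\<lambda>n. \<phi> (x n) = \<phi> (x' n)) F" using eq by (rule eventually_mono) simp
  then show "((\<lambda>n. \<phi> (x' n)) \<longlongrightarrow> \<phi> y) F" by (rule Lim_transform_eventually[OF weak_limD[OF x]])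
qed

section \<open>Closed subspaces of finite codimension\<close>

lemma UNIV_in_cof: "UNIV \<in> cof"
  unfolding cof_def by (auto intro!: exI[of _ "{}"] simp: subspace_UNIV)

lemma cof_inter_kernel:
  fixes \<phi> :: "'a::real_normed_vector dual"
  assumes Y: "Y \<in> cof"
  shows "Y \<inter> {x. \<phi> x = 0} \<in> cof"
proof (cases "\<forall>y\<in>Y. \<phi> y = 0")
  case True
  then have "Y \<inter> {x. \<phi> x = 0} = Y" by auto
  then show ?thesis using Y by simp
next
  case False
  obtain F where F: "subspace Y" "closed Y" "finite F" "span (Y \<union> F) = UNIV"
    using Y by (auto simp: cof_def)
  obtain e where e: "e \<in> Y" "\<phi> e \<noteq> 0" using False by blast
  let ?Z = "Y \<inter> {x. \<phi> x = 0}"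
  have "subspace {x. \<phi> x = 0}" by (auto simp: subspace_def blinfun.add_right blinfun.scaleR_right)
  then have "subspace ?Z" using F(1) by (rule subspace_inter[rotated])
  moreover have "closed {x. \<phi> x = 0}" by (intro closed_Collect_eq continuous_intros)
  then have "closed ?Z" using F(2) by (rule closed_Int[rotated])
  moreover have "Y \<subseteq> span (?Z \<union> insert e F)"
  proof
    fix y assume y: "y \<in> Y"
    have "y - (\<phi> y / \<phi> e) *\<^sub>R e \<in> ?Z"
      using y e F(1) by (auto simp: blinfun.diff_right blinfun.scaleR_right intro!: subspace_diff subspace_scale)
    then have "(y - (\<phi> y / \<phi> e) *\<^sub>R e) + (\<phi> y / \<phi> e) *\<^sub>R e \<in> span (?Z \<union> insert e F)"
      by (intro span_add span_scale span_base) auto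
    then show "y \<in> span (?Z \<union> insert e F)" by simp
  qed
  then have "span (Y \<union> F) \<subseteq> span (?Z \<union> insert e F)"
    by (intro span_minimal) (auto intro: span_base)
  then have "span (?Z \<union> insert e F) = UNIV" using F(4) by auto
  ultimately show ?thesis using F(3) unfolding cof_def by blast
qed

lemma cof_kernels:
  fixes \<Phi> :: "('a::real_normed_vector dual) set"
  assumes "finite \<Phi>"
  shows "{x. \<forall>\<phi>\<in>\<Phi>. \<phi> x = 0} \<in> cof"
  using assms
proof induction
  case empty
  then show ?case by (simp add: UNIV_in_cof)
next
  case (insert \<phi> \<Phi>)
  have "{x. \<forall>\<psi>\<in>insert \<phi> \<Phi>. \<psi> x = 0} = {x. \<forall>\<phi>\<in>\<Phi>. \<phi> x = 0} \<inter> {x. \<phi> x = 0}" by auto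
  then show ?case using cof_inter_kernel[OF insert.IH, of \<phi>] by simp
qed

text \<open>Modulo a closed subspace of finite codimension weak and norm convergence agree. The induction adds one spanning vector \<open>u\<close> to \<open>Y\<close> at a time: the functional that vanishes on \<open>Y\<close> and is 1 at \<open>u\<close> shows that the enlarged subspace is closed, and its values along the family tend to 0.\<close>

lemma weak_null_near_cof:
  fixes x :: "'b \<Rightarrow> 'a::real_normed_vector"
  assumes Y: "Y \<in> cof" and x: "weak_lim F x 0" and \<epsilon>: "\<epsilon> > 0"
  shows "eventually (\<lambda>n. \<exists>y\<in>Y. norm (x n - y) < \<epsilon>) F"
proof -
  have "eventually (\<lambda>n. \<exists>y\<in>Y. norm (x n - y) < \<epsilon>) F"
    if "finite S" "subspace Y" "closed Y" "span (Y \<union> S) = UNIV" "\<epsilon> > 0" for S Y \<epsilon>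
    using that
  proof (induction S arbitrary: Y \<epsilon>)
    case empty
    then have "Y = UNIV" by (metis Un_empty_right span_eq_iff)
    have "\<exists>y\<in>Y. norm (x n - y) < \<epsilon>" for n
      using empty(4) \<open>Y = UNIV\<close> by (intro bexI[of _ "x n"]) auto
    then show ?case by simp
  next
    case (insert u S)
    show ?case
    proof (cases "u \<in> Y")
      case True
      then have "span (Y \<union> S) = UNIV" using insert.prems(3) by (simp add: insert_absorb)
      then show ?thesis using insert by blast
    next
      case False
      obtain \<phi> :: "'a dual" where \<phi>: "\<phi> u = 1" "\<And>y. y \<in> Y \<Longrightarrow> \<phi> y = 0"
        using separating_functional_closed[OF insert.prems(1,2) False] by blast
      define Z where "Z = {z. z - \<phi> z *\<^sub>R u \<in> Y}"
      have subZ: "subspace Z"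
      proof (rule subspaceI)
        show "0 \<in> Z" using insert.prems(1) by (simp add: Z_def subspace_0)
        fix v w c assume v: "v \<in> Z"
        show "c *\<^sub>R v \<in> Z"
          using subspace_scale[OF insert.prems(1), of "v - \<phi> v *\<^sub>R u" c] v
          by (simp add: Z_def algebra_simps blinfun.scaleR_right)
        assume w: "w \<in> Z"
        show "v + w \<in> Z"
          using subspace_add[OF insert.prems(1), of "v - \<phi> v *\<^sub>R u" "w - \<phi> w *\<^sub>R u"] v w
          by (simp add: Z_def algebra_simps blinfun.add_right)
      qed
      have "Z = (\<lambda>z. z - \<phi> z *\<^sub>R u) -` Y" by (auto simp: Z_def)
      then have clZ: "closed Z"
        using insert.prems(2) by (auto intro!: closed_vimage continuous_intros)
      have "Y \<subseteq> Z" "u \<in> Z" using \<phi> subspace_0[OF insert.prems(1)] by (auto simp: Z_def)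
      then have "Y \<union> insert u S \<subseteq> span (Z \<union> S)" by (auto intro: span_base)
      then have "span (Z \<union> S) = UNIV" using insert.prems(3) span_minimal[OF _ subspace_span] by blast
      define \<eta> where "\<eta> = \<epsilon> / (2 + norm \<phi> * norm u)"
      have pos: "2 + norm \<phi> * norm u > 0" by (simp add: add_pos_nonneg)
      have \<eta>: "\<eta> > 0" "\<eta> * (2 + norm \<phi> * norm u) = \<epsilon>" using insert.prems(4) pos by (auto simp: \<eta>_def)
      have ev1: "eventually (\<lambda>n. \<exists>z\<in>Z. norm (x n - z) < \<eta>) F"
        by (rule insert.IH) fact+
      have "((\<lambda>n. norm (\<phi> (x n) *\<^sub>R u)) \<longlongrightarrow> 0) F"
        using tendsto_norm[OF tendsto_scaleR[OF weak_limD[OF x, of \<phi>] tendsto_const[of u]]] by simp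
      then have ev2: "eventually (\<lambda>n. norm (\<phi> (x n) *\<^sub>R u) < \<eta>) F"
        using \<eta>(1) by (auto dest: order_tendstoD(2))
      show ?thesis using ev1 ev2
      proof eventually_elim
        case (elim n)
        then obtain z where z: "z \<in> Z" "norm (x n - z) < \<eta>" by blast
        have "x n - (z - \<phi> z *\<^sub>R u) = (x n - z) + (\<phi> (x n) *\<^sub>R u - \<phi> (x n - z) *\<^sub>R u)"
          by (simp add: blinfun.diff_right algebra_simps)
        then have "norm (x n - (z - \<phi> z *\<^sub>R u)) \<le> norm (x n - z) + (norm (\<phi> (x n) *\<^sub>R u) + norm (\<phi> (x n - z) *\<^sub>R u))"
          using norm_triangle_ineq norm_triangle_ineq4 by (smt (verit))
        also have "norm (\<phi> (x n - z) *\<^sub>R u) \<le> (norm \<phi> * norm (x n - z)) * norm u"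
          using abs_blinfun_le[of \<phi> "x n - z"] by (simp add: mult_right_mono)
        also have "\<dots> \<le> (norm \<phi> * \<eta>) * norm u"
          using z(2) by (intro mult_right_mono mult_left_mono) auto
        also have "norm (x n - z) + (norm (\<phi> (x n) *\<^sub>R u) + norm \<phi> * \<eta> * norm u) < \<eta> + (\<eta> + norm \<phi> * \<eta> * norm u)"
          using z(2) elim(2) by simp
        also have "\<dots> = \<epsilon>" using \<eta>(2) by (simp add: algebra_simps)
        finally have "norm (x n - (z - \<phi> z *\<^sub>R u)) < \<epsilon>" by simp
        then show ?case using z(1) by (auto simp: Z_def)
      qed
    qed
  qed
  then show ?thesis using Y \<epsilon> unfolding cof_def by blast
qed

section \<open>Biorthogonal sequences in non-reflexive spaces\<close>

lemma functional_in_span: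
  fixes f :: "nat \<Rightarrow> 'v::real_vector \<Rightarrow> real"
  assumes "\<And>i. linear (f i)" "linear g" "\<And>v. (\<And>i. i < n \<Longrightarrow> f i v = 0) \<Longrightarrow> g v = 0"
  shows "\<exists>c. \<forall>v. g v = (\<Sum>i<n. c i * f i v)"
  using assms(2,3)
proof (induction n arbitrary: g)
  case 0
  then show ?case by simp
next
  case (Suc n)
  show ?case
  proof (cases "\<exists>e. (\<forall>i<n. f i e = 0) \<and> f n e \<noteq> 0")
    case False
    then have "\<exists>c. \<forall>v. g v = (\<Sum>i<n. c i * f i v)"
      using Suc.prems by (intro Suc.IH) (auto simp: less_Suc_eq)
    then obtain c where "\<forall>v. g v = (\<Sum>i<n. c i * f i v)" by blast
    then show ?thesis by (intro exI[of _ "c(n := 0)"]) simp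
  next
    case True
    then obtain e where e: "\<And>i. i < n \<Longrightarrow> f i e = 0" "f n e \<noteq> 0" by blast
    define b where "b = g e / f n e"
    have "\<exists>c. \<forall>v. g v - b * f n v = (\<Sum>i<n. c i * f i v)"
    proof (rule Suc.IH)
      show "linear (\<lambda>v. g v - b * f n v)"
        using Suc.prems(1) assms(1) by (auto intro!: linearI simp: linear_add linear_scale algebra_simps)
      fix v assume v: "\<And>i. i < n \<Longrightarrow> f i v = 0"
      have "g (v - (f n v / f n e) *\<^sub>R e) = 0"
        using v e assms(1) by (intro Suc.prems(2)) (auto simp: linear_diff linear_scale less_Suc_eq)
      then show "g v - b * f n v = 0"
        using Suc.prems(1) by (simp add: linear_diff linear_scale b_def)
    qed
    then obtain c where c: "\<And>v. g v - b * f n v = (\<Sum>i<n. c i * f i v)" by blast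
    then have "g v = (\<Sum>i<n. c i * f i v) + b * f n v" for v using c[of v] by linarith
    then show ?thesis by (intro exI[of _ "c(n := b)"]) simp
  qed
qed

text \<open>The image of a Banach space in its bidual is complete, hence closed; a functional outside of it has a positive distance \<open>\<theta>\<close> from it.\<close>

lemma nonreflexive_gap:
  assumes "\<not> reflexive_space TYPE('a::banach)"
  obtains \<Phi> :: "'a::banach dual dual" and \<theta> where "\<theta> > 0" "\<And>x. \<exists>\<phi>. \<bar>\<Phi> \<phi> - \<phi> x\<bar> > \<theta> * norm \<phi>"
proof -
  obtain \<Phi> :: "'a dual dual" where \<Phi>: "\<And>x. \<exists>\<phi>. \<Phi> \<phi> \<noteq> \<phi> x"
    using assms unfolding reflexive_space_def by blast
  have "\<exists>\<theta>>0. \<forall>x. \<exists>\<phi>. \<bar>\<Phi> \<phi> - \<phi> x\<bar> > \<theta> * norm \<phi>"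
  proof (rule ccontr)
    assume "\<not> ?thesis"
    then have "\<exists>x. \<forall>\<phi>. \<bar>\<Phi> \<phi> - \<phi> x\<bar> \<le> inverse (real (Suc n)) * norm \<phi>" for n
      by (metis inverse_positive_iff_positive not_less of_nat_0_less_iff zero_less_Suc)
    then obtain x where x: "\<And>n \<phi>. \<bar>\<Phi> \<phi> - \<phi> (x n)\<bar> \<le> inverse (real (Suc n)) * norm \<phi>"
      by metis
    have close: "norm (x m - x n) \<le> inverse (real (Suc m)) + inverse (real (Suc n))" for m n
    proof -
      obtain \<phi> :: "'a dual" where \<phi>: "\<phi> (x m - x n) = norm (x m - x n)" "\<And>y. \<bar>\<phi> y\<bar> \<le> norm y"
        using norming_functional by blast
      have "norm \<phi> \<le> 1" using \<phi>(2) by (intro norm_blinfun_bound) auto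
      then have "inverse (real (Suc k)) * norm \<phi> \<le> inverse (real (Suc k))" for k
        by (simp add: mult_left_le)
      then have "\<bar>\<Phi> \<phi> - \<phi> (x k)\<bar> \<le> inverse (real (Suc k))" for k
        using x[of \<phi> k] order_trans by blast
      from this[of m] this[of n] show ?thesis using \<phi>(1) by (simp add: blinfun.diff_right)
    qed
    have "Cauchy x"
    proof (rule metric_CauchyI)
      fix e :: real assume "e > 0"
      then obtain N where N: "inverse (real (Suc N)) < e / 2"
        using reals_Archimedean[of "e/2"] by auto
      have "dist (x m) (x n) < e" if "m \<ge> N" "n \<ge> N" for m n
      proof -
        have "inverse (real (Suc m)) \<le> inverse (real (Suc N))" "inverse (real (Suc n)) \<le> inverse (real (Suc N))"
          using that by (auto intro!: le_imp_inverse_le)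
        then show ?thesis using close[of m n] N unfolding dist_norm by linarith
      qed
      then show "\<exists>M. \<forall>m\<ge>M. \<forall>n\<ge>M. dist (x m) (x n) < e" by blast
    qed
    then obtain y where y: "x \<longlonglongrightarrow> y" using Cauchy_convergent_iff convergent_def by blast
    have "\<Phi> \<phi> = \<phi> y" for \<phi>
    proof -
      have "(\<lambda>n. \<bar>\<Phi> \<phi> - \<phi> (x n)\<bar>) \<longlonglongrightarrow> \<bar>\<Phi> \<phi> - \<phi> y\<bar>" using y by (intro tendsto_intros)
      moreover have "(\<lambda>n. inverse (real (Suc n)) * norm \<phi>) \<longlonglongrightarrow> 0 * norm \<phi>"
        by (intro tendsto_intros LIMSEQ_inverse_real_of_nat)
      ultimately have "\<bar>\<Phi> \<phi> - \<phi> y\<bar> \<le> 0 * norm \<phi>" using x by (intro LIMSEQ_le) auto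
      then show ?thesis by simp
    qed
    then show False using \<Phi> by blast
  qed
  then show ?thesis using that by blast
qed

text \<open>Otherwise \<open>\<Phi>\<close> would be bounded by \<open>\<theta>\<close> on the annihilator of the \<open>x j\<close>. A Hahn--Banach extension of that restriction differs from \<open>\<Phi>\<close> by a functional vanishing on the annihilator, which is evaluation at a combination of the \<open>x j\<close>; so \<open>\<Phi>\<close> would be within \<open>\<theta>\<close> of a point of the space.\<close>

lemma functional_vanishing_on_finite:
  fixes \<Phi> :: "'a::real_normed_vector dual dual" and x :: "nat \<Rightarrow> 'a"
  assumes \<theta>: "\<theta> \<ge> 0" "\<And>x. \<exists>\<phi>. \<bar>\<Phi> \<phi> - \<phi> x\<bar> > \<theta> * norm \<phi>"
  obtains \<phi> :: "'a dual" where "\<And>y. \<bar>blinfun_apply \<phi> y\<bar> \<le> norm y" "\<And>j. j < n \<Longrightarrow> \<phi> (x j) = 0" "\<Phi> \<phi> > \<theta>"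
proof -
  define S where "S = {\<phi> :: 'a dual. \<forall>j<n. blinfun_apply \<phi> (x j) = 0}"
  have S: "subspace S" by (auto simp: S_def subspace_def plus_blinfun.rep_eq scaleR_blinfun.rep_eq)
  have "\<exists>\<phi>\<in>S. \<Phi> \<phi> > \<theta> * norm \<phi>"
  proof (rule ccontr)
    assume "\<not> ?thesis"
    then have le: "\<Phi> \<phi> \<le> \<theta> * norm \<phi>" if "\<phi> \<in> S" for \<phi> using that by force
    have p: "sublinear (\<lambda>\<phi> :: 'a dual. \<theta> * norm \<phi>)"
      using \<theta>(1) by (auto simp: sublinear_def distrib_left[symmetric] intro!: mult_left_mono norm_triangle_ineq)
    obtain g where g: "linear g" "\<And>\<phi>. g \<phi> \<le> \<theta> * norm \<phi>" "\<And>\<phi>. \<phi> \<in> S \<Longrightarrow> g \<phi> = \<Phi> \<phi>"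
      using Hahn_Banach[OF p S, of "blinfun_apply \<Phi>"] le by (auto simp: blinfun.add_right blinfun.scaleR_right)
    have "\<exists>c. \<forall>\<phi>. \<Phi> \<phi> - g \<phi> = (\<Sum>j<n. c j * blinfun_apply \<phi> (x j))"
    proof (rule functional_in_span[of "\<lambda>j \<phi> :: 'a dual. \<phi> (x j)" "\<lambda>\<phi>. \<Phi> \<phi> - g \<phi>"])
      show "linear (\<lambda>\<phi>. blinfun_apply \<phi> (x j))" for j
        by (auto intro!: linearI simp: plus_blinfun.rep_eq scaleR_blinfun.rep_eq)
      show "linear (\<lambda>\<phi>. \<Phi> \<phi> - g \<phi>)"
        using g(1) by (auto intro!: linearI simp: blinfun.add_right blinfun.scaleR_right linear_add linear_scale algebra_simps)
      show "\<Phi> \<phi> - g \<phi> = 0" if "\<And>j. j < n \<Longrightarrow> blinfun_apply \<phi> (x j) = 0" for \<phi>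
        using that g(3)[of \<phi>] by (simp add: S_def)
    qed
    then obtain c where c: "\<And>\<phi>. \<Phi> \<phi> - g \<phi> = (\<Sum>j<n. c j * blinfun_apply \<phi> (x j))" by blast
    have "\<Phi> \<phi> - \<phi> (\<Sum>j<n. c j *\<^sub>R x j) = g \<phi>" for \<phi>
      using c[of \<phi>] by (simp add: blinfun.sum_right blinfun.scaleR_right)
    moreover have "\<bar>g \<phi>\<bar> \<le> \<theta> * norm \<phi>" for \<phi>
      using g(2)[of \<phi>] g(2)[of "- \<phi>"] linear_neg[OF g(1), of \<phi>] by simp
    ultimately show False using \<theta>(2)[of "\<Sum>j<n. c j *\<^sub>R x j"] by (metis not_less)
  qed
  then obtain \<phi> where \<phi>: "\<phi> \<in> S" "\<Phi> \<phi> > \<theta> * norm \<phi>" by blast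
  then have "norm \<phi> \<noteq> 0" by auto
  then have pos: "norm \<phi> > 0" by simp
  let ?\<psi> = "(1 / norm \<phi>) *\<^sub>R \<phi>"
  show ?thesis
  proof (rule that[of ?\<psi>])
    show "\<bar>?\<psi> y\<bar> \<le> norm y" for y
      using abs_blinfun_le[of \<phi> y] pos by (simp add: scaleR_blinfun.rep_eq abs_mult field_simps)
    show "?\<psi> (x j) = 0" if "j < n" for j using \<phi>(1) that by (simp add: S_def scaleR_blinfun.rep_eq)
    show "\<Phi> ?\<psi> > \<theta>" using \<phi>(2) pos by (simp add: blinfun.scaleR_right field_simps)
  qed
qed

text \<open>Helly's theorem. Linear algebra provides a point with the prescribed values; its distance from the common kernel of the \<open>\<phi> i\<close> is at most \<open>\<parallel>\<Phi>\<parallel>\<close>, since a functional that realises this distance is a combination of the \<open>\<phi> i\<close>, on which \<open>\<Phi>\<close> and the point agree. Subtracting an element of the kernel brings the norm below \<open>\<parallel>\<Phi>\<parallel> + 1\<close>.\<close>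

lemma Helly_interpolation:
  fixes \<Phi> :: "'a::real_normed_vector dual dual" and \<phi> :: "nat \<Rightarrow> 'a dual"
  obtains x where "\<And>i. i < n \<Longrightarrow> \<phi> i x = \<Phi> (\<phi> i)" "norm x \<le> norm \<Phi> + 1"
proof -
  have span: "\<exists>c. \<forall>v. \<psi> v = (\<Sum>i<m. c i * \<phi> i v)" if "\<And>v. (\<And>i. i < m \<Longrightarrow> \<phi> i v = 0) \<Longrightarrow> \<psi> v = 0"
    for m and \<psi> :: "'a dual"
    by (rule functional_in_span) (use that in \<open>auto intro: blinfun.bounded_linear_right bounded_linear.linear\<close>)
  have comb: "\<Phi> \<psi> = (\<Sum>i<m. c i * \<Phi> (\<phi> i))" if "\<And>v. \<psi> v = (\<Sum>i<m. c i * \<phi> i v)"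
    for m and \<psi> :: "'a dual" and c :: "nat \<Rightarrow> real"
  proof -
    have "\<psi> = (\<Sum>i<m. c i *\<^sub>R \<phi> i)"
      by (rule blinfun_eqI) (simp add: that blinfun.sum_left scaleR_blinfun.rep_eq)
    then show ?thesis by (simp add: blinfun.sum_right blinfun.scaleR_right)
  qed
  have "\<exists>x. \<forall>i<n. \<phi> i x = \<Phi> (\<phi> i)"
  proof (induction n)
    case (Suc n)
    then obtain x where x: "\<And>i. i < n \<Longrightarrow> \<phi> i x = \<Phi> (\<phi> i)" by blast
    show ?case
    proof (cases "\<exists>e. (\<forall>i<n. \<phi> i e = 0) \<and> \<phi> n e \<noteq> 0")
      case True
      then obtain e where e: "\<And>i. i < n \<Longrightarrow> \<phi> i e = 0" "\<phi> n e \<noteq> 0" by blast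
      define b where "b = (\<Phi> (\<phi> n) - \<phi> n x) / \<phi> n e"
      have "\<phi> i (x + b *\<^sub>R e) = \<Phi> (\<phi> i)" if "i < Suc n" for i
        using that x e by (cases "i = n") (auto simp: blinfun.add_right blinfun.scaleR_right b_def)
      then show ?thesis by blast
    next
      case False
      then obtain c where c: "\<And>v. \<phi> n v = (\<Sum>i<n. c i * \<phi> i v)" using span[of n "\<phi> n"] by blast
      have "\<phi> n x = \<Phi> (\<phi> n)" using c[of x] comb[OF c] x by simp
      then show ?thesis using x by (auto simp: less_Suc_eq)
    qed
  qed simp
  then obtain x where x: "\<And>i. i < n \<Longrightarrow> \<phi> i x = \<Phi> (\<phi> i)" by blast
  let ?K = "{v. \<forall>i<n. \<phi> i v = 0}"
  have K: "subspace ?K" by (auto simp: subspace_def blinfun.add_right blinfun.scaleR_right)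
  have "\<exists>k\<in>?K. norm (x - k) < norm \<Phi> + 1"
  proof (rule ccontr)
    assume "\<not> ?thesis"
    then have far: "\<And>k. k \<in> ?K \<Longrightarrow> norm \<Phi> + 1 \<le> norm (x - k)" by force
    obtain \<psi> :: "'a dual" where \<psi>: "\<psi> x = norm \<Phi> + 1" "\<And>k. k \<in> ?K \<Longrightarrow> \<psi> k = 0" "\<And>y. \<bar>\<psi> y\<bar> \<le> norm y"
      using separating_functional[OF K far] by auto
    obtain c where c: "\<And>v. \<psi> v = (\<Sum>i<n. c i * \<phi> i v)" using span[of n \<psi>] \<psi>(2) by auto
    have "\<Phi> \<psi> = norm \<Phi> + 1" using comb[OF c] c[of x] x \<psi>(1) by simp
    moreover have "norm \<psi> \<le> 1" using \<psi>(3) by (intro norm_blinfun_bound) auto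
    then have "norm \<Phi> * norm \<psi> \<le> norm \<Phi>" by (simp add: mult_left_le)
    ultimately show False using abs_blinfun_le[of \<Phi> \<psi>] by linarith
  qed
  then obtain k where "k \<in> ?K" "norm (x - k) < norm \<Phi> + 1" by blast
  then show ?thesis using that[of "x - k"] x by (simp add: blinfun.diff_right)
qed

text \<open>James' construction: choose alternately \<open>\<phi> n\<close> vanishing at the earlier points with \<open>\<Phi> (\<phi> n) > \<theta>\<close>, and \<open>x n\<close> on which all functionals so far have the value prescribed by \<open>\<Phi>\<close>.\<close>

theorem James_biorthogonal_sequence:
  assumes "\<not> reflexive_space TYPE('a::banach)"
  obtains x :: "nat \<Rightarrow> 'a::banach" and \<phi> :: "nat \<Rightarrow> 'a dual" and \<theta> B where "\<theta> > 0"
    "\<And>n. norm (x n) \<le> B" "\<And>n y. \<bar>\<phi> n y\<bar> \<le> norm y"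
    "\<And>n j. j < n \<Longrightarrow> \<phi> n (x j) = 0" "\<And>n j. n \<le> j \<Longrightarrow> \<phi> n (x j) > \<theta>"
proof -
  obtain \<Phi> :: "'a dual dual" and \<theta> where
    \<theta>: "\<theta> > 0" "\<And>x. \<exists>\<phi>. \<bar>\<Phi> \<phi> - \<phi> x\<bar> > \<theta> * norm \<phi>"
    using nonreflexive_gap[OF assms] by blast
  define P where "P f n r \<longleftrightarrow> (\<forall>y. \<bar>blinfun_apply (fst r) y\<bar> \<le> norm y) \<and> (\<forall>j<n. fst r (snd (f j)) = 0)
      \<and> \<Phi> (fst r) > \<theta> \<and> norm (snd r) \<le> norm \<Phi> + 1 \<and> (\<forall>i<n. fst (f i) (snd r) = \<Phi> (fst (f i)))
      \<and> fst r (snd r) = \<Phi> (fst r)" for f :: "nat \<Rightarrow> ('a dual) \<times> 'a" and n r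
  have "\<exists>f. \<forall>n. P f n (f n)"
  proof (rule dependent_wellorder_choice)
    fix n and f :: "nat \<Rightarrow> ('a dual) \<times> 'a"
    obtain \<phi> where \<phi>: "\<And>y. \<bar>blinfun_apply \<phi> y\<bar> \<le> norm y" "\<And>j. j < n \<Longrightarrow> \<phi> (snd (f j)) = 0" "\<Phi> \<phi> > \<theta>"
      using functional_vanishing_on_finite[of \<theta> \<Phi> n "\<lambda>j. snd (f j)"] \<theta> by (metis less_imp_le)
    define \<psi> where "\<psi> i = (if i < n then fst (f i) else \<phi>)" for i
    obtain x where x: "\<And>i. i < Suc n \<Longrightarrow> \<psi> i x = \<Phi> (\<psi> i)" "norm x \<le> norm \<Phi> + 1"
      using Helly_interpolation by blast
    have "fst (f i) x = \<Phi> (fst (f i))" if "i < n" for i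
      using x(1)[of i] that by (simp add: \<psi>_def)
    moreover have "\<phi> x = \<Phi> \<phi>" using x(1)[of n] by (simp add: \<psi>_def)
    ultimately have "P f n (\<phi>, x)" using \<phi> x(2) unfolding P_def by simp
    then show "\<exists>r. P f n r" by blast
  qed (simp add: P_def)
  then obtain f where f: "\<And>n. P f n (f n)" by blast
  show ?thesis
  proof (rule that[of \<theta> "\<lambda>n. snd (f n)" "norm \<Phi> + 1" "\<lambda>n. fst (f n)"])
    show "\<theta> < fst (f n) (snd (f j))" if "n \<le> j" for n j
      using f[of j] f[of n] that unfolding P_def by (cases "n = j") (auto simp: order.order_iff_strict)
  qed (use f \<theta>(1) in \<open>auto simp: P_def\<close>)
qed

section \<open>Concentration for arrays\<close>

abbreviation (input) Hamming_Lipschitz :: "nat \<Rightarrow> (nat set \<Rightarrow> 'a::metric_space) \<Rightarrow> bool" where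
  "Hamming_Lipschitz k f \<equiv> is_Lipschitz ([UNIV]\<^bsup>k\<^esup>) (hamming_dist k) f"

abbreviation (input) Hamming_Lip :: "nat \<Rightarrow> (nat set \<Rightarrow> 'a::metric_space) \<Rightarrow> real" where
  "Hamming_Lip k f \<equiv> Lip ([UNIV]\<^bsup>k\<^esup>) (hamming_dist k) f"

definition concentration :: "real \<Rightarrow> 'a::real_normed_vector itself \<Rightarrow> bool" where
  "concentration C _ \<longleftrightarrow> (\<forall>k\<ge>1. \<forall>f :: nat set \<Rightarrow> 'a.
     Hamming_Lipschitz k f \<longrightarrow>
     (\<exists>M. infinite M \<and> diameter (f ` ([M]\<^bsup>k\<^esup>)) \<le> C * Hamming_Lip k f))"

lemma sorted_list_of_set_strict_mono_image:
  assumes "strict_mono (e :: nat \<Rightarrow> nat)"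
  shows "sorted_list_of_set (e ` {a..<b}) = map e [a..<b]"
proof -
  have "sorted_wrt (<) (map e [a..<b])"
    using assms by (simp add: sorted_wrt_iff_nth_less strict_mono_less)
  then show ?thesis
    using sorted_list_of_set.idem_if_sorted_distinct[of "map e [a..<b]"] by (simp add: strict_sorted_iff)
qed

lemma nsets_shift_image:
  assumes "strict_mono (e :: nat \<Rightarrow> nat)"
  shows "e ` {a..<a + k} \<in> [range e]\<^bsup>k\<^esup>"
  using assms by (auto simp: nsets_def card_image strict_mono_imp_inj_on inj_on_subset[OF strict_mono_imp_inj_on])

lemma hamming_quotients_nonempty:
  assumes "k \<ge> 1" shows "lipschitz_quotients ([UNIV]\<^bsup>k\<^esup>) (hamming_dist k) f \<noteq> {}"
proof -
  have A: "{a..<a+k} \<in> [UNIV]\<^bsup>k\<^esup>" for a :: nat by (auto simp: nsets_def)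
  have "0 \<in> {i. i < k \<and> sorted_list_of_set {0..<0+k} ! i \<noteq> sorted_list_of_set {k..<k+k} ! i}"
    using assms by (auto simp del: upt_Suc)
  then have "card {i. i < k \<and> sorted_list_of_set {0..<0+k} ! i \<noteq> sorted_list_of_set {k..<k+k} ! i} > 0"
    by (subst card_gt_0_iff) auto
  then have "hamming_dist k {0..<0+k} {k..<k+k} > 0" unfolding hamming_dist_def by simp
  then show ?thesis using A[of 0] A[of k] unfolding lipschitz_quotients_def by blast
qed

text \<open>Changing one coordinate changes one summand, so the map has Lipschitz constant at most \<open>2 W\<close> independently of \<open>k\<close>. The conclusion is only recorded for two consecutive blocks of indices, which is the form in which concentration is contradicted later.\<close>

lemma array_concentration:
  fixes w :: "nat \<Rightarrow> nat \<Rightarrow> 'a::real_normed_vector"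
  assumes conc: "concentration C TYPE('a)" "C \<ge> 0" and k: "k \<ge> 1" and W: "\<And>i l. norm (w i l) \<le> W"
  obtains e :: "nat \<Rightarrow> nat" where "strict_mono e"
    "norm ((\<Sum>i<k. w i (e i)) - (\<Sum>i<k. w i (e (k + i)))) \<le> 2 * C * W"
proof -
  define f where "f A = (\<Sum>i<k. w i (sorted_list_of_set A ! i))" for A
  have "dist (f A) (f B) \<le> 2 * W * hamming_dist k A B" for A B
  proof -
    let ?D = "{i. i < k \<and> sorted_list_of_set A ! i \<noteq> sorted_list_of_set B ! i}"
    have "dist (f A) (f B) = norm (\<Sum>i<k. w i (sorted_list_of_set A ! i) - w i (sorted_list_of_set B ! i))"
      by (simp add: f_def dist_norm sum_subtractf)
    also have "(\<Sum>i<k. w i (sorted_list_of_set A ! i) - w i (sorted_list_of_set B ! i))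
        = (\<Sum>i\<in>?D. w i (sorted_list_of_set A ! i) - w i (sorted_list_of_set B ! i))"
      by (rule sum.mono_neutral_right) auto
    also have "norm \<dots> \<le> (\<Sum>i\<in>?D. W + W)"
      by (intro sum_norm_le order_trans[OF norm_triangle_ineq4] add_mono W)
    finally show ?thesis by (simp add: hamming_dist_def mult.commute)
  qed
  then have q: "q \<le> 2 * W" if "q \<in> lipschitz_quotients ([UNIV]\<^bsup>k\<^esup>) (hamming_dist k) f" for q
    using that by (auto simp: lipschitz_quotients_def divide_le_eq)
  then have "Hamming_Lipschitz k f"
    unfolding is_Lipschitz_def by (rule bdd_aboveI)
  then obtain M where M: "infinite M" "diameter (f ` ([M]\<^bsup>k\<^esup>)) \<le> C * Hamming_Lip k f"
    using conc(1) k unfolding concentration_def by blast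
  define e where "e = enumerate M"
  have e: "strict_mono e" "range e = M"
    using M(1) by (auto simp: e_def strict_mono_enumerate range_enumerate)
  have "Hamming_Lip k f \<le> 2 * W"
    unfolding Lip_def using hamming_quotients_nonempty[OF k] q by (rule cSup_least)
  then have le: "diameter (f ` ([M]\<^bsup>k\<^esup>)) \<le> C * (2 * W)"
    using M(2) mult_left_mono conc(2) order_trans by blast
  have "norm (f A) \<le> (\<Sum>i<k. W)" for A unfolding f_def by (intro sum_norm_le W)
  then have bdd: "bounded (f ` ([M]\<^bsup>k\<^esup>))" by (intro boundedI) auto
  have feq: "f (e ` {a..<a + k}) = (\<Sum>i<k. w i (e (a + i)))" for a
    unfolding f_def sorted_list_of_set_strict_mono_image[OF e(1)] by simp
  have "dist (f (e ` {0..<0 + k})) (f (e ` {k..<k + k})) \<le> diameter (f ` ([M]\<^bsup>k\<^esup>))"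
    using nsets_shift_image[OF e(1)] e(2) by (intro diameter_bounded_bound[OF bdd] imageI) blast+
  then show ?thesis using that[OF e(1)] le unfolding feq dist_norm by simp
qed

text \<open>Sums of two consecutive blocks of length \<open>k\<close> of James' sequence are at distance at least \<open>k \<theta>\<close>, as the functional that starts with the second block shows.\<close>

theorem concentration_imp_reflexive:
  assumes conc: "concentration C TYPE('a::banach)" "C \<ge> 1"
  shows "reflexive_space TYPE('a)"
proof (rule ccontr)
  assume "\<not> ?thesis"
  then obtain x :: "nat \<Rightarrow> 'a" and \<phi> :: "nat \<Rightarrow> 'a dual" and \<theta> B where *: "\<theta> > 0"
    "\<And>n. norm (x n) \<le> B" "\<And>n y. \<bar>\<phi> n y\<bar> \<le> norm y"
    "\<And>n j. j < n \<Longrightarrow> \<phi> n (x j) = 0" "\<And>n j. n \<le> j \<Longrightarrow> \<phi> n (x j) > \<theta>"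
    by (rule James_biorthogonal_sequence) blast
  obtain m :: nat where m: "real m > 2 * C * B / \<theta>" using reals_Archimedean2 by blast
  define k where "k = Suc m"
  have k: "k \<ge> 1" "real k * \<theta> > 2 * C * B" using m *(1) by (auto simp: k_def field_simps)
  obtain e :: "nat \<Rightarrow> nat" where e: "strict_mono e"
    "norm ((\<Sum>i<k. x (e i)) - (\<Sum>i<k. x (e (k + i)))) \<le> 2 * C * B"
    using array_concentration[OF conc(1) _ k(1), of "\<lambda>_. x" B] conc(2) *(2) by (metis order_trans zero_le_one)
  have "\<phi> (e k) (x (e i)) = 0" if "i < k" for i
    using e(1) that by (intro *(4)) (simp add: strict_mono_less)
  moreover have "\<phi> (e k) (x (e (k + i))) > \<theta>" for i
    using e(1) by (intro *(5)) (simp add: strict_mono_less_eq)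
  then have "(\<Sum>i<k. \<theta>) \<le> (\<Sum>i<k. \<phi> (e k) (x (e (k + i))))" by (intro sum_mono less_imp_le)
  ultimately have "- \<phi> (e k) ((\<Sum>i<k. x (e i)) - (\<Sum>i<k. x (e (k + i)))) \<ge> real k * \<theta>"
    by (simp add: blinfun.diff_right blinfun.sum_right)
  then show False
    using *(3)[of "e k" "(\<Sum>i<k. x (e i)) - (\<Sum>i<k. x (e (k + i)))"] e(2) k(2) by linarith
qed

text \<open>If almost all sums were larger than \<open>2 C W\<close>, then, the sums being weakly null and the norm weakly lower semicontinuous, almost all differences of a sum and a later sum would be larger as well; along an infinite set this contradicts concentration. That the bound does not involve the number of rows is essential for its use on sums over all prefixes.\<close>

theorem weak_null_array_bound:
  fixes w :: "nat \<Rightarrow> nat \<Rightarrow> 'a::real_normed_vector"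
  assumes conc: "concentration C TYPE('a)" "C \<ge> 0"
    and U: "ultra U" "U \<le> sequentially"
    and W: "\<And>i l. norm (w i l) \<le> W" and w: "\<And>i. weak_lim U (w i) 0"
  shows "iter_ev U R (\<lambda>t. norm (\<Sum>i<R. w i (t ! i)) \<le> 2 * C * W) []"
proof (cases "R = 0")
  case True
  have "0 \<le> W" using W[of 0 0] norm_ge_zero order_trans by blast
  then show ?thesis using True conc(2) by simp
next
  case False
  define F where "F t = (\<Sum>i<R. w i (t ! i))" for t
  define K where "K = 2 * C * W"
  have ne: "iter_filter U R \<noteq> bot" using ultra_iter_filter[OF U(1)] by (simp add: ultra_def)
  have "weak_lim (iter_filter U R) F (\<Sum>i<R. 0)"
    unfolding F_def by (intro weak_lim_sum weak_lim_compose[OF w] filterlim_nth_iter_filter) simp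
  then have wF: "weak_lim (iter_filter U R) (\<lambda>t. F s - F t) (F s)" for s
    using weak_lim_diff[OF weak_lim_const[of _ "F s"]] by fastforce
  show ?thesis
  proof (rule ccontr)
    assume "\<not> ?thesis"
    then have bad: "iter_ev U R (\<lambda>t. norm (F t) > K) []"
      using iter_ev_not[OF U(1)] unfolding F_def K_def by (simp add: not_le)
    have apart: "iter_ev U R (\<lambda>t. norm (F s - F t) > K) []" if "norm (F s) > K" for s
    proof (rule ccontr)
      assume "\<not> ?thesis"
      then have "eventually (\<lambda>t. norm (F s - F t) \<le> K) (iter_filter U R)"
        using iter_ev_not[OF U(1)] by (simp add: not_less eventually_iter_filter)
      then show False using weak_lim_norm_le[OF wF ne] that by force
    qed
    define P where "P t \<longleftrightarrow> norm (F (take R t) - F (drop R t)) > K" for t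
    have "iter_ev U R (\<lambda>s. length s = length [] + R \<and> take (length []) s = [] \<and> norm (F s) > K) []"
      using iter_ev_conj[OF iter_ev_length[of U R "[]"] bad] by simp
    then have "iter_ev U R (iter_ev U R P) []"
    proof (rule iter_ev_mono[rotated])
      fix s :: "nat list" assume s: "length s = length [] + R \<and> take (length []) s = [] \<and> norm (F s) > K"
      then have "iter_ev U R (\<lambda>t. P (s @ t)) []" using apart by (simp add: P_def)
      then show "iter_ev U R P s" using iter_ev_append[of U R P s "[]"] by simp
    qed
    then have "iter_ev U (R + R) P []" by (simp add: iter_ev_add)
    then obtain M :: "nat set" where M: "infinite M"
      "\<And>t. sorted_wrt (<) t \<Longrightarrow> set t \<subseteq> M \<Longrightarrow> length t = R + R \<Longrightarrow> P t"
      using iter_ev_infinite_set[of U "R + R" P] U by (auto simp: ultra_def)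
    define g where "g = enumerate M"
    have g: "strict_mono g" "range g = M"
      using M(1) by (auto simp: g_def strict_mono_enumerate range_enumerate)
    obtain e :: "nat \<Rightarrow> nat" where e: "strict_mono e"
      "norm ((\<Sum>i<R. w i (g (e i))) - (\<Sum>i<R. w i (g (e (R + i))))) \<le> 2 * C * W"
      using array_concentration[OF conc, of R "\<lambda>i l. w i (g l)" W] False W by auto
    have ge: "strict_mono (\<lambda>i. g (e i))" using g(1) e(1) by (simp add: strict_mono_def)
    define t where "t = map (\<lambda>i. g (e i)) [0..<R + R]"
    have "t = sorted_list_of_set ((\<lambda>i. g (e i)) ` {0..<R + R})"
      unfolding t_def using sorted_list_of_set_strict_mono_image[OF ge] by simp
    then have "sorted_wrt (<) t" by (simp add: strict_sorted_list_of_set)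
    moreover have "set t \<subseteq> M" using g(2) by (auto simp: t_def)
    moreover have "length t = R + R" by (simp add: t_def)
    ultimately have "P t" by (rule M(2))
    moreover have "F (take R t) = (\<Sum>i<R. w i (g (e i)))" unfolding F_def by (intro sum.cong) (auto simp: t_def)
    moreover have "F (drop R t) = (\<Sum>i<R. w i (g (e (R + i))))" unfolding F_def by (intro sum.cong) (auto simp: t_def)
    ultimately show False using e(2) by (simp add: P_def K_def)
  qed
qed

section \<open>Weakly null trees from the asymptotic game\<close>

text \<open>Rational combinations, coded by lists so that they can be enumerated.\<close>

definition rat_comb :: "(nat \<Rightarrow> 'a::real_vector) \<Rightarrow> (rat \<times> nat) list \<Rightarrow> 'a" where
  "rat_comb x ps = (\<Sum>(c, i)\<leftarrow>ps. real_of_rat c *\<^sub>R x i)"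

lemma rat_comb_append: "rat_comb x (ps @ qs) = rat_comb x ps + rat_comb x qs"
  by (simp add: rat_comb_def)

lemma rat_comb_scale: "rat_comb x (map (\<lambda>(c, i). (r * c, i)) ps) = real_of_rat r *\<^sub>R rat_comb x ps"
  by (induction ps) (auto simp: rat_comb_def of_rat_mult scaleR_add_right)

lemma rat_comb_cong: "(\<And>c i. (c, i) \<in> set ps \<Longrightarrow> x i = y i) \<Longrightarrow> rat_comb x ps = rat_comb y ps"
  unfolding rat_comb_def by (intro arg_cong[where f=sum_list] map_cong) auto

lemma subspace_closure_rat_comb:
  fixes x :: "nat \<Rightarrow> 'a::real_normed_vector"
  shows "subspace (closure (range (rat_comb x)))"
proof (rule subspaceI)
  have "0 = rat_comb x []" by (simp add: rat_comb_def)
  then have "0 \<in> range (rat_comb x)" by (rule range_eqI)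
  then show "0 \<in> closure (range (rat_comb x))" by (rule subsetD[OF closure_subset])
next
  fix y z assume yz: "y \<in> closure (range (rat_comb x))" "z \<in> closure (range (rat_comb x))"
  obtain p where p: "\<And>n. p n \<in> range (rat_comb x)" "p \<longlonglongrightarrow> y"
    using yz(1) unfolding closure_sequential by metis
  obtain q where q: "\<And>n. q n \<in> range (rat_comb x)" "q \<longlonglongrightarrow> z"
    using yz(2) unfolding closure_sequential by metis
  have "p n + q n \<in> range (rat_comb x)" for n
  proof -
    obtain ps qs where "p n = rat_comb x ps" "q n = rat_comb x qs" using p(1)[of n] q(1)[of n] by (elim imageE)
    then have "p n + q n = rat_comb x (ps @ qs)" by (simp add: rat_comb_append)
    then show ?thesis by (rule range_eqI)
  qed
  then show "y + z \<in> closure (range (rat_comb x))"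
    unfolding closure_sequential using tendsto_add[OF p(2) q(2)] by (intro exI[of _ "\<lambda>n. p n + q n"]) simp
next
  fix c and y assume y: "y \<in> closure (range (rat_comb x))"
  show "c *\<^sub>R y \<in> closure (range (rat_comb x))"
    unfolding closure_approachable
  proof (intro allI impI)
    fix e :: real assume e: "e > 0"
    have "e / 2 / (\<bar>c\<bar> + 1) > 0" using e by simp
    then obtain ps where ps: "dist (rat_comb x ps) y < e / 2 / (\<bar>c\<bar> + 1)"
      using y unfolding closure_approachable by (elim allE[of _ "e / 2 / (\<bar>c\<bar> + 1)"] impE bexE imageE) auto
    have cancel: "a / b * b = a" if "b \<noteq> 0" for a b :: real using that by simp
    have N0: "norm (rat_comb x ps) + 1 \<noteq> 0" using norm_ge_zero[of "rat_comb x ps"] by linarith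
    have "e / 2 / (norm (rat_comb x ps) + 1) > 0" using e by (simp add: add_nonneg_pos)
    then obtain r where r: "c < real_of_rat r" "real_of_rat r < c + e / 2 / (norm (rat_comb x ps) + 1)"
      using of_rat_dense[of c "c + e / 2 / (norm (rat_comb x ps) + 1)"] by auto
    have "norm (real_of_rat r *\<^sub>R rat_comb x ps - c *\<^sub>R y)
        = norm ((real_of_rat r - c) *\<^sub>R rat_comb x ps + c *\<^sub>R (rat_comb x ps - y))"
      by (simp add: algebra_simps)
    also have "\<dots> \<le> (real_of_rat r - c) * norm (rat_comb x ps) + \<bar>c\<bar> * norm (rat_comb x ps - y)"
      using r(1) by (intro norm_triangle_le) simp
    also have "\<bar>c\<bar> * norm (rat_comb x ps - y) \<le> \<bar>c\<bar> * (e / 2 / (\<bar>c\<bar> + 1))"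
      using ps by (intro mult_left_mono) (auto simp: dist_norm)
    also have "\<bar>c\<bar> * (e / 2 / (\<bar>c\<bar> + 1)) < e / 2" using e by (simp add: field_simps)
    also have "(real_of_rat r - c) * norm (rat_comb x ps) \<le> (e / 2 / (norm (rat_comb x ps) + 1)) * norm (rat_comb x ps)"
      using r by (intro mult_right_mono) auto
    also have "\<dots> \<le> (e / 2 / (norm (rat_comb x ps) + 1)) * (norm (rat_comb x ps) + 1)"
      using e by (intro mult_left_mono) auto
    also have "\<dots> = e / 2"
      by (rule cancel[OF N0])
    finally have "norm (real_of_rat r *\<^sub>R rat_comb x ps - c *\<^sub>R y) < e" by simp
    then show "\<exists>z\<in>range (rat_comb x). dist z (c *\<^sub>R y) < e"
      unfolding rat_comb_scale[symmetric] dist_norm by blast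
  qed
qed

text \<open>A bounded set that meets every closed subspace of finite codimension has 0 in its weak closure; in a reflexive space a sequence suffices. Choose \<open>x n\<close> in the kernels of functionals that norm the first few rational combinations of earlier terms. A weak limit \<open>y\<close> lies in the closed span; it is approximated by a combination \<open>d\<close> whose norming functional vanishes at almost all terms, hence at \<open>y\<close>, and this forces \<open>y = 0\<close>.\<close>

theorem weak_null_sequence:
  fixes A :: "'a::real_normed_vector set"
  assumes refl: "reflexive_space TYPE('a)" and U: "ultra U" "U \<le> sequentially"
    and A: "\<And>Y. Y \<in> cof \<Longrightarrow> \<exists>x\<in>Y. x \<in> A" and B: "\<And>x. x \<in> A \<Longrightarrow> norm x \<le> B"
  obtains x where "\<And>n. x n \<in> A" "weak_lim U x 0"
proof -
  have ne: "U \<noteq> bot" using U(1) by (simp add: ultra_def)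
  have "\<exists>\<psi> :: 'a dual. \<psi> v = norm v \<and> (\<forall>y. \<bar>\<psi> y\<bar> \<le> norm y)" for v
    using norming_functional[of v] by blast
  then obtain \<psi> :: "'a \<Rightarrow> 'a dual" where \<psi>: "\<And>v. \<psi> v v = norm v" "\<And>v y. \<bar>\<psi> v y\<bar> \<le> norm y"
    by metis
  \<comment> \<open>The combinations considered at step \<open>n\<close>: finitely many, and built from terms that are already chosen.\<close>
  define J where "J n = {j. j < n \<and> (\<forall>(c, i)\<in>set (from_nat j :: (rat \<times> nat) list). i < n)}" for n
  define P where "P f n r \<longleftrightarrow> r \<in> A \<and> (\<forall>j\<in>J n. \<psi> (rat_comb f (from_nat j)) r = 0)" for f n r
  have "\<exists>f. \<forall>n. P f n (f n)"
  proof (rule dependent_wellorder_choice)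
    fix n r and f f' :: "nat \<Rightarrow> 'a" assume "\<And>m. m < n \<Longrightarrow> f m = f' m"
    then have "rat_comb f (from_nat j) = rat_comb f' (from_nat j)" if "j \<in> J n" for j
      using that by (intro rat_comb_cong) (auto simp: J_def)
    then show "P f n r = P f' n r" by (simp add: P_def)
  next
    fix n and f :: "nat \<Rightarrow> 'a"
    have "finite (J n)" by (simp add: J_def)
    then have "{x. \<forall>\<phi>\<in>(\<lambda>j. \<psi> (rat_comb f (from_nat j))) ` J n. \<phi> x = 0} \<in> cof"
      by (intro cof_kernels) simp
    then show "\<exists>r. P f n r" using A by (fastforce simp: P_def)
  qed
  then obtain x where x: "\<And>n. P x n (x n)" by blast
  then have xA: "\<And>n. x n \<in> A" by (simp add: P_def)
  obtain y where y: "weak_lim U x y" using weak_lim_exists[OF refl U(1), of x B] B xA by blast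
  define Z where "Z = closure (range (rat_comb x))"
  have xZ: "x n \<in> Z" for n
  proof -
    have "rat_comb x [(1, n)] = x n" by (simp add: rat_comb_def)
    then show ?thesis unfolding Z_def by (metis closure_subset rangeI subsetD)
  qed
  have "subspace Z" unfolding Z_def by (rule subspace_closure_rat_comb)
  moreover have "closed Z" by (simp add: Z_def)
  ultimately have yZ: "y \<in> Z" using weak_lim_in_subspace[OF _ _ y ne, of Z] xZ by simp
  have "norm y \<le> 0"
  proof (rule field_le_epsilon)
    fix e :: real assume "e > 0"
    then have "e / 2 > 0" by simp
    then obtain ps where ps: "dist (rat_comb x ps) y < e / 2"
      using yZ unfolding Z_def closure_approachable by (metis imageE)
    define d where "d = rat_comb x ps"
    define N where "N = Suc (to_nat ps + (\<Sum>(c, i)\<leftarrow>ps. i))"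
    have "to_nat ps \<in> J n" if "n \<ge> N" for n
    proof -
      have "i \<le> (\<Sum>(c, i)\<leftarrow>ps. i)" if "(c, i) \<in> set ps" for c i
        using member_le_sum_list[of i "map (\<lambda>(c, i). i) ps"] that by force
      then show ?thesis using that unfolding J_def N_def by fastforce
    qed
    then have "\<psi> d (x n) = 0" if "n \<ge> N" for n
      using x[of n] that by (force simp: P_def d_def)
    then have "eventually (\<lambda>n. \<psi> d (x n) = 0) U"
      using U(2) by (meson eventually_ge_at_top eventually_mono filter_leD)
    then have "((\<lambda>n. \<psi> d (x n)) \<longlongrightarrow> 0) U" by (rule tendsto_eventually)
    then have "\<psi> d y = 0" using tendsto_unique[OF ne weak_limD[OF y]] by blast
    then have "norm d \<le> norm (d - y)" using \<psi>(1)[of d] \<psi>(2)[of d "d - y"] by (simp add: blinfun.diff_right)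
    moreover have "norm y \<le> norm d + norm (d - y)" by (metis norm_minus_commute norm_triangle_sub)
    ultimately show "norm y \<le> 0 + e" using ps by (simp add: d_def dist_norm)
  qed
  then show ?thesis using that[of x] xA y by simp
qed

text \<open>Every position from which the game can still be won has a weakly null sequence of good continuations, by the preceding theorem.\<close>

theorem game_tree:
  fixes P :: "'a::real_normed_vector list \<Rightarrow> bool"
  assumes refl: "reflexive_space TYPE('a)" and U: "ultra U" "U \<le> sequentially"
    and game: "asymptotic_game P k []"
  obtains x :: "nat list \<Rightarrow> 'a" where
    "\<And>t l. length t < k \<Longrightarrow> norm (x (t @ [l])) = 1"
    "\<And>t. length t < k \<Longrightarrow> weak_lim U (\<lambda>l. x (t @ [l])) 0"
    "\<And>t. length t = k \<Longrightarrow> P (map (\<lambda>i. x (take (Suc i) t)) [0..<k])"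
proof -
  define live where "live xs \<longleftrightarrow> asymptotic_game P (k - length xs) xs" for xs
  have "\<exists>s. (\<forall>l. norm (s l) = 1 \<and> live (xs @ [s l])) \<and> weak_lim U s 0"
    if xs: "live xs" "length xs < k" for xs
  proof -
    have "k - length xs = Suc (k - Suc (length xs))" using xs(2) by simp
    then have *: "\<exists>x\<in>Y. x \<in> {x. norm x = 1 \<and> live (xs @ [x])}" if "Y \<in> cof" for Y
      using xs(1) that unfolding live_def by simp
    obtain s where "\<And>n. s n \<in> {x. norm x = 1 \<and> live (xs @ [x])}" "weak_lim U s 0"
      using weak_null_sequence[OF refl U *, of 1] by auto
    then show ?thesis by blast
  qed
  then obtain s where s: "\<And>xs l. live xs \<Longrightarrow> length xs < k \<Longrightarrow> norm (s xs l) = 1 \<and> live (xs @ [s xs l])"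
    "\<And>xs. live xs \<Longrightarrow> length xs < k \<Longrightarrow> weak_lim U (s xs) 0"
    by metis
  define v where "v t = foldl (\<lambda>xs l. xs @ [s xs l]) [] t" for t
  define x where "x t = last (v t)" for t
  have v_snoc: "v (t @ [l]) = v t @ [s (v t) l]" for t l by (simp add: v_def)
  have x_snoc: "x (t @ [l]) = s (v t) l" for t l by (simp add: x_def v_snoc)
  have len: "length (v t) = length t" for t
    by (induction t rule: rev_induct) (simp_all add: v_snoc, simp add: v_def)
  have live: "live (v t)" if "length t \<le> k" for t
    using that
  proof (induction t rule: rev_induct)
    case Nil then show ?case using game by (simp add: live_def v_def)
  next
    case (snoc l t) then show ?case using s(1) by (simp add: v_snoc len)
  qed
  have v_map: "v t = map (\<lambda>i. x (take (Suc i) t)) [0..<length t]" for t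
  proof (induction t rule: rev_induct)
    case Nil then show ?case by (simp add: v_def)
  next
    case (snoc l t) then show ?case by (simp add: v_snoc x_snoc)
  qed
  show ?thesis
  proof
    show "norm (x (t @ [l])) = 1" if "length t < k" for t l
      using s(1)[of "v t" l] live[of t] that by (simp add: x_snoc len)
    show "weak_lim U (\<lambda>l. x (t @ [l])) 0" if "length t < k" for t
      using s(2)[of "v t"] live[of t] that by (simp add: x_snoc len)
    show "P (map (\<lambda>i. x (take (Suc i) t)) [0..<k])" if "length t = k" for t
      using live[of t] that v_map[of t] len[of t] by (simp add: live_def)
  qed
qed

section \<open>Separated subtrees\<close>

text \<open>Functionals norming the branch vectors \<open>b t\<close> at level \<open>k\<close> are extended to all shorter lists by weak-star limits. Differences \<open>g (t @ [l]) - g t\<close> then form a weak-star null tree, so that a branch functional is decomposed along its branch. Beyond level \<open>k\<close> the tree is constant.\<close>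

theorem functional_tree:
  fixes b :: "nat list \<Rightarrow> 'a::real_normed_vector"
  assumes U: "ultra U"
  obtains g :: "nat list \<Rightarrow> 'a dual" where
    "\<And>t. length t = k \<Longrightarrow> g t (b t) = norm (b t)"
    "\<And>t y. \<bar>g t y\<bar> \<le> norm y"
    "\<And>t y. ((\<lambda>l. g (t @ [l]) y) \<longlongrightarrow> g t y) U"
proof -
  have "\<exists>\<phi> :: 'a dual. \<phi> (b t) = norm (b t) \<and> (\<forall>y. \<bar>\<phi> y\<bar> \<le> norm y)" for t
    using norming_functional[of "b t"] by blast
  then obtain \<phi> :: "nat list \<Rightarrow> 'a dual" where
    \<phi>: "\<And>t. \<phi> t (b t) = norm (b t)" "\<And>t y. \<bar>\<phi> t y\<bar> \<le> norm y" by metis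
  define L :: "(nat \<Rightarrow> 'a dual) \<Rightarrow> 'a dual" where
    "L h = (SOME g. (\<forall>y. \<bar>blinfun_apply g y\<bar> \<le> norm y) \<and> (\<forall>y. ((\<lambda>n. blinfun_apply (h n) y) \<longlongrightarrow> blinfun_apply g y) U))" for h
  have L: "\<bar>blinfun_apply (L h) y\<bar> \<le> norm y" "((\<lambda>n. blinfun_apply (h n) y) \<longlongrightarrow> blinfun_apply (L h) y) U"
    if h: "\<And>n y. \<bar>blinfun_apply (h n) y\<bar> \<le> norm y" for h y
  proof -
    have "\<exists>g :: 'a dual. (\<forall>y. \<bar>g y\<bar> \<le> norm y) \<and> (\<forall>y. ((\<lambda>n. h n y) \<longlongrightarrow> g y) U)"
      using weak_star_lim_exists[OF U, of h 1] h by simp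
    from someI_ex[OF this] show "\<bar>blinfun_apply (L h) y\<bar> \<le> norm y" "((\<lambda>n. blinfun_apply (h n) y) \<longlongrightarrow> blinfun_apply (L h) y) U"
      unfolding L_def by blast+
  qed
  define G where "G = rec_nat (\<lambda>t. \<phi> (take k t)) (\<lambda>_ G t. L (\<lambda>l. G (t @ [l])))"
  have G0: "G 0 t = \<phi> (take k t)" and GS: "G (Suc n) t = L (\<lambda>l. G n (t @ [l]))" for n t
    by (simp_all add: G_def)
  have Gb: "\<bar>G n t y\<bar> \<le> norm y" for n t y
    by (induction n arbitrary: t y) (simp_all add: G0 GS \<phi>(2) L(1))
  define g where "g t = G (k - length t) t" for t
  show ?thesis
  proof
    show "g t (b t) = norm (b t)" if "length t = k" for t
      using that \<phi>(1) by (simp add: g_def G0)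
    show "\<bar>g t y\<bar> \<le> norm y" for t y by (simp add: g_def Gb)
    show "((\<lambda>l. g (t @ [l]) y) \<longlongrightarrow> g t y) U" for t y
    proof (cases "length t < k")
      case True
      then have "k - length t = Suc (k - Suc (length t))" by simp
      then show ?thesis using L(2)[of "\<lambda>l. G (k - Suc (length t)) (t @ [l])" y] Gb by (simp add: g_def GS)
    next
      case False
      then show ?thesis by (simp add: g_def G0)
    qed
  qed
qed

text \<open>Simultaneous generic extension of finitely many nodes \<open>T s\<close> by one number each. Only sums over nodes of equal length are controlled, as each length is a row of the array to be built. The functionals of the new nodes are almost zero at the other new nodes: at those chosen later because the children of a node are weakly null, at those chosen earlier because the functional is then close to that of its parent.\<close>

lemma generic_extensions:
  fixes x :: "nat list \<Rightarrow> 'a::real_normed_vector" and g :: "nat list \<Rightarrow> 'a dual"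
  assumes conc: "concentration C TYPE('a)" "C \<ge> 0" and U: "ultra U" "U \<le> sequentially"
    and x: "\<And>t. norm (x t) \<le> 1" "\<And>t. weak_lim U (\<lambda>l. x (t @ [l])) 0"
    and g: "\<And>t y. ((\<lambda>l. g (t @ [l]) y) \<longlongrightarrow> g t y) U"
    and S: "finite S" and \<epsilon>: "\<epsilon> > 0"
  shows "\<exists>r :: 'i \<Rightarrow> nat.
     (\<forall>i<k::nat. norm (\<Sum>s\<in>{s\<in>S. length (T s) = i}. x (T s @ [r s])) \<le> 2 * C) \<and>
     (\<forall>s\<in>S. \<forall>p\<in>S. s \<noteq> p \<longrightarrow> \<bar>g (T s @ [r s]) (x (T p @ [r p]))\<bar> < \<epsilon>) \<and>
     (\<forall>s\<in>S. \<forall>p\<in>S. \<bar>g (T p) (x (T s @ [r s]))\<bar> < \<epsilon>) \<and>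
     (\<forall>s\<in>S. \<forall>p\<in>S. \<bar>g (T s @ [r s]) (x (T p)) - g (T s) (x (T p))\<bar> < \<epsilon>)"
proof -
  obtain h where h: "bij_betw h {0..<card S} S" using ex_bij_betw_nat_finite[OF S] by blast
  define n where "n = card S"
  have hS: "h ` {..<n} = S" and hinj: "inj_on h {..<n}"
    using h by (auto simp: bij_betw_def n_def atLeast0LessThan)
  have gx: "eventually (\<lambda>b. \<bar>g p (x (t @ [b]))\<bar> < \<delta>) U" if "\<delta> > 0" for p t \<delta>
    using tendsto_norm[OF weak_limD[OF x(2), of "g p" t]] that by (auto dest: order_tendstoD(2))
  have gg: "eventually (\<lambda>b. \<bar>g (t @ [b]) y - g t y\<bar> < \<delta>) U" if "\<delta> > 0" for t y \<delta>
    using g[of t y] that by (auto simp: tendsto_iff dist_real_def)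
  let ?W = "\<lambda>i ls. norm (\<Sum>j<n. if length (T (h j)) = i then x (T (h j) @ [ls ! j]) else 0) \<le> 2 * C"
  have ev1: "iter_ev U n (\<lambda>ls. \<forall>i\<in>{..<k}. ?W i ls) []"
  proof (rule iter_ev_ball_finite)
    fix i assume "i \<in> {..<k}"
    have "weak_lim U (\<lambda>l. if length (T (h j)) = i then x (T (h j) @ [l]) else 0) 0" for j
      by (cases "length (T (h j)) = i") (use x(2) weak_lim_const in auto)
    moreover have "norm (if length (T (h j)) = i then x (T (h j) @ [l]) else 0) \<le> 1" for j l
      using x(1) by simp
    ultimately show "iter_ev U n (?W i) []"
      using weak_null_array_bound[OF conc U, of "\<lambda>j l. if length (T (h j)) = i then x (T (h j) @ [l]) else 0" 1 n]
      by simp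
  qed simp
  have ev2: "iter_ev U n (\<lambda>ls. \<forall>j<n. \<forall>i<j.
      \<bar>g (T (h i) @ [ls ! i]) (x (T (h j) @ [ls ! j]))\<bar> < \<epsilon> \<and>
      \<bar>g (T (h j) @ [ls ! j]) (x (T (h i) @ [ls ! i])) - g (T (h j)) (x (T (h i) @ [ls ! i]))\<bar> < \<epsilon> / 2) []"
    by (rule iter_ev_pairs) (use \<epsilon> in \<open>intro eventually_conj gx gg; simp\<close>)
  have ev3: "iter_ev U n (\<lambda>ls. \<forall>i<n. \<forall>j\<in>{..<n}. \<bar>g (T (h j)) (x (T (h i) @ [ls ! i]))\<bar> < \<epsilon> / 2 \<and>
      \<bar>g (T (h i) @ [ls ! i]) (x (T (h j))) - g (T (h i)) (x (T (h j)))\<bar> < \<epsilon>) []"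
    by (rule iter_ev_coordinates) (use \<epsilon> in \<open>intro eventually_ball_finite ballI eventually_conj gx gg; simp\<close>)
  have ne: "iter_filter U n \<noteq> bot" using ultra_iter_filter[OF U(1)] by (simp add: ultra_def)
  from eventually_happens'[OF ne eventually_conj[OF ev1[folded eventually_iter_filter]
      eventually_conj[OF ev2[folded eventually_iter_filter] ev3[folded eventually_iter_filter]]]]
  obtain ls where ls: "\<And>i. i < k \<Longrightarrow> ?W i ls"
      "\<And>i j. i < j \<Longrightarrow> j < n \<Longrightarrow> \<bar>g (T (h i) @ [ls ! i]) (x (T (h j) @ [ls ! j]))\<bar> < \<epsilon>"
      "\<And>i j. i < j \<Longrightarrow> j < n \<Longrightarrow>
        \<bar>g (T (h j) @ [ls ! j]) (x (T (h i) @ [ls ! i])) - g (T (h j)) (x (T (h i) @ [ls ! i]))\<bar> < \<epsilon> / 2"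
      "\<And>i j. i < n \<Longrightarrow> j < n \<Longrightarrow> \<bar>g (T (h j)) (x (T (h i) @ [ls ! i]))\<bar> < \<epsilon> / 2"
      "\<And>i j. i < n \<Longrightarrow> j < n \<Longrightarrow> \<bar>g (T (h i) @ [ls ! i]) (x (T (h j))) - g (T (h i)) (x (T (h j)))\<bar> < \<epsilon>"
    by (elim exE conjE) (rule that; blast)
  define r where "r s = ls ! the_inv_into {..<n} h s" for s
  have rh: "r (h j) = ls ! j" if "j < n" for j
    using the_inv_into_f_f[OF hinj] that by (simp add: r_def)
  have r1: "norm (\<Sum>s\<in>{s\<in>S. length (T s) = i}. x (T s @ [r s])) \<le> 2 * C" if "i < k" for i
  proof -
    have "(\<Sum>s\<in>{s\<in>S. length (T s) = i}. x (T s @ [r s])) = (\<Sum>s\<in>S. if length (T s) = i then x (T s @ [r s]) else 0)"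
      using S by (simp add: sum.inter_filter)
    also have "\<dots> = (\<Sum>j<n. if length (T (h j)) = i then x (T (h j) @ [r (h j)]) else 0)"
      unfolding hS[symmetric] by (rule sum.reindex_cong[OF hinj refl refl])
    also have "\<dots> = (\<Sum>j<n. if length (T (h j)) = i then x (T (h j) @ [ls ! j]) else 0)"
      by (intro sum.cong) (auto simp: rh)
    finally show ?thesis using ls(1)[OF that] by simp
  qed
  have "\<bar>g (T (h i) @ [r (h i)]) (x (T (h j) @ [r (h j)]))\<bar> < \<epsilon>" if ij: "i < n" "j < n" "i \<noteq> j" for i j
  proof (cases "i < j")
    case True
    then show ?thesis using ls(2)[OF True ij(2)] unfolding rh[OF ij(1)] rh[OF ij(2)] by blast
  next
    case False
    then show ?thesis using ls(3)[of j i] ls(4)[of j i] ij unfolding rh[OF ij(1)] rh[OF ij(2)] by linarith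
  qed
  then have r2: "\<forall>s\<in>S. \<forall>p\<in>S. s \<noteq> p \<longrightarrow> \<bar>g (T s @ [r s]) (x (T p @ [r p]))\<bar> < \<epsilon>"
    unfolding hS[symmetric] ball_simps by blast
  have r3: "\<bar>g (T p) (x (T s @ [r s]))\<bar> < \<epsilon>" if "s \<in> S" "p \<in> S" for s p
  proof -
    have "s \<in> h ` {..<n}" "p \<in> h ` {..<n}" using that hS by auto
    then obtain i j where "i < n" "j < n" "s = h i" "p = h j" by auto
    then show ?thesis using ls(4)[of i j] \<epsilon> by (simp add: rh)
  qed
  have r4: "\<bar>g (T s @ [r s]) (x (T p)) - g (T s) (x (T p))\<bar> < \<epsilon>" if "s \<in> S" "p \<in> S" for s p
  proof -
    have "s \<in> h ` {..<n}" "p \<in> h ` {..<n}" using that hS by auto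
    then obtain i j where "i < n" "j < n" "s = h i" "p = h j" by auto
    then show ?thesis using ls(5)[of i j] by (simp add: rh)
  qed
  show ?thesis
  proof (intro exI[of _ r] conjI)
    show "\<forall>s\<in>S. \<forall>p\<in>S. s \<noteq> p \<longrightarrow> \<bar>g (T s @ [r s]) (x (T p @ [r p]))\<bar> < \<epsilon>" by (rule r2)
  qed (intro allI ballI impI r1 r3 r4; assumption)+
qed

text \<open>The node of the subtree that corresponds to a finite set \<open>A\<close> of positions. The label chosen at stage \<open>m\<close> depends on the elements of \<open>A\<close> below \<open>m\<close>, and initial segments of \<open>A\<close> give the predecessors of its node.\<close>

definition node :: "(nat \<Rightarrow> nat set \<Rightarrow> nat) \<Rightarrow> nat set \<Rightarrow> nat list" where
  "node l A = map (\<lambda>m. l m (A \<inter> {..<m})) (sorted_list_of_set A)"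

lemma node_empty: "node l {} = []"
  by (simp add: node_def)

lemma sorted_list_of_set_insert_max:
  assumes "finite A" "A \<subseteq> {..<m::nat}"
  shows "sorted_list_of_set (insert m A) = sorted_list_of_set A @ [m]"
proof -
  have "sorted_wrt (<) (sorted_list_of_set A @ [m])"
    using assms by (auto simp: sorted_wrt_append strict_sorted_list_of_set)
  then show ?thesis
    using sorted_list_of_set.idem_if_sorted_distinct[of "sorted_list_of_set A @ [m]"] assms(1)
    by (simp add: strict_sorted_iff)
qed

lemma node_insert:
  assumes "A \<subseteq> {..<m}"
  shows "node l (insert m A) = node l A @ [l m A]"
proof -
  have fin: "finite A" using assms finite_subset by blast
  have "insert m A \<inter> {..<j} = A \<inter> {..<j}" if "j \<in> A" for j using that assms by auto
  moreover have "insert m A \<inter> {..<m} = A" using assms by auto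
  ultimately show ?thesis
    using fin sorted_list_of_set_insert_max[OF fin assms] by (simp add: node_def)
qed

lemma length_node: "finite A \<Longrightarrow> length (node l A) = card A"
  by (simp add: node_def)

lemma node_cong: "(\<And>j. j \<in> A \<Longrightarrow> l j = l' j) \<Longrightarrow> finite A \<Longrightarrow> node l A = node l' A"
  by (simp add: node_def)

lemma node_image:
  assumes "strict_mono (e :: nat \<Rightarrow> nat)"
  shows "node l (e ` {..<Suc i}) = node l (e ` {..<i}) @ [l (e i) (e ` {..<i})]"
proof -
  have "e ` {..<i} \<subseteq> {..<e i}" using assms by (auto simp: strict_mono_less)
  then show ?thesis using node_insert by (simp add: lessThan_Suc)
qed

lemma take_node_image:
  assumes "strict_mono (e :: nat \<Rightarrow> nat)" "i \<le> k"
  shows "take i (node l (e ` {..<k})) = node l (e ` {..<i})"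
  using assms(2)
proof (induction k)
  case 0
  then show ?case by (simp add: node_empty)
next
  case (Suc k)
  have len: "length (node l (e ` {..<j})) = j" for j
    using assms(1) by (simp add: length_node card_image strict_mono_imp_inj_on inj_on_subset)
  show ?case
  proof (cases "i = Suc k")
    case True then show ?thesis using len[of "Suc k"] by simp
  next
    case False then show ?thesis using Suc len[of k] by (simp add: node_image[OF assms(1)])
  qed
qed

text \<open>At stage \<open>m\<close> the nodes of all sets of numbers below \<open>m\<close> are extended at the same time. There are \<open>2 ^ m\<close> of them, so that the tolerances \<open>\<epsilon> m\<close> can be chosen small compared with their number.\<close>

lemma separated_subtree:
  fixes x :: "nat list \<Rightarrow> 'a::real_normed_vector" and g :: "nat list \<Rightarrow> 'a dual"
  assumes conc: "concentration C TYPE('a)" "C \<ge> 0" and U: "ultra U" "U \<le> sequentially"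
    and x: "\<And>t. norm (x t) \<le> 1" "\<And>t. weak_lim U (\<lambda>l. x (t @ [l])) 0"
    and g: "\<And>t y. ((\<lambda>l. g (t @ [l]) y) \<longlongrightarrow> g t y) U"
    and \<epsilon>: "\<And>m. \<epsilon> m > 0"
  obtains l where
    "\<And>m i. i < k \<Longrightarrow> norm (\<Sum>s\<in>{s\<in>Pow {..<m}. card s = i}. x (node l (insert m s))) \<le> 2 * C"
    "\<And>m s p. s \<subseteq> {..<m} \<Longrightarrow> p \<subseteq> {..<m} \<Longrightarrow> s \<noteq> p \<Longrightarrow> \<bar>g (node l (insert m s)) (x (node l (insert m p)))\<bar> < \<epsilon> m"
    "\<And>m s p. s \<subseteq> {..<m} \<Longrightarrow> p \<subseteq> {..<m} \<Longrightarrow> \<bar>g (node l p) (x (node l (insert m s)))\<bar> < \<epsilon> m"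
    "\<And>m s p. s \<subseteq> {..<m} \<Longrightarrow> p \<subseteq> {..<m} \<Longrightarrow> \<bar>g (node l (insert m s)) (x (node l p)) - g (node l s) (x (node l p))\<bar> < \<epsilon> m"
proof -
  define P where "P l m r \<longleftrightarrow>
     (\<forall>i<k. norm (\<Sum>s\<in>{s\<in>Pow {..<m}. card s = i}. x (node l s @ [r s])) \<le> 2 * C) \<and>
     (\<forall>s\<in>Pow {..<m}. \<forall>p\<in>Pow {..<m}. s \<noteq> p \<longrightarrow> \<bar>g (node l s @ [r s]) (x (node l p @ [r p]))\<bar> < \<epsilon> m) \<and>
     (\<forall>s\<in>Pow {..<m}. \<forall>p\<in>Pow {..<m}. \<bar>g (node l p) (x (node l s @ [r s]))\<bar> < \<epsilon> m) \<and>
     (\<forall>s\<in>Pow {..<m}. \<forall>p\<in>Pow {..<m}. \<bar>g (node l s @ [r s]) (x (node l p)) - g (node l s) (x (node l p))\<bar> < \<epsilon> m)"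
    for l m r
  have len: "{s \<in> Pow {..<m}. length (node l s) = i} = {s \<in> Pow {..<m}. card s = i}" for m i and l
    by (auto simp: length_node finite_subset)
  have "\<exists>l. \<forall>m. P l m (l m)"
  proof (rule dependent_wellorder_choice)
    fix m r and l l' :: "nat \<Rightarrow> nat set \<Rightarrow> nat" assume "\<And>j. j < m \<Longrightarrow> l j = l' j"
    then have eq: "node l s = node l' s" if "s \<in> Pow {..<m}" for s
      using that by (intro node_cong) (auto intro: finite_subset)
    have "(\<Sum>s\<in>{s\<in>Pow {..<m}. card s = i}. x (node l s @ [r s])) = (\<Sum>s\<in>{s\<in>Pow {..<m}. card s = i}. x (node l' s @ [r s]))" for i
      by (rule sum.cong) (use eq in auto)
    then show "P l m r = P l' m r" unfolding P_def by (simp add: eq cong: ball_cong_simp)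
  next
    fix m and l :: "nat \<Rightarrow> nat set \<Rightarrow> nat"
    have "finite (Pow {..<m::nat})" by simp
    from generic_extensions[OF conc U x g this \<epsilon>[of m], of k "node l"]
    show "\<exists>r. P l m r" unfolding P_def len .
  qed
  then obtain l where l: "\<And>m. P l m (l m)" by blast
  have ins: "node l s @ [l m s] = node l (insert m s)" if "s \<in> Pow {..<m}" for m s
    using that by (simp add: node_insert)
  show ?thesis
  proof (rule that[of l])
    fix m
    have P: "P l m (l m)" by (rule l)
    show "norm (\<Sum>s\<in>{s\<in>Pow {..<m}. card s = i}. x (node l (insert m s))) \<le> 2 * C" if "i < k" for i
    proof -
      have "(\<Sum>s\<in>{s\<in>Pow {..<m}. card s = i}. x (node l (insert m s))) = (\<Sum>s\<in>{s\<in>Pow {..<m}. card s = i}. x (node l s @ [l m s]))"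
        by (rule sum.cong) (use ins in auto)
      then show ?thesis using P that unfolding P_def by simp
    qed
    fix s p assume sp: "s \<subseteq> {..<m}" "p \<subseteq> {..<m}"
    then have sp': "s \<in> Pow {..<m}" "p \<in> Pow {..<m}" by auto
    show "\<bar>g (node l (insert m s)) (x (node l (insert m p)))\<bar> < \<epsilon> m" if "s \<noteq> p"
      using P sp' that unfolding P_def ins[OF sp'(1), symmetric] ins[OF sp'(2), symmetric] by blast
    show "\<bar>g (node l p) (x (node l (insert m s)))\<bar> < \<epsilon> m"
      using P sp' unfolding P_def ins[OF sp'(1), symmetric] by blast
    show "\<bar>g (node l (insert m s)) (x (node l p)) - g (node l s) (x (node l p))\<bar> < \<epsilon> m"
      using P sp' unfolding P_def ins[OF sp'(1), symmetric] by blast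
  qed
qed

section \<open>Concentration bounds branch sums\<close>

text \<open>The map to which concentration is applied sends \<open>A\<close> to the sum, over \<open>m\<close> in \<open>A\<close>, of all nodes of sets \<open>insert m s\<close> with \<open>s \<subseteq> {..<m}\<close> having as many elements as \<open>A \<inter> {..<m}\<close>. The nodes of the branch of \<open>A\<close> occur among them, and the functional of that branch nearly vanishes at all others.\<close>

theorem concentration_tree_bound:
  fixes x :: "nat list \<Rightarrow> 'a::real_normed_vector"
  assumes conc: "concentration C TYPE('a)" "C \<ge> 0" and U: "ultra U" "U \<le> sequentially"
    and x: "\<And>t. norm (x t) \<le> 1" "\<And>t. weak_lim U (\<lambda>l. x (t @ [l])) 0"
    and k: "k \<ge> 1" and K: "\<And>t. length t = k \<Longrightarrow> norm (\<Sum>i<k. x (take (Suc i) t)) \<ge> K"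
  shows "K \<le> 4 * C\<^sup>2 + 1"
proof -
  obtain g :: "nat list \<Rightarrow> 'a dual" where
    g: "\<And>t. length t = k \<Longrightarrow> g t (\<Sum>i<k. x (take (Suc i) t)) = norm (\<Sum>i<k. x (take (Suc i) t))"
    "\<And>t y. \<bar>g t y\<bar> \<le> norm y"
    "\<And>t y. ((\<lambda>l. g (t @ [l]) y) \<longlongrightarrow> g t y) U"
    using functional_tree[OF U(1), of k "\<lambda>t. \<Sum>i<k. x (take (Suc i) t)"] by blast
  \<comment> \<open>Each of the \<open>k\<close> summands of the first block contributes an error of at most \<open>k \<delta>\<close>, each of the second block
    one of at most \<open>\<delta>\<close>; altogether this is 1. The tolerance of a single node at stage \<open>m\<close> is divided by the
    number \<open>2 ^ m\<close> of nodes.\<close>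
  define \<delta> where "\<delta> = 1 / (real k * (real k + 1))"
  define \<epsilon> where "\<epsilon> m = \<delta> / 2 ^ m" for m :: nat
  have "real k * (real k + 1) > 0" using k by simp
  then have "\<delta> > 0" "\<delta> * (real k * (real k + 1)) = 1" using k by (simp_all add: \<delta>_def)
  then have \<delta>: "\<delta> > 0" "real k * (real k * \<delta>) + real k * \<delta> = 1" by (simp_all add: algebra_simps)
  have \<epsilon>: "\<epsilon> m > 0" for m using \<delta> by (simp add: \<epsilon>_def)
  have \<epsilon>_mono: "\<epsilon> n \<le> \<epsilon> m" if "m \<le> n" for m n
    using \<delta>(1) that unfolding \<epsilon>_def by (intro divide_left_mono power_increasing) auto
  obtain l where
    w: "\<And>m i. i < k \<Longrightarrow> norm (\<Sum>s\<in>{s\<in>Pow {..<m}. card s = i}. x (node l (insert m s))) \<le> 2 * C" and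
    sep1: "\<And>m s p. s \<subseteq> {..<m} \<Longrightarrow> p \<subseteq> {..<m} \<Longrightarrow> s \<noteq> p \<Longrightarrow> \<bar>g (node l (insert m s)) (x (node l (insert m p)))\<bar> < \<epsilon> m" and
    sep2: "\<And>m s p. s \<subseteq> {..<m} \<Longrightarrow> p \<subseteq> {..<m} \<Longrightarrow> \<bar>g (node l p) (x (node l (insert m s)))\<bar> < \<epsilon> m" and
    sep3: "\<And>m s p. s \<subseteq> {..<m} \<Longrightarrow> p \<subseteq> {..<m} \<Longrightarrow> \<bar>g (node l (insert m s)) (x (node l p)) - g (node l s) (x (node l p))\<bar> < \<epsilon> m"
    by (rule separated_subtree[OF conc U x g(3) \<epsilon>, of k]) (rule that; assumption)
  define S where "S m i = {s\<in>Pow {..<m}. card s = i}" for m i :: nat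
  define f where "f i m = (if i < k then \<Sum>s\<in>S m i. x (node l (insert m s)) else 0)" for i m
  have S: "finite (S m i)" "card (S m i) \<le> 2 ^ m" for m i
  proof -
    have "card (S m i) \<le> card (Pow {..<m})" unfolding S_def by (intro card_mono) auto
    then show "card (S m i) \<le> 2 ^ m" by (simp add: card_Pow)
    show "finite (S m i)" by (simp add: S_def)
  qed
  have S\<epsilon>: "real (card (S m i)) * \<epsilon> m \<le> \<delta>" for m i
  proof -
    have "real (card (S m i)) * \<epsilon> m \<le> 2 ^ m * \<epsilon> m"
      using S(2)[of m i] \<epsilon>[of m] by (intro mult_right_mono) (auto simp: of_nat_le_iff[symmetric] simp del: of_nat_le_iff)
    then show ?thesis by (simp add: \<epsilon>_def)
  qed
  have fb: "norm (f i m) \<le> 2 * C" for i m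
    using w[of i m] conc(2) by (simp add: f_def S_def)
  obtain e :: "nat \<Rightarrow> nat" where e: "strict_mono e"
    "norm ((\<Sum>i<k. f i (e i)) - (\<Sum>i<k. f i (e (k + i)))) \<le> 2 * C * (2 * C)"
    by (rule array_concentration[OF conc k fb]) (rule that; assumption)
  define A where "A = e ` {..<k}"
  define G where "G = g (node l A)"
  have lt: "e ` {..<i} \<subseteq> {..<e j}" if "i \<le> j" for i j
    using e(1) that by (auto simp: strict_mono_less)
  have cardA: "card (e ` {..<i}) = i" for i
    using e(1) by (simp add: card_image strict_mono_imp_inj_on inj_on_subset)
  have lenA: "length (node l A) = k" by (simp add: A_def length_node cardA)
  have off: "\<bar>G (x (node l (insert (e i) s)))\<bar> \<le> real k * \<epsilon> (e i)"
    if i: "i < k" and s: "s \<subseteq> {..<e i}" "s \<noteq> e ` {..<i}" for i s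
  proof -
    \<comment> \<open>The branch and the node separate at stage \<open>e i\<close>; each later stage changes the value of the branch functional little.\<close>
    have "\<bar>g (node l (e ` {..<j})) (x (node l (insert (e i) s)))\<bar> \<le> real j * \<epsilon> (e i)"
      if "Suc i \<le> j" for j
      using that
    proof (induction j rule: dec_induct)
      case base
      have "e ` {..<Suc i} = insert (e i) (e ` {..<i})" by (simp add: lessThan_Suc)
      then have "\<bar>g (node l (e ` {..<Suc i})) (x (node l (insert (e i) s)))\<bar> < \<epsilon> (e i)"
        using sep1[of "e ` {..<i}" "e i" s] s lt[of i i] by simp
      moreover have "\<epsilon> (e i) \<le> real (Suc i) * \<epsilon> (e i)" using \<epsilon>[of "e i"] by (simp add: algebra_simps)
      ultimately show ?case by linarith
    next
      case (step j)
      have eq: "e ` {..<Suc j} = insert (e j) (e ` {..<j})" by (simp add: lessThan_Suc)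
      have ij: "e i < e j" using step(1) e(1) by (simp add: strict_mono_less)
      then have "insert (e i) s \<subseteq> {..<e j}" using s(1) by auto
      then have "\<bar>g (node l (insert (e j) (e ` {..<j}))) (x (node l (insert (e i) s)))
          - g (node l (e ` {..<j})) (x (node l (insert (e i) s)))\<bar> < \<epsilon> (e j)"
        by (rule sep3[OF lt[of j j, OF order_refl]])
      moreover have "\<epsilon> (e j) \<le> \<epsilon> (e i)" using ij by (intro \<epsilon>_mono) simp
      ultimately have "\<bar>g (node l (e ` {..<Suc j})) (x (node l (insert (e i) s)))\<bar> \<le> real j * \<epsilon> (e i) + \<epsilon> (e i)"
        using step.IH unfolding eq by linarith
      then show ?case by (simp add: algebra_simps)
    qed
    then show ?thesis using i by (simp add: G_def A_def)
  qed
  have lower: "G (f i (e i)) \<ge> G (x (take (Suc i) (node l A))) - real k * \<delta>" if i: "i < k" for i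
  proof -
    let ?b = "e ` {..<i}"
    have bS: "?b \<in> S (e i) i" using lt[of i i] cardA by (auto simp: S_def)
    have "insert (e i) ?b = e ` {..<Suc i}" by (simp add: lessThan_Suc)
    then have b: "node l (insert (e i) ?b) = take (Suc i) (node l A)"
      using take_node_image[OF e(1), of "Suc i" k l] i by (simp add: A_def)
    have "G (f i (e i)) = (\<Sum>s\<in>S (e i) i. G (x (node l (insert (e i) s))))"
      using i by (simp add: f_def blinfun.sum_right)
    also have "\<dots> = G (x (node l (insert (e i) ?b))) + (\<Sum>s\<in>S (e i) i - {?b}. G (x (node l (insert (e i) s))))"
      by (rule sum.remove[OF S(1) bS])
    finally have eq: "G (f i (e i)) - G (x (take (Suc i) (node l A))) = (\<Sum>s\<in>S (e i) i - {?b}. G (x (node l (insert (e i) s))))"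
      unfolding b by simp
    have "norm (\<Sum>s\<in>S (e i) i - {?b}. G (x (node l (insert (e i) s)))) \<le> (\<Sum>s\<in>S (e i) i - {?b}. real k * \<epsilon> (e i))"
      using i by (intro sum_norm_le) (auto simp: S_def intro!: off)
    also have "\<dots> \<le> (\<Sum>s\<in>S (e i) i. real k * \<epsilon> (e i))"
      using S(1) \<epsilon>[of "e i"] by (intro sum_mono2) auto
    also have "\<dots> = real k * (real (card (S (e i) i)) * \<epsilon> (e i))" by simp
    also have "\<dots> \<le> real k * \<delta>" using S\<epsilon> by (intro mult_left_mono) auto
    finally show ?thesis using eq by (simp add: abs_le_iff)
  qed
  have upper: "G (f i (e (k + i))) \<le> \<delta>" if i: "i < k" for i
  proof -
    have "G (f i (e (k + i))) = (\<Sum>s\<in>S (e (k + i)) i. G (x (node l (insert (e (k + i)) s))))"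
      using i by (simp add: f_def blinfun.sum_right)
    also have "\<dots> \<le> (\<Sum>s\<in>S (e (k + i)) i. \<epsilon> (e (k + i)))"
    proof (rule sum_mono)
      fix s assume "s \<in> S (e (k + i)) i"
      then have "s \<subseteq> {..<e (k + i)}" by (auto simp: S_def)
      moreover have "A \<subseteq> {..<e (k + i)}" unfolding A_def by (rule lt) simp
      ultimately show "G (x (node l (insert (e (k + i)) s))) \<le> \<epsilon> (e (k + i))"
        using sep2[of s "e (k + i)" A] by (simp add: G_def)
    qed
    also have "\<dots> \<le> \<delta>" using S\<epsilon> by simp
    finally show ?thesis .
  qed
  have "K \<le> G (\<Sum>i<k. x (take (Suc i) (node l A)))"
    using K[OF lenA] g(1)[OF lenA] by (simp add: G_def)
  also have "\<dots> = (\<Sum>i<k. G (x (take (Suc i) (node l A))))" by (simp add: blinfun.sum_right)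
  also have "\<dots> \<le> (\<Sum>i<k. G (f i (e i)) + real k * \<delta>)"
    using lower by (intro sum_mono) (simp add: algebra_simps)
  finally have 1: "K \<le> G (\<Sum>i<k. f i (e i)) + real k * (real k * \<delta>)"
    by (simp add: blinfun.sum_right sum.distrib)
  have "(\<Sum>i<k. G (f i (e (k + i)))) \<le> (\<Sum>i<k. \<delta>)" using upper by (intro sum_mono) simp
  then have 2: "G (\<Sum>i<k. f i (e (k + i))) \<le> real k * \<delta>" by (simp add: blinfun.sum_right)
  have "G ((\<Sum>i<k. f i (e i)) - (\<Sum>i<k. f i (e (k + i)))) \<le> 2 * C * (2 * C)"
    using g(2)[of "node l A" "(\<Sum>i<k. f i (e i)) - (\<Sum>i<k. f i (e (k + i)))"] e(2) unfolding G_def by linarith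
  then show ?thesis using 1 2 \<delta>(2) by (simp add: blinfun.diff_right power2_eq_square)
qed

section \<open>Norms on finite-dimensional spaces\<close>

abbreviation (input) coord :: "('i \<Rightarrow>\<^sub>0 'b::zero) \<Rightarrow> 'i \<Rightarrow> 'b" where
  "coord \<equiv> Poly_Mapping.lookup"

lemma lookup_scaleR_poly_mapping:
  "coord (r *\<^sub>R v) i = r *\<^sub>R coord v i"
  for v :: "'i \<Rightarrow>\<^sub>0 'b::real_vector"
proof -
  have "finite {i. r *\<^sub>R coord v i \<noteq> 0}"
    by (rule finite_subset[OF _ finite_lookup[of v]]) auto
  then show ?thesis by (simp add: scaleR_poly_mapping_def)
qed

definition rvec :: "nat \<Rightarrow> (nat \<Rightarrow> real) \<Rightarrow> (nat \<Rightarrow>\<^sub>0 real)" where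
  "rvec n a = (\<Sum>i<n. a i *\<^sub>R unit_vec i)"

lemma lookup_rvec: "coord (rvec n a) j = (if j < n then a j else 0)"
proof -
  have "coord (rvec n a) j = (\<Sum>i<n. if i = j then a i else 0)"
    unfolding rvec_def lookup_sum
    by (intro sum.cong) (auto simp: lookup_scaleR_poly_mapping unit_vec_def lookup_single when_def)
  then show ?thesis by simp
qed

lemma rvec_scale: "rvec n (\<lambda>i. c * a i) = c *\<^sub>R rvec n a"
  by (simp add: rvec_def scaleR_sum_right)

lemma rvec_eq_0_iff: "rvec n a = 0 \<longleftrightarrow> (\<forall>i<n. a i = 0)"
  by (auto simp: poly_mapping_eq_iff fun_eq_iff lookup_rvec)

lemma rvec_in_Rk: "n \<le> k \<Longrightarrow> rvec n a \<in> Rk k"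
  unfolding rvec_def Rk_def by (intro span_sum span_scale span_base) auto

lemma Rk_eq_rvec: assumes "v \<in> Rk k" shows "v = rvec k (coord v)"
proof -
  let ?S = "{v. v = rvec k (coord v)}"
  have "subspace ?S"
    by (auto simp: subspace_def poly_mapping_eq_iff fun_eq_iff lookup_rvec lookup_add lookup_scaleR_poly_mapping split: if_splits)
  moreover have "unit_vec ` {..<k} \<subseteq> ?S"
    by (auto simp: poly_mapping_eq_iff fun_eq_iff lookup_rvec unit_vec_def lookup_single when_def)
  ultimately have "Rk k \<subseteq> ?S" unfolding Rk_def by (rule span_minimal[rotated])
  then show ?thesis using assms by auto
qed

lemma lin_indep_seqI:
  assumes "\<And>a i. (\<Sum>i<k. a i *\<^sub>R x i) = 0 \<Longrightarrow> i < k \<Longrightarrow> a i = 0"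
  shows "lin_indep_seq k x"
proof -
  have inj: "inj_on x {..<k}"
  proof (rule inj_onI, rule ccontr)
    fix i j assume ij: "i \<in> {..<k}" "j \<in> {..<k}" "x i = x j" "i \<noteq> j"
    have "(\<Sum>m<k. (if m = i then 1 else if m = j then - 1 else 0) *\<^sub>R x m)
        = (\<Sum>m<k. (if m = i then x i else 0) - (if m = j then x j else 0))"
      using ij(4) by (intro sum.cong) auto
    also have "\<dots> = 0" using ij by (simp add: sum_subtractf)
    finally show False using assms[of "\<lambda>m. if m = i then 1 else if m = j then - 1 else 0" i] ij(1) by simp
  qed
  have "independent (x ` {..<k})"
  proof (rule independent_if_scalars_zero)
    fix f v assume f: "(\<Sum>v\<in>x ` {..<k}. f v *\<^sub>R v) = 0" and v: "v \<in> x ` {..<k}"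
    have "(\<Sum>i<k. f (x i) *\<^sub>R x i) = 0" using f by (simp add: sum.reindex[OF inj])
    then show "f v = 0" using v assms[of "\<lambda>i. f (x i)"] by auto
  qed simp
  then show ?thesis using inj by (simp add: lin_indep_seq_def)
qed

lemma lin_indep_unit_vec: "lin_indep_seq k unit_vec"
  by (rule lin_indep_seqI) (auto simp: rvec_def[symmetric] rvec_eq_0_iff)

lemma linf_norm_rvec: "k \<ge> 1 \<Longrightarrow> linf_norm k (rvec k a) = Max ((\<lambda>i. \<bar>a i\<bar>) ` {..<k})"
  unfolding linf_norm_def by (intro arg_cong[where f=Max] image_cong) (auto simp: lookup_rvec)

lemma max_coordinate:
  fixes a :: "nat \<Rightarrow> real"
  assumes "k \<ge> 1"
  obtains j where "j < k" "Max ((\<lambda>i. \<bar>a i\<bar>) ` {..<k}) = \<bar>a j\<bar>" "\<And>i. i < k \<Longrightarrow> \<bar>a i\<bar> \<le> \<bar>a j\<bar>"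
proof -
  let ?M = "(\<lambda>i. \<bar>a i\<bar>) ` {..<k}"
  have "Max ?M \<in> ?M" using assms by (intro Max_in) (auto simp: lessThan_empty_iff)
  then obtain j where j: "j < k" "Max ?M = \<bar>a j\<bar>" by auto
  moreover have "\<bar>a i\<bar> \<le> Max ?M" if "i < k" for i using that by (intro Max_ge) auto
  ultimately show ?thesis using that by metis
qed

text \<open>The factor 2 arises because a coordinate is the difference of two initial projections, each of norm at most 1.\<close>

lemma normalized_monotone_normsD:
  assumes N: "N \<in> normalized_monotone_norms k"
  shows "\<And>a. N (rvec k (\<lambda>i. c * a i)) = \<bar>c\<bar> * N (rvec k a)"
    and "\<And>a j. j < k \<Longrightarrow> \<bar>a j\<bar> \<le> 2 * N (rvec k a)"
    and "N 0 = 0"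
proof -
  have nrm: "norm_on (Rk k) N" and unit: "\<And>j. j < k \<Longrightarrow> N (unit_vec j) = 1"
    and mono: "\<And>a m n. m \<le> n \<Longrightarrow> n \<le> k \<Longrightarrow> N (rvec m a) \<le> N (rvec n a)"
    using N unfolding normalized_monotone_norms_def rvec_def by auto
  have sc: "N (c *\<^sub>R v) = \<bar>c\<bar> * N v" if "v \<in> Rk k" for c v using nrm that by (auto simp: norm_on_def)
  have tri: "N (v + w) \<le> N v + N w" if "v \<in> Rk k" "w \<in> Rk k" for v w
    using nrm that unfolding norm_on_def by blast
  show "N (rvec k (\<lambda>i. c * a i)) = \<bar>c\<bar> * N (rvec k a)" for a
    using sc[OF rvec_in_Rk[of k k a]] by (simp add: rvec_scale)
  have R0: "0 \<in> Rk k" unfolding Rk_def by (rule span_zero)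
  then show "N 0 = 0" using nrm by (auto simp: norm_on_def)
  show "\<bar>a j\<bar> \<le> 2 * N (rvec k a)" if j: "j < k" for a j
  proof -
    have R: "unit_vec j \<in> Rk k" "rvec (Suc j) a \<in> Rk k" "rvec j a \<in> Rk k"
      using j by (auto simp: Rk_def[of k] rvec_in_Rk intro: span_base) (auto simp: Rk_def[symmetric] intro!: rvec_in_Rk)
    have Rm: "(-1) *\<^sub>R rvec j a \<in> Rk k" using R(3) unfolding Rk_def by (rule span_scale)
    have "a j *\<^sub>R unit_vec j = rvec (Suc j) a + (-1) *\<^sub>R rvec j a" by (simp add: rvec_def)
    then have "\<bar>a j\<bar> * N (unit_vec j) = N (rvec (Suc j) a + (-1) *\<^sub>R rvec j a)" using sc[OF R(1)] by metis
    also have "\<dots> \<le> N (rvec (Suc j) a) + N ((-1) *\<^sub>R rvec j a)"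
      using tri[OF R(2) Rm] .
    also have "\<dots> = N (rvec (Suc j) a) + N (rvec j a)" using sc[OF R(3), of "-1"] by simp
    also have "\<dots> \<le> 2 * N (rvec k a)" using mono[of "Suc j" k a] mono[of j k a] j by simp
    finally show ?thesis using unit[OF j] by simp
  qed
qed

lemma equivalent_linfI:
  assumes N: "N \<in> normalized_monotone_norms k" and k: "k \<ge> 1" and D: "D > 0"
    and le: "\<And>a. (\<And>i. i < k \<Longrightarrow> \<bar>a i\<bar> \<le> 1) \<Longrightarrow> N (rvec k a) \<le> D"
  shows "equivalent_seqs (D * 2) k N unit_vec (linf_norm k) unit_vec"
proof -
  have "1 / D * N (rvec k a) \<le> linf_norm k (rvec k a) \<and> linf_norm k (rvec k a) \<le> 2 * N (rvec k a)" for a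
  proof
    obtain j where j: "j < k" "Max ((\<lambda>i. \<bar>a i\<bar>) ` {..<k}) = \<bar>a j\<bar>" "\<And>i. i < k \<Longrightarrow> \<bar>a i\<bar> \<le> \<bar>a j\<bar>"
      using max_coordinate[OF k, of a] by metis
    define m where "m = \<bar>a j\<bar>"
    have mge: "\<bar>a i\<bar> \<le> m" if "i < k" for i using j(3) that by (simp add: m_def)
    show "linf_norm k (rvec k a) \<le> 2 * N (rvec k a)"
      using normalized_monotone_normsD(2)[OF N j(1)] by (simp add: linf_norm_rvec[OF k] j(2))
    have "N (rvec k a) \<le> m * D"
    proof (cases "m = 0")
      case True
      then have "rvec k a = 0" using mge by (simp add: rvec_eq_0_iff)
      then show ?thesis using normalized_monotone_normsD(3)[OF N] True by simp
    next
      case False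
      have "m > 0" using False mge[of 0] k by simp
      then have "N (rvec k (\<lambda>i. 1 / m * a i)) \<le> D" using mge by (intro le) (auto simp: abs_mult field_simps)
      from mult_left_mono[OF this less_imp_le[OF \<open>m > 0\<close>]] show ?thesis
        using normalized_monotone_normsD(1)[OF N, of "1/m" a] \<open>m > 0\<close>
        by (simp add: pos_divide_le_eq mult.commute)
    qed
    then show "1 / D * N (rvec k a) \<le> linf_norm k (rvec k a)"
      using D by (simp add: linf_norm_rvec[OF k] j(2) m_def field_simps)
  qed
  then show ?thesis
    unfolding equivalent_seqs_def rvec_def[symmetric] using D lin_indep_unit_vec
    by (intro conjI exI[of _ D] exI[of _ 2]) auto
qed

text \<open>A norm in the asymptotic structure that takes a large value at some \<open>a\<close> in the unit cube would give, through the game, a weakly null tree whose nodes, multiplied by the \<open>a i\<close>, have large branch sums.\<close>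

theorem concentration_imp_asymptotic_c0:
  assumes conc: "concentration C TYPE('a::banach)" "C \<ge> 1"
  shows "asymptotic_c0 TYPE('a)"
proof -
  define K where "K = 4 * C\<^sup>2 + 1"
  have K: "K \<ge> 1" by (simp add: K_def)
  have refl: "reflexive_space TYPE('a)" by (rule concentration_imp_reflexive[OF conc])
  obtain U :: "nat filter" where U: "U \<le> sequentially" "ultra U"
    using exists_ultra[of sequentially] by auto
  have "N (rvec k a) \<le> K" if k: "k \<ge> 1" and N: "N \<in> asymptotic_structure TYPE('a) k"
    and a: "\<And>i. i < k \<Longrightarrow> \<bar>a i\<bar> \<le> 1" for k N a
  proof (rule ccontr)
    assume "\<not> ?thesis"
    then have Na: "N (rvec k a) > K" by simp
    \<comment> \<open>So small that the branch sums of a \<open>(1 + \<epsilon>)\<close>-equivalent tree still exceed the bound \<open>K\<close>.\<close>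
    define \<epsilon> where "\<epsilon> = (N (rvec k a) / K - 1) / 2"
    have \<epsilon>: "\<epsilon> > 0" using Na K by (simp add: \<epsilon>_def field_simps)
    have "K * (1 + \<epsilon>) = (N (rvec k a) + K) / 2" using K by (simp add: \<epsilon>_def field_simps)
    then have "K * (1 + \<epsilon>) < N (rvec k a)" using Na by simp
    then have big: "K < N (rvec k a) / (1 + \<epsilon>)" using \<epsilon> by (simp add: field_simps)
    have Nn: "N \<in> normalized_monotone_norms k" using N by (simp add: asymptotic_structure_def)
    let ?P = "\<lambda>xs :: 'a list. equivalent_seqs (1 + \<epsilon>) k norm (\<lambda>i. xs ! i) N unit_vec"
    have "asymptotic_game ?P k []" using N \<epsilon> by (simp add: asymptotic_structure_def)
    from game_tree[OF refl U(2,1) this] obtain y :: "nat list \<Rightarrow> 'a" where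
      y: "\<And>t l. length t < k \<Longrightarrow> norm (y (t @ [l])) = 1"
      "\<And>t. length t < k \<Longrightarrow> weak_lim U (\<lambda>l. y (t @ [l])) 0"
      "\<And>t. length t = k \<Longrightarrow> ?P (map (\<lambda>i. y (take (Suc i) t)) [0..<k])"
      by metis
    \<comment> \<open>Zero beyond level \<open>k\<close>, so that the tree is weakly null at every list.\<close>
    define x where "x t = (if t \<noteq> [] \<and> length t \<le> k then a (length t - 1) *\<^sub>R y t else 0)" for t
    have x1: "norm (x t) \<le> 1" for t
    proof (cases "t \<noteq> [] \<and> length t \<le> k")
      case True
      then have t: "t = butlast t @ [last t]" "length (butlast t) < k" by (simp, cases t, auto)
      have "norm (y t) = 1" using y(1)[OF t(2), of "last t"] t(1) by simp
      then show ?thesis using True t(2) a[of "length t - 1"] by (simp add: x_def)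
    next
      case False
      then show ?thesis unfolding x_def by (simp only: if_False norm_zero zero_le_one)
    qed
    have x2: "weak_lim U (\<lambda>l. x (t @ [l])) 0" for t
    proof (cases "length t < k")
      case True
      then show ?thesis using weak_lim_scaleR[OF y(2)[OF True], of "a (length t)"] by (simp add: x_def)
    next
      case False
      then show ?thesis by (simp add: x_def weak_lim_const)
    qed
    have "N (rvec k a) / (1 + \<epsilon>) \<le> 4 * C\<^sup>2 + 1"
    proof (rule concentration_tree_bound[OF conc(1) _ U(2,1) x1 x2 k])
      fix t :: "nat list" assume t: "length t = k"
      define z where "z i = y (take (Suc i) t)" for i
      have sum: "(\<Sum>i<k. c i *\<^sub>R (map (\<lambda>i. y (take (Suc i) t)) [0..<k] ! i)) = (\<Sum>i<k. c i *\<^sub>R z i)" for c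
        by (intro sum.cong) (auto simp: z_def)
      obtain A B where AB: "A > 0" "B > 0" "1 + \<epsilon> = A * B"
        and low: "\<And>c. 1 / A * norm (\<Sum>i<k. c i *\<^sub>R z i) \<le> N (rvec k c)"
        and up: "\<And>c. N (rvec k c) \<le> B * norm (\<Sum>i<k. c i *\<^sub>R z i)"
        using y(3)[OF t] unfolding equivalent_seqs_def sum rvec_def[symmetric] by blast
      have "take (Suc 0) t = [] @ [t ! 0]" using t k by (simp add: take_Suc_conv_app_nth)
      then have z0: "norm (z 0) = 1" using y(1)[of "[]"] k by (simp add: z_def)
      let ?c = "\<lambda>i::nat. if i = 0 then 1 else 0 :: real"
      have "(\<Sum>i<k. ?c i *\<^sub>R z i) = (\<Sum>i<k. if i = 0 then z i else 0)" by (intro sum.cong) auto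
      then have "(\<Sum>i<k. ?c i *\<^sub>R z i) = z 0" using k by simp
      moreover have "rvec k ?c = (\<Sum>i<k. if i = 0 then unit_vec i else 0)" unfolding rvec_def by (intro sum.cong) auto
      then have "rvec k ?c = unit_vec 0" using k by simp
      moreover have "N (unit_vec 0) = 1" using Nn k by (simp add: normalized_monotone_norms_def)
      ultimately have "A \<ge> 1" using low[of ?c] z0 AB(1) by (simp add: field_simps)
      then have "B \<le> 1 + \<epsilon>" using AB by simp
      then have "N (rvec k a) \<le> (1 + \<epsilon>) * norm (\<Sum>i<k. a i *\<^sub>R z i)"
        using up[of a] mult_right_mono[OF _ norm_ge_zero] order_trans by blast
      moreover have "x (take (Suc i) t) = a i *\<^sub>R z i" if "i < k" for i
      proof -
        have "length (take (Suc i) t) = Suc i" "take (Suc i) t \<noteq> []" using that t by auto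
        then show ?thesis using that by (simp add: x_def z_def del: length_take)
      qed
      ultimately show "N (rvec k a) / (1 + \<epsilon>) \<le> norm (\<Sum>i<k. x (take (Suc i) t))"
        using \<epsilon> by (simp add: field_simps)
    qed (use conc(2) in simp)
    then show False using big by (simp add: K_def)
  qed
  then have "C_asymptotic_c0 (K * 2) TYPE('a)"
    using K unfolding C_asymptotic_c0_def
    by (auto intro!: equivalent_linfI simp: asymptotic_structure_def)
  then show ?thesis using K unfolding asymptotic_c0_def by (intro exI[of _ "K * 2"]) simp
qed

section \<open>The norm type of a normalized tree\<close>

lemma asymptotic_game_mono:
  "asymptotic_game P n xs \<Longrightarrow> (\<And>ys. P ys \<Longrightarrow> Q ys) \<Longrightarrow> asymptotic_game Q n xs"
proof (induction n arbitrary: xs)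
  case (Suc n)
  then show ?case by (auto, meson)
qed simp

definition near_branch ::
  "(nat list \<Rightarrow> 'a::real_normed_vector) \<Rightarrow> real \<Rightarrow> (nat list \<Rightarrow> bool) \<Rightarrow> nat \<Rightarrow> 'a list \<Rightarrow> bool" where
  "near_branch u \<eta> P n ys \<longleftrightarrow> (\<exists>t. P t \<and> length t = n \<and> length ys = n \<and>
     (\<forall>i<n. norm (ys ! i - u (take (Suc i) t)) \<le> \<eta>))"

text \<open>The player who chooses vectors follows a branch of the tree: whatever subspace is given, almost all children of the current node are close to it, and their nearby points in the subspace can be normalized.\<close>

lemma tree_to_game:
  fixes u :: "nat list \<Rightarrow> 'a::real_normed_vector"
  assumes U: "U \<noteq> bot" and u: "\<And>t l. norm (u (t @ [l])) = 1" "\<And>t. weak_lim U (\<lambda>l. u (t @ [l])) 0"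
    and \<eta>: "0 < \<eta>" "\<eta> < 1"
    and "iter_ev U n Good t" "length xs = length t" "\<And>i. i < length t \<Longrightarrow> norm (xs ! i - u (take (Suc i) t)) \<le> \<eta>"
  shows "asymptotic_game (near_branch u \<eta> Good (length t + n)) n xs"
  using assms(6-)
proof (induction n arbitrary: t xs)
  case 0
  then show ?case by (auto simp: near_branch_def)
next
  case (Suc n)
  show ?case unfolding asymptotic_game.simps
  proof
    fix Y :: "'a set" assume Y: "Y \<in> cof"
    then have sub: "subspace Y" by (auto simp: cof_def)
    have "eventually (\<lambda>l. iter_ev U n Good (t @ [l])) U" using Suc.prems(1) by simp
    moreover have "eventually (\<lambda>l. \<exists>y\<in>Y. norm (u (t @ [l]) - y) < \<eta> / 2) U"
      by (intro weak_null_near_cof[OF Y u(2)]) (use \<eta>(1) in simp)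
    ultimately have "eventually (\<lambda>l. iter_ev U n Good (t @ [l]) \<and> (\<exists>y\<in>Y. norm (u (t @ [l]) - y) < \<eta> / 2)) U"
      by (rule eventually_conj)
    then obtain l y where l: "iter_ev U n Good (t @ [l])" and y: "y \<in> Y" "norm (u (t @ [l]) - y) < \<eta> / 2"
      using eventually_happens'[OF U] by blast
    have ny: "\<bar>1 - norm y\<bar> < \<eta> / 2"
      using norm_triangle_ineq3[of "u (t @ [l])" y] y(2) u(1)[of t l] by linarith
    then have "y \<noteq> 0" using \<eta> by auto
    define z where "z = (1 / norm y) *\<^sub>R y"
    have z: "z \<in> Y" "norm z = 1" using y(1) sub \<open>y \<noteq> 0\<close> by (auto simp: z_def subspace_scale)
    have "norm y *\<^sub>R z = y" using \<open>y \<noteq> 0\<close> by (simp add: z_def)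
    then have "z - y = (1 - norm y) *\<^sub>R z" by (simp add: scaleR_diff_left)
    then have "norm (z - y) = \<bar>1 - norm y\<bar>" using z(2) by simp
    then have near: "norm (z - u (t @ [l])) \<le> \<eta>"
      using norm_triangle_ineq[of "z - y" "y - u (t @ [l])"] ny y(2) by (simp add: norm_minus_commute)
    have "asymptotic_game (near_branch u \<eta> Good (length (t @ [l]) + n)) n (xs @ [z])"
    proof (rule Suc.IH[OF l])
      show "length (xs @ [z]) = length (t @ [l])" using Suc.prems(2) by simp
      show "norm ((xs @ [z]) ! i - u (take (Suc i) (t @ [l]))) \<le> \<eta>" if "i < length (t @ [l])" for i
      proof (cases "i = length t")
        case True then show ?thesis using near Suc.prems(2) by (simp add: nth_append)
      next
        case False then show ?thesis using Suc.prems(2,3) that by (simp add: nth_append)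
      qed
    qed
    then show "\<exists>x\<in>Y. norm x = 1 \<and> asymptotic_game (near_branch u \<eta> Good (length t + Suc n)) n (xs @ [x])"
      using z by (intro bexI[of _ z]) simp_all
  qed
qed

definition branch_sum :: "(nat list \<Rightarrow> 'a::real_vector) \<Rightarrow> nat \<Rightarrow> nat list \<Rightarrow> (nat \<Rightarrow> real) \<Rightarrow> 'a" where
  "branch_sum u k t a = (\<Sum>i<k. a i *\<^sub>R u (take (Suc i) t))"

lemma branch_sum_bound:
  assumes "\<And>t. norm (u t) \<le> 1" shows "norm (branch_sum u k t a) \<le> (\<Sum>i<k. \<bar>a i\<bar>)"
  unfolding branch_sum_def by (intro sum_norm_le) (use assms in \<open>simp add: mult_left_le\<close>)

lemma branch_sum_diff: "branch_sum u k t a - branch_sum u k t b = branch_sum u k t (\<lambda>i. a i - b i)"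
  by (simp add: branch_sum_def scaleR_diff_left sum_subtractf)

text \<open>The function \<open>\<phi>\<close> is the norm type of the tree; its existence is a matter of compactness, so it is taken as a parameter here.\<close>

locale normalized_tree =
  fixes U :: "nat filter" and u :: "nat list \<Rightarrow> 'a::real_normed_vector" and k :: nat and \<phi> :: "(nat \<Rightarrow> real) \<Rightarrow> real"
  assumes U: "ultra U" and k: "k \<ge> 1"
    and u1: "\<And>t l. norm (u (t @ [l])) = 1" and u0: "norm (u []) \<le> 1" and wn: "\<And>t. weak_lim U (\<lambda>l. u (t @ [l])) 0"
    and \<phi>: "\<And>a. ((\<lambda>t. norm (branch_sum u k t a)) \<longlongrightarrow> \<phi> a) (iter_filter U k)"
begin

abbreviation "F \<equiv> iter_filter U k"

lemma ne: "F \<noteq> bot" using ultra_iter_filter[OF U] by (simp add: ultra_def)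

lemma neU: "U \<noteq> bot" using U by (simp add: ultra_def)

lemma u_le: "norm (u t) \<le> 1"
  using u1[of "butlast t" "last t"] u0 by (cases "t = []") auto

lemma length_F: "eventually (\<lambda>t. length t = k) F"
  unfolding eventually_iter_filter using iter_ev_length[of U k "[]"] by (auto elim!: iter_ev_mono[rotated])

lemma limit_le: "eventually (\<lambda>t. norm (branch_sum u k t a) \<le> norm (branch_sum u k t b) + \<delta>) F \<Longrightarrow> \<phi> a \<le> \<phi> b + \<delta>"
  by (rule tendsto_le[OF ne tendsto_add[OF \<phi> tendsto_const] \<phi>])

lemma limit_nonneg: "0 \<le> \<phi> a"
  by (rule tendsto_lowerbound[OF \<phi> _ ne]) simp

lemma limit_scale: "\<phi> (\<lambda>i. c * a i) = \<bar>c\<bar> * \<phi> a"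
proof -
  have "branch_sum u k t (\<lambda>i. c * a i) = c *\<^sub>R branch_sum u k t a" for t
    by (simp add: branch_sum_def scaleR_sum_right)
  then show ?thesis
    using tendsto_unique[OF ne \<phi>[of "\<lambda>i. c * a i"]] tendsto_mult_left[OF \<phi>[of a], of "\<bar>c\<bar>"] by simp
qed

lemma limit_triangle: "\<phi> (\<lambda>i. a i + b i) \<le> \<phi> a + \<phi> b"
proof (rule tendsto_le[OF ne tendsto_add[OF \<phi> \<phi>] \<phi>])
  have "branch_sum u k t (\<lambda>i. a i + b i) = branch_sum u k t a + branch_sum u k t b" for t
    by (simp add: branch_sum_def scaleR_add_left sum.distrib)
  then show "eventually (\<lambda>t. norm (branch_sum u k t (\<lambda>i. a i + b i)) \<le> norm (branch_sum u k t a) + norm (branch_sum u k t b)) F"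
    by (auto intro!: always_eventually norm_triangle_ineq)
qed

lemma limit_cong: "(\<And>i. i < k \<Longrightarrow> a i = b i) \<Longrightarrow> \<phi> a = \<phi> b"
  using tendsto_unique[OF ne \<phi>[of a]] \<phi>[of b] by (simp add: branch_sum_def)

lemma limit_unit: "j < k \<Longrightarrow> \<phi> (\<lambda>i. if i = j then 1 else 0) = 1"
proof (rule tendsto_unique[OF ne \<phi>])
  assume j: "j < k"
  have "eventually (\<lambda>t. norm (branch_sum u k t (\<lambda>i. if i = j then 1 else 0)) = 1) F"
    using length_F
  proof eventually_elim
    case (elim t)
    have "branch_sum u k t (\<lambda>i. if i = j then 1 else 0) = (\<Sum>i<k. if i = j then u (take (Suc i) t) else 0)"
      unfolding branch_sum_def by (intro sum.cong) auto
    also have "\<dots> = u (take j t @ [t ! j])" using j elim by (simp add: take_Suc_conv_app_nth)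
    finally show ?case using u1 by simp
  qed
  then show "((\<lambda>t. norm (branch_sum u k t (\<lambda>i. if i = j then 1 else 0))) \<longlongrightarrow> 1) F"
    by (rule tendsto_eventually)
qed

text \<open>The partial sum up to \<open>m\<close> is the weak limit of those up to \<open>Suc m\<close>, and the norm is weakly lower semicontinuous.\<close>

lemma limit_monotone_step:
  assumes m: "m < k"
  shows "\<phi> (\<lambda>i. if i < m then a i else 0) \<le> \<phi> (\<lambda>i. if i < Suc m then a i else 0)"
proof (rule field_le_epsilon)
  fix \<delta> :: real assume \<delta>: "\<delta> > 0"
  have trunc: "branch_sum u k t (\<lambda>i. if i < n then a i else 0) = branch_sum u n t a" if "n \<le> k" for n t
    unfolding branch_sum_def by (rule sum.mono_neutral_cong_right) (use that in auto)
  have "iter_ev U k (\<lambda>s. norm (branch_sum u m (take (Suc m) s) a) \<le> norm (branch_sum u (Suc m) (take (Suc m) s) a) + \<delta>) []"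
  proof (rule iter_ev_level[OF _ m])
    fix t :: "nat list" assume t: "length t = m"
    let ?p = "branch_sum u m t a"
    have p: "branch_sum u m (t @ [l]) a = ?p" "branch_sum u (Suc m) (t @ [l]) a = ?p + a m *\<^sub>R u (t @ [l])" for l
      using t by (simp_all add: branch_sum_def)
    have wl: "weak_lim U (\<lambda>l. ?p + a m *\<^sub>R u (t @ [l])) ?p"
      using weak_lim_add[OF weak_lim_const weak_lim_scaleR[OF wn[of t], of "a m"], of ?p] by simp
    show "eventually (\<lambda>l. norm (branch_sum u m (t @ [l]) a) \<le> norm (branch_sum u (Suc m) (t @ [l]) a) + \<delta>) U"
    proof (rule ccontr)
      assume "\<not> ?thesis"
      then have "eventually (\<lambda>l. norm (?p + a m *\<^sub>R u (t @ [l])) \<le> norm ?p - \<delta>) U"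
        unfolding ultra_not[OF U] p by (auto elim!: eventually_mono)
      then show False using weak_lim_norm_le[OF wl neU] \<delta> by force
    qed
  qed
  then have "eventually (\<lambda>s. norm (branch_sum u m s a) \<le> norm (branch_sum u (Suc m) s a) + \<delta>) F"
    unfolding eventually_iter_filter by (rule iter_ev_mono[rotated]) (simp add: branch_sum_def min_def)
  then show "\<phi> (\<lambda>i. if i < m then a i else 0) \<le> \<phi> (\<lambda>i. if i < Suc m then a i else 0) + \<delta>"
    using m by (intro limit_le) (simp add: trunc)
qed

lemma limit_monotone:
  assumes "m \<le> n" "n \<le> k"
  shows "\<phi> (\<lambda>i. if i < m then a i else 0) \<le> \<phi> (\<lambda>i. if i < n then a i else 0)"
  using assms
proof (induction n rule: dec_induct)
  case (step n)
  then show ?case using limit_monotone_step[of n a] by (simp add: less_Suc_eq_le)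
qed simp

definition type_norm :: "(nat \<Rightarrow>\<^sub>0 real) \<Rightarrow> real" where
  "type_norm v = \<phi> (coord v)"

lemma type_norm_rvec: "n \<le> k \<Longrightarrow> type_norm (rvec n a) = \<phi> (\<lambda>i. if i < n then a i else 0)"
  unfolding type_norm_def by (rule limit_cong) (simp add: lookup_rvec)

lemma coordinate_le: assumes j: "j < k" shows "\<bar>a j\<bar> \<le> 2 * \<phi> a"
proof -
  have "\<bar>a j\<bar> = \<phi> (\<lambda>i. a j * (if i = j then 1 else 0))" using limit_scale limit_unit[OF j] by simp
  also have "\<dots> = \<phi> (\<lambda>i. (if i < Suc j then a i else 0) + (-1) * (if i < j then a i else 0))"
    by (rule limit_cong) (auto simp: less_Suc_eq)
  also have "\<dots> \<le> \<phi> (\<lambda>i. if i < Suc j then a i else 0) + \<phi> (\<lambda>i. (-1) * (if i < j then a i else 0))"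
    by (rule limit_triangle)
  also have "\<dots> \<le> \<phi> (\<lambda>i. if i < k then a i else 0) + \<phi> (\<lambda>i. if i < k then a i else 0)"
    using limit_monotone[of "Suc j" k a] limit_monotone[of j k a] j limit_scale[of "-1" "\<lambda>i. if i < j then a i else 0"] by simp
  also have "\<phi> (\<lambda>i. if i < k then a i else 0) = \<phi> a" by (rule limit_cong) simp
  finally show ?thesis by simp
qed

lemma type_norm_normalized_monotone: "type_norm \<in> normalized_monotone_norms k"
proof -
  have "norm_on (Rk k) type_norm"
    unfolding norm_on_def
  proof (intro conjI ballI allI)
    fix v assume v: "v \<in> Rk k"
    show "0 \<le> type_norm v" by (simp add: type_norm_def limit_nonneg)
    show "type_norm v = 0 \<longleftrightarrow> v = 0"
    proof
      assume "type_norm v = 0"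
      then have "coord v j = 0" if "j < k" for j
        using coordinate_le[OF that, of "coord v"] by (simp add: type_norm_def)
      then have "rvec k (coord v) = 0" by (simp add: rvec_eq_0_iff)
      then show "v = 0" using Rk_eq_rvec[OF v] by simp
    next
      assume "v = 0"
      then have "type_norm v = \<phi> (\<lambda>i. 0 * 0)" unfolding type_norm_def by (intro limit_cong) simp
      then show "type_norm v = 0" using limit_scale[of 0 "\<lambda>_. 0"] by simp
    qed
    show "type_norm (c *\<^sub>R v) = \<bar>c\<bar> * type_norm v" for c
    proof -
      have "type_norm (c *\<^sub>R v) = \<phi> (\<lambda>i. c * coord v i)"
        unfolding type_norm_def by (rule limit_cong) (simp add: lookup_scaleR_poly_mapping)
      then show ?thesis using limit_scale by (simp add: type_norm_def)
    qed
    show "type_norm (v + w) \<le> type_norm v + type_norm w" for w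
    proof -
      have "type_norm (v + w) = \<phi> (\<lambda>i. coord v i + coord w i)"
        unfolding type_norm_def by (rule limit_cong) (simp add: lookup_add)
      then show ?thesis using limit_triangle by (simp add: type_norm_def)
    qed
  qed
  moreover have "type_norm (unit_vec j) = 1" if "j < k" for j
  proof -
    have "type_norm (unit_vec j) = \<phi> (\<lambda>i. if i = j then 1 else 0)"
      unfolding type_norm_def by (rule limit_cong) (auto simp: unit_vec_def lookup_single when_def)
    then show ?thesis using limit_unit[OF that] by simp
  qed
  moreover have "type_norm (rvec m a) \<le> type_norm (rvec n a)" if "m \<le> n" "n \<le> k" for a m n
    using limit_monotone[OF that] that by (simp add: type_norm_rvec)
  ultimately show ?thesis unfolding normalized_monotone_norms_def rvec_def by simp
qed

lemma branch_sum_perturb: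
  assumes "\<And>i. i < k \<Longrightarrow> \<bar>a i - b i\<bar> \<le> \<delta>"
  shows "\<bar>norm (branch_sum u k t a) - norm (branch_sum u k t b)\<bar> \<le> real k * \<delta>"
proof -
  have "norm (branch_sum u k t a - branch_sum u k t b) \<le> (\<Sum>i<k. \<bar>a i - b i\<bar>)"
    unfolding branch_sum_diff by (rule branch_sum_bound[OF u_le])
  also have "\<dots> \<le> (\<Sum>i<k. \<delta>)" using assms by (intro sum_mono) simp
  finally show ?thesis using norm_triangle_ineq3[of "branch_sum u k t a" "branch_sum u k t b"] by simp
qed

lemma limit_perturb:
  assumes "\<And>i. i < k \<Longrightarrow> \<bar>a i - b i\<bar> \<le> \<delta>" shows "\<bar>\<phi> a - \<phi> b\<bar> \<le> real k * \<delta>"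
  by (rule tendsto_upperbound[OF tendsto_rabs[OF tendsto_diff[OF \<phi> \<phi>]] _ ne])
    (simp add: branch_sum_perturb[OF assms])

lemma uniform_convergence:
  assumes \<eta>: "\<eta> > 0"
  shows "eventually (\<lambda>t. \<forall>a. (\<forall>i<k. \<bar>a i\<bar> \<le> 1) \<longrightarrow> \<bar>norm (branch_sum u k t a) - \<phi> a\<bar> \<le> \<eta>) F"
proof -
  obtain n :: nat where "max 1 (3 * real k / \<eta>) < real n" using reals_Archimedean2 by blast
  then have n: "n > 0" "3 * real k / \<eta> < real n" by auto
  define \<delta> where "\<delta> = 1 / real n"
  have \<delta>: "real k * \<delta> \<le> \<eta> / 3" using n \<eta> by (simp add: \<delta>_def field_simps)
  \<comment> \<open>A finite grid in the unit cube of mesh \<open>1 / n\<close>; pointwise convergence on the grid suffices.\<close>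
  define G where "G = (\<lambda>c i. real_of_int (c i) / real n) ` (PiE {..<k} (\<lambda>_. {- int n..int n}))"
  have "finite G" unfolding G_def by (intro finite_imageI finite_PiE) auto
  then have "eventually (\<lambda>t. \<forall>b\<in>G. \<bar>norm (branch_sum u k t b) - \<phi> b\<bar> < \<eta> / 3) F"
  proof (rule eventually_ball_finite, intro ballI)
    fix b
    show "eventually (\<lambda>t. \<bar>norm (branch_sum u k t b) - \<phi> b\<bar> < \<eta> / 3) F"
      using tendstoD[OF \<phi>[of b], of "\<eta> / 3"] \<eta> by (simp add: dist_real_def)
  qed
  then show ?thesis
  proof eventually_elim
    case (elim t)
    show ?case
    proof (intro allI impI)
      fix a :: "nat \<Rightarrow> real" assume a: "\<forall>i<k. \<bar>a i\<bar> \<le> 1"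
      define c where "c = (\<lambda>i\<in>{..<k}. \<lfloor>real n * a i\<rfloor>)"
      define b where "b i = real_of_int (c i) / real n" for i
      have "c \<in> PiE {..<k} (\<lambda>_. {- int n..int n})"
      proof (rule PiE_I)
        fix i assume i: "i \<in> {..<k}"
        have "- 1 \<le> a i" "a i \<le> 1" using a i by (auto simp: abs_le_iff)
        then have "real n * a i \<le> real n * 1" "real n * (-1) \<le> real n * a i" using mult_left_mono[of "a i" 1 "real n"] mult_left_mono[of "-1" "a i" "real n"] by simp_all
        then show "c i \<in> {- int n..int n}" using i by (auto simp: c_def le_floor_iff floor_le_iff)
      qed (simp add: c_def)
      then have "b \<in> G" unfolding G_def b_def by blast
      then have 1: "\<bar>norm (branch_sum u k t b) - \<phi> b\<bar> < \<eta> / 3" using elim by blast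
      have ab: "\<bar>a i - b i\<bar> \<le> \<delta>" if "i < k" for i
      proof -
        have "\<bar>real n * a i - real_of_int \<lfloor>real n * a i\<rfloor>\<bar> \<le> 1" by linarith
        moreover have "a i - b i = (real n * a i - real_of_int \<lfloor>real n * a i\<rfloor>) / real n"
          using that n(1) by (simp add: b_def c_def field_simps)
        ultimately show ?thesis using n(1) by (simp add: \<delta>_def divide_right_mono)
      qed
      have 2: "\<bar>\<phi> a - \<phi> b\<bar> \<le> real k * \<delta>" by (rule limit_perturb[OF ab])
      have "\<bar>norm (branch_sum u k t a) - norm (branch_sum u k t b)\<bar> \<le> real k * \<delta>"
        by (rule branch_sum_perturb[OF ab])
      then show "\<bar>norm (branch_sum u k t a) - \<phi> a\<bar> \<le> \<eta>" using 1 2 \<delta> by linarith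
    qed
  qed
qed

lemma almost_isometric_equivalent:
  fixes ys :: "'a list"
  assumes \<epsilon>: "\<epsilon> > 0" and c: "c = \<epsilon> / (2 + \<epsilon>)"
    and close: "\<And>a. (\<And>i. i < k \<Longrightarrow> \<bar>a i\<bar> \<le> 1) \<Longrightarrow> \<bar>norm (\<Sum>i<k. a i *\<^sub>R ys ! i) - \<phi> a\<bar> \<le> c / 2"
  shows "equivalent_seqs (1 + \<epsilon>) k norm (\<lambda>i. ys ! i) type_norm unit_vec"
proof -
  have c1: "0 < c" "c < 1" using \<epsilon> by (auto simp: c field_simps)
  have est: "\<bar>norm (\<Sum>i<k. a i *\<^sub>R ys ! i) - \<phi> a\<bar> \<le> c * \<phi> a" for a
  proof -
    obtain j where j: "j < k" "\<And>i. i < k \<Longrightarrow> \<bar>a i\<bar> \<le> \<bar>a j\<bar>" using max_coordinate[OF k, of a] by metis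
    define m where "m = \<bar>a j\<bar>"
    have mge: "\<bar>a i\<bar> \<le> m" if "i < k" for i using j(2) that by (simp add: m_def)
    have m2: "m \<le> 2 * \<phi> a" using coordinate_le[OF j(1)] by (simp add: m_def)
    show ?thesis
    proof (cases "m = 0")
      case True
      then have a0: "a i = 0" if "i < k" for i using mge[OF that] by simp
      then have "\<phi> a = \<phi> (\<lambda>i. 0 * a i)" by (intro limit_cong) simp
      then have "\<phi> a = 0" using limit_scale[of 0 a] by simp
      then show ?thesis using a0 by simp
    next
      case False
      have m0: "m > 0" using False mge[of 0] k by simp
      have "\<bar>norm (\<Sum>i<k. (1 / m * a i) *\<^sub>R ys ! i) - \<phi> (\<lambda>i. 1 / m * a i)\<bar> \<le> c / 2"
        using mge m0 by (intro close) (auto simp: abs_mult field_simps)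
      moreover have "(\<Sum>i<k. (1 / m * a i) *\<^sub>R ys ! i) = (1 / m) *\<^sub>R (\<Sum>i<k. a i *\<^sub>R ys ! i)"
        by (simp add: scaleR_sum_right)
      ultimately have "\<bar>1 / m * norm (\<Sum>i<k. a i *\<^sub>R ys ! i) - 1 / m * \<phi> a\<bar> \<le> c / 2"
        using m0 limit_scale[of "1/m" a] by simp
      then have "\<bar>(norm (\<Sum>i<k. a i *\<^sub>R ys ! i) - \<phi> a) / m\<bar> \<le> c / 2" by (simp add: diff_divide_distrib)
      then have "\<bar>norm (\<Sum>i<k. a i *\<^sub>R ys ! i) - \<phi> a\<bar> \<le> c / 2 * m"
        using m0 by (simp add: abs_div field_simps)
      also have "\<dots> \<le> c / 2 * (2 * \<phi> a)" using m2 c1 by (intro mult_left_mono) auto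
      finally show ?thesis by simp
    qed
  qed
  have tn: "type_norm (rvec k a) = \<phi> a" for a
    unfolding type_norm_rvec[OF order_refl] by (rule limit_cong) simp
  have lin: "lin_indep_seq k (\<lambda>i. ys ! i)"
  proof (rule lin_indep_seqI)
    fix a i assume 0: "(\<Sum>i<k. a i *\<^sub>R ys ! i) = 0" and i: "i < k"
    have "\<phi> a \<le> c * \<phi> a" using est[of a] 0 limit_nonneg[of a] by simp
    then have "(1 - c) * \<phi> a \<le> 0" by (simp add: algebra_simps)
    then have "\<phi> a \<le> 0" using c1 by (simp add: mult_le_0_iff)
    then show "a i = 0" using coordinate_le[OF i, of a] by simp
  qed
  \<comment> \<open>This identity is the reason for the choice of \<open>c\<close>.\<close>
  have prod: "1 + \<epsilon> = (1 + c) * (1 / (1 - c))" using \<epsilon> by (simp add: c field_simps)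
  have "1 / (1 + c) * norm (\<Sum>i<k. a i *\<^sub>R ys ! i) \<le> \<phi> a \<and> \<phi> a \<le> 1 / (1 - c) * norm (\<Sum>i<k. a i *\<^sub>R ys ! i)" for a
    using est[of a] c1 by (auto simp: field_simps abs_le_iff)
  then show ?thesis
    unfolding equivalent_seqs_def rvec_def[symmetric] tn
    using lin lin_indep_unit_vec c1 prod by (intro conjI exI[of _ "1 + c"] exI[of _ "1 / (1 - c)"]) auto
qed

text \<open>Branches on which the norms of all coefficient vectors are uniformly close to \<open>\<phi>\<close> are almost isometric to the basis; the game stays close to such a branch.\<close>

lemma type_norm_asymptotic: "type_norm \<in> asymptotic_structure TYPE('a) k"
proof -
  have "asymptotic_game (\<lambda>xs :: 'a list. equivalent_seqs (1 + \<epsilon>) k norm (\<lambda>i. xs ! i) type_norm unit_vec) k []"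
    if \<epsilon>: "\<epsilon> > 0" for \<epsilon>
  proof -
    define c where "c = \<epsilon> / (2 + \<epsilon>)"
    have c1: "0 < c" "c < 1" using \<epsilon> by (auto simp: c_def field_simps)
    define \<eta> where "\<eta> = c / (4 * real k)"
    have \<eta>: "0 < \<eta>" "\<eta> < 1" "real k * \<eta> = c / 4" using c1 k by (auto simp: \<eta>_def field_simps)
    define Good where "Good t \<longleftrightarrow> (\<forall>a. (\<forall>i<k. \<bar>a i\<bar> \<le> 1) \<longrightarrow> \<bar>norm (branch_sum u k t a) - \<phi> a\<bar> \<le> c / 4)" for t
    have "iter_ev U k Good []"
      using uniform_convergence[of "c / 4"] c1 unfolding Good_def eventually_iter_filter by simp
    then have "asymptotic_game (near_branch u \<eta> Good (length ([] :: nat list) + k)) k []"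
      using \<eta> by (intro tree_to_game[OF neU u1 wn]) auto
    then show ?thesis
    proof (rule asymptotic_game_mono)
      fix ys :: "'a list"
      assume "near_branch u \<eta> Good (length ([] :: nat list) + k) ys"
      then obtain t where t: "Good t" "\<And>i. i < k \<Longrightarrow> norm (ys ! i - u (take (Suc i) t)) \<le> \<eta>"
        by (auto simp: near_branch_def)
      show "equivalent_seqs (1 + \<epsilon>) k norm (\<lambda>i. ys ! i) type_norm unit_vec"
      proof (rule almost_isometric_equivalent[OF \<epsilon> c_def])
        fix a :: "nat \<Rightarrow> real" assume a: "\<And>i. i < k \<Longrightarrow> \<bar>a i\<bar> \<le> 1"
        have "norm ((\<Sum>i<k. a i *\<^sub>R ys ! i) - branch_sum u k t a) = norm (\<Sum>i<k. a i *\<^sub>R (ys ! i - u (take (Suc i) t)))"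
          by (simp add: branch_sum_def scaleR_diff_right sum_subtractf)
        also have "\<dots> \<le> (\<Sum>i<k. 1 * \<eta>)"
        proof (rule sum_norm_le)
          fix i assume "i \<in> {..<k}"
          then have "\<bar>a i\<bar> * norm (ys ! i - u (take (Suc i) t)) \<le> 1 * \<eta>" using a t(2) by (intro mult_mono) auto
          then show "norm (a i *\<^sub>R (ys ! i - u (take (Suc i) t))) \<le> 1 * \<eta>" by simp
        qed
        also have "\<dots> = c / 4" using \<eta>(3) by simp
        finally have "\<bar>norm (\<Sum>i<k. a i *\<^sub>R ys ! i) - norm (branch_sum u k t a)\<bar> \<le> c / 4"
          using norm_triangle_ineq3 order_trans by blast
        moreover have "\<bar>norm (branch_sum u k t a) - \<phi> a\<bar> \<le> c / 4" using t(1) a by (simp add: Good_def)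
        ultimately show "\<bar>norm (\<Sum>i<k. a i *\<^sub>R ys ! i) - \<phi> a\<bar> \<le> c / 2" by linarith
      qed
    qed
  qed
  then show ?thesis using type_norm_normalized_monotone by (simp add: asymptotic_structure_def)
qed

lemma limit_le_of_asymptotic_c0:
  assumes C: "C_asymptotic_c0 C TYPE('a)" and a: "\<And>i. i < k \<Longrightarrow> \<bar>a i\<bar> \<le> 1"
  shows "\<phi> a \<le> C"
proof -
  obtain A B where AB: "A > 0" "B > 0" "C = A * B"
    and low: "\<And>c. 1 / A * type_norm (rvec k c) \<le> linf_norm k (rvec k c)"
    and up: "\<And>c. linf_norm k (rvec k c) \<le> B * type_norm (rvec k c)"
    using C k type_norm_asymptotic unfolding C_asymptotic_c0_def equivalent_seqs_def rvec_def[symmetric] by blast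
  have tn: "type_norm (rvec k a) = \<phi> a" for a
    unfolding type_norm_rvec[OF order_refl] by (rule limit_cong) simp
  let ?e = "\<lambda>i::nat. if i = 0 then 1 else 0 :: real"
  have "(1::real) \<le> Max ((\<lambda>i. \<bar>?e i\<bar>) ` {..<k})" using k by (intro Max_ge) (auto intro!: image_eqI[of _ _ 0])
  then have "1 \<le> B" using up[of ?e] limit_unit[of 0] k unfolding tn linf_norm_rvec[OF k] by simp
  have "(\<lambda>i. \<bar>a i\<bar>) ` {..<k} \<noteq> {}" using k by (auto simp: lessThan_empty_iff)
  then have "Max ((\<lambda>i. \<bar>a i\<bar>) ` {..<k}) \<le> 1" using a by (intro Max.boundedI) auto
  then have "1 / A * \<phi> a \<le> 1" using low[of a] unfolding tn linf_norm_rvec[OF k] by simp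
  then have "\<phi> a \<le> A" using AB(1) by (simp add: field_simps)
  also have "A \<le> C" using AB \<open>1 \<le> B\<close> by simp
  finally show ?thesis .
qed

end

section \<open>From asymptotic structure to concentration\<close>

lemma exists_limit_type:
  fixes u :: "nat list \<Rightarrow> 'a::real_normed_vector"
  assumes U: "ultra U" and u: "\<And>t. norm (u t) \<le> 1"
  obtains \<phi> where "\<And>a. ((\<lambda>t. norm (branch_sum u k t a)) \<longlongrightarrow> \<phi> a) (iter_filter U k)"
proof -
  have "\<exists>l. ((\<lambda>t. norm (branch_sum u k t a)) \<longlongrightarrow> l) (iter_filter U k)" for a
  proof (rule ultra_tendsto[OF ultra_iter_filter[OF U]])
    show "eventually (\<lambda>t. \<bar>norm (branch_sum u k t a)\<bar> \<le> (\<Sum>i<k. \<bar>a i\<bar>)) (iter_filter U k)"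
      by (auto intro!: always_eventually branch_sum_bound u)
  qed blast
  then show ?thesis using that by metis
qed

text \<open>A tree in the unit ball is compared with a normalized tree \<open>u\<close>, obtained by dividing nodes by their norms. If the children of a node tend to 0 in norm, the quotients need not be weakly null, and a fixed normalized weakly null sequence takes their place. Since the norms of the nodes on a branch converge level by level to numbers \<open>a i\<close>, the branch sums are close to those of \<open>u\<close> with coefficients \<open>a i\<close>.\<close>

theorem weak_null_tree_bound:
  fixes x :: "nat list \<Rightarrow> 'a::real_normed_vector"
  assumes refl: "reflexive_space TYPE('a)" and C: "C_asymptotic_c0 C TYPE('a)" "C \<ge> 0"
    and U: "ultra U" "U \<le> sequentially" and k: "k \<ge> 1"
    and x1: "\<And>t. norm (x t) \<le> 1" and wn: "\<And>t. weak_lim U (\<lambda>l. x (t @ [l])) 0"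
  shows "iter_ev U k (\<lambda>t. norm (\<Sum>i<k. x (take (Suc i) t)) \<le> C + 1) []"
proof (cases "\<forall>Y\<in>cof. \<exists>y\<in>Y. y \<in> {y :: 'a. norm y = 1}")
  \<comment> \<open>Then 0 is a subspace of finite codimension, and weakly null families tend to 0 in norm.\<close>
  case False
  then obtain Y :: "'a set" where Y: "Y \<in> cof" "\<And>y. y \<in> Y \<Longrightarrow> norm y \<noteq> 1" by blast
  have sub: "subspace Y" using Y(1) by (auto simp: cof_def)
  have Y0: "y = 0" if "y \<in> Y" for y
  proof (rule ccontr)
    assume "y \<noteq> 0"
    then have "norm ((1 / norm y) *\<^sub>R y) = 1" by simp
    then show False using Y(2) subspace_scale[OF sub that] by blast
  qed
  have "iter_ev U k (\<lambda>s. norm (x (take (Suc i) s)) < 1 / real k) []" if "i < k" for i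
  proof (rule iter_ev_level[OF _ that])
    fix t
    have "eventually (\<lambda>l. \<exists>y\<in>Y. norm (x (t @ [l]) - y) < 1 / real k) U"
      by (rule weak_null_near_cof[OF Y(1) wn]) (use k in simp)
    then show "eventually (\<lambda>l. norm (x (t @ [l])) < 1 / real k) U"
      by (rule eventually_mono) (use Y0 in fastforce)
  qed
  then have "iter_ev U k (\<lambda>s. \<forall>i\<in>{..<k}. norm (x (take (Suc i) s)) < 1 / real k) []"
    by (intro iter_ev_ball_finite) auto
  then show ?thesis
  proof (rule iter_ev_mono[rotated])
    fix s assume s: "\<forall>i\<in>{..<k}. norm (x (take (Suc i) s)) < 1 / real k"
    have "norm (\<Sum>i<k. x (take (Suc i) s)) \<le> (\<Sum>i<k. 1 / real k)"
      by (rule sum_norm_le) (use s in \<open>auto intro: less_imp_le\<close>)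
    then show "norm (\<Sum>i<k. x (take (Suc i) s)) \<le> C + 1" using C(2) k by simp
  qed
next
  case True
  obtain y :: "nat \<Rightarrow> 'a" where y: "\<And>n. norm (y n) = 1" "weak_lim U y 0"
    using weak_null_sequence[OF refl U, of "{y. norm y = 1}" 1] True by auto
  have neU: "U \<noteq> bot" using U(1) by (simp add: ultra_def)
  define small where "small t \<longleftrightarrow> ((\<lambda>l. norm (x (t @ [l]))) \<longlongrightarrow> 0) U" for t
  define u where "u t = (if t = [] then 0 else if x t = 0 \<or> small (butlast t) then y (last t) else (1 / norm (x t)) *\<^sub>R x t)" for t
  have u1: "norm (u (t @ [l])) = 1" for t l by (simp add: u_def y(1))
  have u0: "norm (u []) \<le> 1" by (simp add: u_def)
  have u_le: "norm (u t) \<le> 1" for t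
    using u1[of "butlast t" "last t"] u0 by (cases "t = []") auto
  have uwn: "weak_lim U (\<lambda>l. u (t @ [l])) 0" for t
  proof (cases "small t")
    case True
    then show ?thesis using y(2) by (simp add: u_def)
  next
    case False
    have bd: "eventually (\<lambda>l. \<bar>norm (x (t @ [l]))\<bar> \<le> 1) U" using x1 by simp
    obtain c where c: "((\<lambda>l. norm (x (t @ [l]))) \<longlongrightarrow> c) U" using ultra_tendsto[OF U(1) bd] by blast
    have c0: "c \<noteq> 0" using False c by (auto simp: small_def)
    have "eventually (\<lambda>l. norm (x (t @ [l])) \<noteq> 0) U" by (rule tendsto_imp_eventually_ne[OF c c0])
    then have eq: "eventually (\<lambda>l. (1 / norm (x (t @ [l]))) *\<^sub>R x (t @ [l]) = u (t @ [l])) U"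
      by (rule eventually_mono) (use False in \<open>simp add: u_def\<close>)
    have "weak_lim U (\<lambda>l. (1 / norm (x (t @ [l]))) *\<^sub>R x (t @ [l])) 0"
      unfolding weak_lim_def
    proof
      fix \<psi> :: "'a dual"
      show "((\<lambda>l. \<psi> ((1 / norm (x (t @ [l]))) *\<^sub>R x (t @ [l]))) \<longlongrightarrow> \<psi> 0) U"
        using tendsto_divide[OF weak_limD[OF wn[of t], of \<psi>] c c0] by (simp add: blinfun.scaleR_right)
    qed
    then show ?thesis by (rule weak_lim_cong[OF eq])
  qed
  obtain \<phi> where \<phi>: "\<And>a. ((\<lambda>t. norm (branch_sum u k t a)) \<longlongrightarrow> \<phi> a) (iter_filter U k)"
    by (rule exists_limit_type[OF U(1) u_le]) (rule that; assumption)
  interpret normalized_tree U u k \<phi>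
    by (rule normalized_tree.intro[OF U(1) k u1 u0 uwn \<phi>])
  have "\<exists>a. ((\<lambda>t. norm (x (take (Suc i) t))) \<longlongrightarrow> a) F" for i
    by (rule ultra_tendsto[OF ultra_iter_filter[OF U(1)], of _ 1 k]) (use x1 in auto)
  then obtain a where a: "\<And>i. ((\<lambda>t. norm (x (take (Suc i) t))) \<longlongrightarrow> a i) F" by metis
  have "0 \<le> a i" "a i \<le> 1" for i
    by (rule tendsto_lowerbound[OF a _ ne], simp) (rule tendsto_upperbound[OF a _ ne], simp add: x1)
  then have \<phi>a: "\<phi> a \<le> C" by (intro limit_le_of_asymptotic_c0[OF C(1)]) simp
  define \<delta> where "\<delta> = 1 / (6 * real k)"
  have \<delta>: "\<delta> > 0" "real k * (3 * \<delta>) = 1 / 2" using k by (auto simp: \<delta>_def)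
  \<comment> \<open>Either the node is negligible, or \<open>u t\<close> is its normalization. The alternatives are decided by the parent of \<open>t\<close>.\<close>
  define Q where "Q t \<longleftrightarrow> norm (x t) < \<delta> \<or> x t = norm (x t) *\<^sub>R u t" for t
  have "eventually (\<lambda>t. \<forall>i\<in>{..<k}. Q (take (Suc i) t)) F"
    unfolding eventually_iter_filter
  proof (rule iter_ev_ball_finite)
    fix i assume "i \<in> {..<k}"
    then show "iter_ev U k (\<lambda>t. Q (take (Suc i) t)) []"
    proof (intro iter_ev_level[of i Q])
      fix t :: "nat list"
      show "eventually (\<lambda>l. Q (t @ [l])) U"
      proof (cases "small t")
        case True
        then have "eventually (\<lambda>l. norm (x (t @ [l])) < \<delta>) U"
          unfolding small_def using \<delta>(1) by (rule order_tendstoD(2))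
        then show ?thesis by (rule eventually_mono) (simp add: Q_def)
      next
        case False
        have "Q (t @ [l])" for l
          using False \<delta>(1) by (cases "x (t @ [l]) = 0") (simp_all add: Q_def u_def)
        then show ?thesis by simp
      qed
    qed simp
  qed simp
  moreover have "eventually (\<lambda>t. \<forall>i\<in>{..<k}. \<bar>norm (x (take (Suc i) t)) - a i\<bar> < \<delta>) F"
    using tendstoD[OF a \<delta>(1)] by (intro eventually_ball_finite) (auto simp: dist_real_def)
  moreover have "eventually (\<lambda>t. \<bar>norm (branch_sum u k t a) - \<phi> a\<bar> < 1 / 2) F"
    using tendstoD[OF \<phi>[of a], of "1/2"] by (simp add: dist_real_def)
  ultimately have "eventually (\<lambda>t. norm (\<Sum>i<k. x (take (Suc i) t)) \<le> C + 1) F"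
  proof eventually_elim
    case (elim t)
    have near: "norm (x (take (Suc i) t) - a i *\<^sub>R u (take (Suc i) t)) \<le> 3 * \<delta>" if i: "i < k" for i
    proof -
      let ?x = "x (take (Suc i) t)" and ?u = "u (take (Suc i) t)"
      have d: "\<bar>norm ?x - a i\<bar> < \<delta>" using elim(2) i by simp
      have "norm ?x < \<delta> \<or> ?x = norm ?x *\<^sub>R ?u" using elim(1) i by (simp add: Q_def)
      then show ?thesis
      proof
        assume s: "norm ?x < \<delta>"
        have "norm (a i *\<^sub>R ?u) \<le> \<bar>a i\<bar> * 1" using u_le by (simp add: mult_left_le)
        moreover have "norm (?x - a i *\<^sub>R ?u) \<le> norm ?x + norm (a i *\<^sub>R ?u)" by (rule norm_triangle_ineq4)
        moreover have "\<bar>a i\<bar> < 2 * \<delta>" using s d norm_ge_zero[of ?x] by linarith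
        ultimately show ?thesis using s by linarith
      next
        assume s: "?x = norm ?x *\<^sub>R ?u"
        have "?x - a i *\<^sub>R ?u = (norm ?x - a i) *\<^sub>R ?u" by (subst s) (simp add: scaleR_diff_left)
        then have "norm (?x - a i *\<^sub>R ?u) = \<bar>norm ?x - a i\<bar> * norm ?u" by simp
        also have "\<dots> \<le> \<bar>norm ?x - a i\<bar>" using u_le by (simp add: mult_left_le)
        finally show ?thesis using d by linarith
      qed
    qed
    have "norm ((\<Sum>i<k. x (take (Suc i) t)) - branch_sum u k t a)
        = norm (\<Sum>i<k. x (take (Suc i) t) - a i *\<^sub>R u (take (Suc i) t))"
      by (simp add: branch_sum_def sum_subtractf)
    also have "\<dots> \<le> (\<Sum>i<k. 3 * \<delta>)" using near by (intro sum_norm_le) simp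
    also have "\<dots> = 1 / 2" using \<delta>(2) by simp
    finally show ?case
      using norm_triangle_ineq2[of "\<Sum>i<k. x (take (Suc i) t)" "branch_sum u k t a"] elim(3) \<phi>a by linarith
  qed
  then show ?thesis by (simp add: eventually_iter_filter)
qed

lemma lipschitz_Hamming:
  assumes f: "Hamming_Lipschitz k f" and AB: "A \<in> [UNIV]\<^bsup>k\<^esup>" "B \<in> [UNIV]\<^bsup>k\<^esup>"
  shows "dist (f A) (f B) \<le> Hamming_Lip k f * hamming_dist k A B"
proof (cases "hamming_dist k A B = 0")
  case True
  have fin: "finite A" "finite B" "card A = k" "card B = k" using AB by (auto simp: nsets_def)
  have "{i. i < k \<and> sorted_list_of_set A ! i \<noteq> sorted_list_of_set B ! i} = {}"
    using True by (simp add: hamming_dist_def)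
  then have "sorted_list_of_set A = sorted_list_of_set B"
    using fin by (intro nth_equalityI) auto
  then have "A = B" using fin by (metis set_sorted_list_of_set)
  then show ?thesis using True by simp
next
  case False
  moreover have "hamming_dist k A B \<ge> 0" by (simp add: hamming_dist_def)
  ultimately have pos: "hamming_dist k A B > 0" by linarith
  then have "dist (f A) (f B) / hamming_dist k A B \<in> lipschitz_quotients ([UNIV]\<^bsup>k\<^esup>) (hamming_dist k) f"
    using AB unfolding lipschitz_quotients_def by blast
  then have "dist (f A) (f B) / hamming_dist k A B \<le> Hamming_Lip k f"
    using f unfolding Lip_def is_Lipschitz_def by (intro cSup_upper)
  then show ?thesis using pos by (simp add: field_simps)
qed

lemma Lip_nonneg:
  assumes f: "Hamming_Lipschitz k f" and k: "k \<ge> 1"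
  shows "Hamming_Lip k f \<ge> 0"
proof -
  obtain q where q: "q \<in> lipschitz_quotients ([UNIV]\<^bsup>k\<^esup>) (hamming_dist k) f"
    using hamming_quotients_nonempty[OF k] by blast
  then have "0 \<le> q" by (auto simp: lipschitz_quotients_def)
  also have "q \<le> Hamming_Lip k f"
    using f q unfolding Lip_def is_Lipschitz_def by (intro cSup_upper)
  finally show ?thesis .
qed

text \<open>Iterated weak limits from the leaves to the root.\<close>

theorem weak_limit_tree:
  fixes b :: "nat list \<Rightarrow> 'a::real_normed_vector"
  assumes refl: "reflexive_space TYPE('a)" and U: "ultra U" and b: "\<And>t. norm (b t) \<le> B"
  obtains h where "\<And>t. length t = k \<Longrightarrow> h t = b t" "\<And>t. length t < k \<Longrightarrow> weak_lim U (\<lambda>l. h (t @ [l])) (h t)"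
proof -
  define W where "W x = (SOME y. weak_lim U x y)" for x :: "nat \<Rightarrow> 'a"
  have W: "weak_lim U x (W x)" if "\<And>n. norm (x n) \<le> B" for x
    using weak_lim_exists[OF refl U, of x B] that unfolding W_def by (metis someI)
  have neU: "U \<noteq> bot" using U by (simp add: ultra_def)
  define H where "H = rec_nat b (\<lambda>_ H t. W (\<lambda>l. H (t @ [l])))"
  have H0: "H 0 t = b t" and HS: "H (Suc n) t = W (\<lambda>l. H n (t @ [l]))" for n t
    by (simp_all add: H_def)
  have Hb: "norm (H n t) \<le> B" for n t
  proof (induction n arbitrary: t)
    case 0 then show ?case by (simp add: H0 b)
  next
    case (Suc n)
    then show ?case unfolding HS by (intro weak_lim_norm_le[OF W neU]) auto
  qed
  show ?thesis
  proof (rule that[of "\<lambda>t. H (k - length t) t"])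
    show "H (k - length t) t = b t" if "length t = k" for t using that by (simp add: H0)
    fix t :: "nat list" assume "length t < k"
    then have "k - length t = Suc (k - length (t @ [0]))" by simp
    then show "weak_lim U (\<lambda>l. H (k - length (t @ [l])) (t @ [l])) (H (k - length t) t)"
      using W[of "\<lambda>l. H (k - Suc (length t)) (t @ [l])"] Hb by (simp add: HS)
  qed
qed

text \<open>Of the two factors, \<open>C + 1\<close> bounds, in units of \<open>Lip(f)\<close>, the distance of the values on an infinite set from the total weak limit, and 2 passes from a radius to a diameter.\<close>

theorem asymptotic_c0_imp_concentration:
  assumes refl: "reflexive_space TYPE('a::banach)" and C: "C_asymptotic_c0 C TYPE('a)" "C \<ge> 1"
  shows "concentration (2 * (C + 1)) TYPE('a)"
  unfolding concentration_def
proof (intro allI impI)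
  fix k :: nat and f :: "nat set \<Rightarrow> 'a"
  assume k: "1 \<le> k" and f: "Hamming_Lipschitz k f"
  define L where "L = Hamming_Lip k f"
  have L0: "L \<ge> 0" unfolding L_def by (rule Lip_nonneg[OF f k])
  have lip: "norm (f A - f B) \<le> L * hamming_dist k A B" if "A \<in> [UNIV]\<^bsup>k\<^esup>" "B \<in> [UNIV]\<^bsup>k\<^esup>" for A B
    using lipschitz_Hamming[OF f that] by (simp add: L_def dist_norm)
  obtain U :: "nat filter" where U: "U \<le> sequentially" "ultra U"
    using exists_ultra[of sequentially] by auto
  have neU: "U \<noteq> bot" using U(2) by (simp add: ultra_def)
  have srt: "eventually (\<lambda>l. sorted_wrt (<) (t @ [l])) U" if "sorted_wrt (<) t" for t
    using iter_ev_sorted[OF U(1) that, of 1] by simp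
  have set_in: "set t \<in> [UNIV]\<^bsup>k\<^esup>" and slos: "sorted_list_of_set (set t) = t"
    if "sorted_wrt (<) t" "length t = k" for t
    using that by (auto simp: nsets_def distinct_card strict_sorted_iff intro: sorted_list_of_set.idem_if_sorted_distinct)
  have hd: "hamming_dist k A B \<le> real k" for A B
  proof -
    have "card {i. i < k \<and> sorted_list_of_set A ! i \<noteq> sorted_list_of_set B ! i} \<le> card {..<k}"
      by (rule card_mono) auto
    then show ?thesis by (simp add: hamming_dist_def)
  qed
  define b where "b t = (if sorted_wrt (<) t \<and> length t = k then f (set t) else 0)" for t
  obtain A0 :: "nat set" where A0: "A0 \<in> [UNIV]\<^bsup>k\<^esup>" using set_in[of "[0..<k]"] by auto
  have "norm (b t) \<le> norm (f A0) + L * real k" for t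
  proof (cases "sorted_wrt (<) t \<and> length t = k")
    case True
    have "norm (f (set t)) \<le> norm (f A0) + norm (f (set t) - f A0)" by (metis add.commute diff_add_cancel norm_triangle_ineq)
    moreover have "norm (f (set t) - f A0) \<le> L * hamming_dist k (set t) A0"
      using True set_in by (intro lip A0) blast
    moreover have "L * hamming_dist k (set t) A0 \<le> L * real k" using hd L0 by (rule mult_left_mono)
    ultimately show ?thesis using True by (simp add: b_def)
  next
    case False
    have "0 \<le> norm (f A0) + L * real k" using L0 by simp
    then show ?thesis using False unfolding b_def by auto
  qed
  then obtain h where h: "\<And>t. length t = k \<Longrightarrow> h t = b t" "\<And>t. length t < k \<Longrightarrow> weak_lim U (\<lambda>l. h (t @ [l])) (h t)"
    using weak_limit_tree[OF refl U(2)] by metis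
  \<comment> \<open>The Lipschitz estimate passes to the weak limits, from the leaves to the root.\<close>
  have hlip: "norm (h s - h s') \<le> L"
    if "sorted_wrt (<) s" "sorted_wrt (<) s'" "length s + n = k" "length s' = length s" "card {i. i < length s \<and> s ! i \<noteq> s' ! i} \<le> 1"
    for n s s'
    using that
  proof (induction n arbitrary: s s')
    case 0
    have "norm (f (set s) - f (set s')) \<le> L * hamming_dist k (set s) (set s')"
      using 0 by (intro lip set_in) auto
    also have "hamming_dist k (set s) (set s') \<le> 1"
      using 0 slos[of s] slos[of s'] unfolding hamming_dist_def by simp
    then have "L * hamming_dist k (set s) (set s') \<le> L * 1" using L0 by (rule mult_left_mono)
    finally show ?case using 0 by (simp add: h b_def)
  next
    case (Suc n)
    have "eventually (\<lambda>l. norm (h (s @ [l]) - h (s' @ [l])) \<le> L) U"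
      using srt[OF Suc.prems(1)] srt[OF Suc.prems(2)]
    proof eventually_elim
      case (elim l)
      have "{i. i < length (s @ [l]) \<and> (s @ [l]) ! i \<noteq> (s' @ [l]) ! i} \<subseteq> {i. i < length s \<and> s ! i \<noteq> s' ! i}"
        using Suc.prems(4) by (auto simp: nth_append less_Suc_eq split: if_splits)
      then have "card {i. i < length (s @ [l]) \<and> (s @ [l]) ! i \<noteq> (s' @ [l]) ! i} \<le> card {i. i < length s \<and> s ! i \<noteq> s' ! i}"
        by (intro card_mono) auto
      then show ?case using Suc.prems by (intro Suc.IH elim) simp_all
    qed
    moreover have "weak_lim U (\<lambda>l. h (s @ [l]) - h (s' @ [l])) (h s - h s')"
      using Suc.prems by (intro weak_lim_diff h) auto
    ultimately show ?case using weak_lim_norm_le neU by blast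
  qed
  have step: "norm (h (t @ [l]) - h t) \<le> L" if t: "sorted_wrt (<) (t @ [l])" "length t < k" for t l
  proof -
    have st: "sorted_wrt (<) t" using t(1) by (simp add: sorted_wrt_append)
    have "eventually (\<lambda>l'. norm (h (t @ [l]) - h (t @ [l'])) \<le> L) U"
      using srt[OF st]
    proof eventually_elim
      case (elim l')
      have "{i. i < length (t @ [l]) \<and> (t @ [l]) ! i \<noteq> (t @ [l']) ! i} \<subseteq> {length t}"
        by (auto simp: nth_append less_Suc_eq)
      then have "card {i. i < length (t @ [l]) \<and> (t @ [l]) ! i \<noteq> (t @ [l']) ! i} \<le> card {length t}"
        by (intro card_mono) auto
      then show ?case using t elim by (intro hlip[of _ _ "k - Suc (length t)"]) auto
    qed
    then show ?thesis using weak_lim_norm_le[OF weak_lim_diff[OF weak_lim_const h(2)[OF t(2)]] neU] by blast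
  qed
  show "\<exists>M. infinite M \<and> diameter (f ` ([M]\<^bsup>k\<^esup>)) \<le> 2 * (C + 1) * Hamming_Lip k f"
  proof (cases "L = 0")
    case True
    have const: "f A = f B" if "A \<in> [UNIV]\<^bsup>k\<^esup>" "B \<in> [UNIV]\<^bsup>k\<^esup>" for A B
      using lip[OF that] unfolding True by simp
    have "diameter (f ` ([UNIV]\<^bsup>k\<^esup>)) \<le> 0"
    proof (rule diameter_le)
      fix v w assume "v \<in> f ` ([UNIV]\<^bsup>k\<^esup>)" "w \<in> f ` ([UNIV]\<^bsup>k\<^esup>)"
      then obtain A B where "A \<in> [UNIV]\<^bsup>k\<^esup>" "v = f A" "B \<in> [UNIV]\<^bsup>k\<^esup>" "w = f B" by (elim imageE)
      then show "norm (v - w) \<le> 0" using const[of A B] by simp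
    qed simp
    moreover have "2 * (C + 1) * Hamming_Lip k f = 0" using True by (simp add: L_def)
    ultimately show ?thesis using infinite_UNIV_nat by metis
  next
    case False
    then have Lp: "L > 0" using L0 by simp
    define x where "x t = (if t \<noteq> [] \<and> length t \<le> k \<and> sorted_wrt (<) t then (1 / L) *\<^sub>R (h t - h (butlast t)) else 0)" for t
    have x1: "norm (x t) \<le> 1" for t
    proof (cases "t \<noteq> [] \<and> length t \<le> k \<and> sorted_wrt (<) t")
      case True
      then have "t = butlast t @ [last t]" "length (butlast t) < k" by (simp, cases t, auto)
      then have "norm (h t - h (butlast t)) \<le> L" using step[of "butlast t" "last t"] True by simp
      then show ?thesis using True Lp by (simp add: x_def)
    next
      case False
      then show ?thesis unfolding x_def by (simp only: if_False norm_zero zero_le_one)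
    qed
    have xwn: "weak_lim U (\<lambda>l. x (t @ [l])) 0" for t
    proof (cases "length t < k \<and> sorted_wrt (<) t")
      case True
      have "eventually (\<lambda>l. (1 / L) *\<^sub>R (h (t @ [l]) - h t) = x (t @ [l])) U"
        using srt[of t] True by (auto simp: x_def elim!: eventually_mono)
      moreover have "weak_lim U (\<lambda>l. (1 / L) *\<^sub>R (h (t @ [l]) - h t)) ((1 / L) *\<^sub>R (h t - h t))"
        using True by (intro weak_lim_scaleR weak_lim_diff h weak_lim_const) simp
      then have "weak_lim U (\<lambda>l. (1 / L) *\<^sub>R (h (t @ [l]) - h t)) 0" by simp
      ultimately show ?thesis by (rule weak_lim_cong)
    next
      case False
      then have "x (t @ [l]) = 0" for l by (auto simp: x_def sorted_wrt_append)
      then show ?thesis by (simp add: weak_lim_const)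
    qed
    have "C \<ge> 0" using C(2) by simp
    from iter_ev_conj[OF weak_null_tree_bound[OF refl C(1) this U(2,1) k x1 xwn] iter_ev_length[of U k "[]"]]
    have "iter_ev U k (\<lambda>t. norm (\<Sum>i<k. x (take (Suc i) t)) \<le> C + 1 \<and> length t = k) []" by simp
    then obtain M :: "nat set" where M: "infinite M"
      "\<And>t. sorted_wrt (<) t \<Longrightarrow> set t \<subseteq> M \<Longrightarrow> length t = k \<Longrightarrow> norm (\<Sum>i<k. x (take (Suc i) t)) \<le> C + 1 \<and> length t = k"
      by (rule iter_ev_infinite_set[OF U(1) neU]) (rule that; assumption)
    have near: "norm (f A - h []) \<le> (C + 1) * L" if A: "A \<in> [M]\<^bsup>k\<^esup>" for A
    proof -
      define t where "t = sorted_list_of_set A"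
      have t: "sorted_wrt (<) t" "length t = k" "set t = A"
        using A by (auto simp: t_def nsets_def strict_sorted_list_of_set)
      have "(\<Sum>i<n. x (take (Suc i) t)) = (1 / L) *\<^sub>R (h (take n t) - h [])" if "n \<le> k" for n
        using that
      proof (induction n)
        case (Suc n)
        have "sorted_wrt (<) (take (Suc n) t)" using t(1) by (rule sorted_wrt_take)
        moreover have "length (take (Suc n) t) \<le> k" "take (Suc n) t \<noteq> []" using t(2) Suc.prems by auto
        moreover have "butlast (take (Suc n) t) = take n t" using t(2) Suc.prems by (simp add: butlast_take)
        ultimately have "x (take (Suc n) t) = (1 / L) *\<^sub>R (h (take (Suc n) t) - h (take n t))" by (simp add: x_def)
        then show ?case using Suc by (simp add: algebra_simps)
      qed simp
      from this[of k] have "(\<Sum>i<k. x (take (Suc i) t)) = (1 / L) *\<^sub>R (f A - h [])"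
        using t h(1)[of t] by (simp add: b_def)
      then have "norm (f A - h []) / L \<le> C + 1" using M(2)[of t] t A Lp by (auto simp: nsets_def)
      then show ?thesis using Lp by (simp add: field_simps)
    qed
    have "diameter (f ` ([M]\<^bsup>k\<^esup>)) \<le> 2 * (C + 1) * L"
    proof (rule diameter_le)
      show "f ` ([M]\<^bsup>k\<^esup>) \<noteq> {} \<or> 0 \<le> 2 * (C + 1) * L" using C(2) L0 by simp
      fix v w assume "v \<in> f ` ([M]\<^bsup>k\<^esup>)" "w \<in> f ` ([M]\<^bsup>k\<^esup>)"
      then obtain A B where AB: "A \<in> [M]\<^bsup>k\<^esup>" "B \<in> [M]\<^bsup>k\<^esup>" "v = f A" "w = f B" by blast
      have "norm (v - w) \<le> norm (f A - h []) + norm (f B - h [])"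
        using norm_triangle_ineq4[of "f A - h []" "f B - h []"] AB by simp
      then show "norm (v - w) \<le> 2 * (C + 1) * L" using near[OF AB(1)] near[OF AB(2)]
        by (simp add: algebra_simps)
    qed
    then show ?thesis using M(1) unfolding L_def by blast
  qed
qed

section \<open>Characterization by concentration on Hamming graphs\<close>

theorem theoremB:
  shows "(reflexive_space TYPE('a::banach) \<and> asymptotic_c0 TYPE('a)) \<longleftrightarrow>
    (\<exists>C::real. C \<ge> 1 \<and>
      (\<forall>k::nat. k \<ge> 1 \<longrightarrow>
        (\<forall>f :: nat set \<Rightarrow> 'a.
          is_Lipschitz ([UNIV]\<^bsup>k\<^esup>) (hamming_dist k) f \<longrightarrow>
          (\<exists>M :: nat set. infinite M \<and>
            diameter (f ` ([M]\<^bsup>k\<^esup>)) \<le> C * Lip ([UNIV]\<^bsup>k\<^esup>) (hamming_dist k) f))))"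
proof -
  have "(reflexive_space TYPE('a) \<and> asymptotic_c0 TYPE('a)) \<longleftrightarrow> (\<exists>C. C \<ge> 1 \<and> concentration C TYPE('a))"
  proof
    assume X: "reflexive_space TYPE('a) \<and> asymptotic_c0 TYPE('a)"
    then obtain C where C: "C \<ge> 1" "C_asymptotic_c0 C TYPE('a)" by (auto simp: asymptotic_c0_def)
    then have "concentration (2 * (C + 1)) TYPE('a)"
      using X by (intro asymptotic_c0_imp_concentration) auto
    then show "\<exists>C. C \<ge> 1 \<and> concentration C TYPE('a)"
      using C(1) by (intro exI[of _ "2 * (C + 1)"]) simp
  next
    assume "\<exists>C. C \<ge> 1 \<and> concentration C TYPE('a)"
    then show "reflexive_space TYPE('a) \<and> asymptotic_c0 TYPE('a)"
      using concentration_imp_reflexive concentration_imp_asymptotic_c0 by blast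
  qed
  then show ?thesis unfolding concentration_def .
qed

end
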